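(* Let $G$ be a compact Lie group and $H<G$ a subgroup of finite index $n=[G:H]$. Let $\{t_1,\dots,t_n\}$ be a transversal of $H$ in $G$ (a set of representatives of the left cosets $G/H$), and let $\alpha\colon G\to\Sigma_n\wr H$, $\kappa\colon B_{G/H}G\to H$ and $\beta\colon B_{G/H}G\to B_{\underline{n}}\Sigma_n\times H$ be the homomorphism, the equivalence of categories and the functor determined by this one transversal (as defined in the context). Then the diagram of functors with upper triangle $$\kappa^*=\beta^*\circ c\colon \mathcal{S}^H\longrightarrow \mathcal{S}^{B_{G/H}G}$$ and lower square $$p_*^{\wedge}\circ\beta^*\;=\;\alpha^*\circ\underline{n}^{\wedge}\colon \mathcal{S}^{B_{\underline{n}}\Sigma_n\times H}\longrightarrow \mathcal{S}^{G}$$ commutes. Consequently the Hill--Hopkins--Ravenel norm map $p_*^{\wedge}\circ\kappa^*\colon\mathcal{S}^H\to\mathcal{S}^G$ and the Greenlees--May norm map $\alpha^*\circ\wedge^n=\alpha^*\circ\underline{n}^{\wedge}\circ c\colon\mathcal{S}^H\to\mathcal{S}^G$ agree.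
   Context: $\mathcal{S}$ is the category of orthogonal spectra with its symmetric monoidal smash product $\wedge$. A group is regarded as a one-object category (the object of $G$ is written $\ast_G$, and similarly for other groups); for a groupoid $K$, $\mathcal{S}^K$ denotes the category of covariant functors $K\to\mathcal{S}$ and natural transformations. In particular $G$-spectra are objects of $\mathcal{S}^G$. Unordered smash products: a smash product $\bigwedge_{i\in A}$ indexed by a finite unordered set $A$ is well defined up to the canonical coherence isomorphisms of the symmetric monoidal structure; a bijection $\phi\colon A\to A'$ together with maps $X(i)\to X'(\phi(i))$ induces a map $\bigwedge_{i\in A}X(i)\to\bigwedge_{i'\in A'}X'(i')$. In particular, for a permutation $\sigma$ of $A$, $\bigwedge_{i\in A}X(\sigma(i))$ is identified with $\bigwedge_{i\in A}X(i)$. Functors built from such products are defined, and equalities between them are understood, up to these canonical natural isomorphisms. Groupoids: $B_{G/H}G$ is the translation groupoid of $G$ acting on $G/H$: objects $x\in G/H$, and for each $g\in G$ and $x\in G/H$ a morphism $g_x\colon x\to gx$, with composition given by multiplication in $G$. The inclusion $\iota\colon H\to B_{G/H}G$ sending $\ast_H$ to the identity coset $eH$ is an equivalence of categories. Let $\underline{n}=\{1,\dots,n\}$; $B_{\underline{n}}\Sigma_n$ is the translation groupoid of the symmetric group $\Sigma_n$ acting on $\underline{n}$, with morphisms $\sigma_i\colon i\to\sigma(i)$ for $\sigma\in\Sigma_n$, $i\in\underline{n}$. Objects of $B_{\underline{n}}\Sigma_n\times H$ are identified with elements $i\in\underline{n}$, and its morphisms are pairs $(\sigma_i,h)\colon i\to\sigma(i)$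 with $\sigma\in\Sigma_n$, $h\in H$. The wreath product $\Sigma_n\wr H$ consists of tuples $(\sigma,h_1,\dots,h_n)$ with product $(\sigma,h_1,\dots,h_n)(\tau,k_1,\dots,k_n)=(\sigma\tau,h_{\tau(1)}k_1,\dots,h_{\tau(n)}k_n)$. Data determined by the transversal $\{t_1,\dots,t_n\}$: for $g\in G$ and $i\in\underline{n}$ define $\sigma_g\in\Sigma_n$ and $h_i(g)\in H$ by $gt_i=t_{\sigma_g(i)}h_i(g)$. Write $g_i\colon t_iH\to t_{\sigma_g(i)}H$ for the morphism $g_{t_iH}$ of $B_{G/H}G$. - $\alpha\colon G\to\Sigma_n\wr H$ is the homomorphism $\alpha(g)=(\sigma_g,h_1(g),\dots,h_n(g))$. - $\kappa\colon B_{G/H}G\to H$ is the functor with $\kappa(g_i)=h_i(g)\colon\ast_H\to\ast_H$; it is an equivalence of categories inverse to $\iota$. - $\beta\colon B_{G/H}G\to B_{\underline{n}}\Sigma_n\times H$ is the functor with $\beta(t_iH)=i$ and $\beta(g_i)=((\sigma_g)_i,h_i(g))\colon i\to\sigma_g(i)$. Functors in the diagram: $\alpha^*,\beta^*,\kappa^*$ are precomposition with $\alpha,\beta,\kappa$. The functor $c\colon\mathcal{S}^H\to\mathcal{S}^{B_{\underline{n}}\Sigma_n\times H}$ is precomposition with the projection $B_{\underline{n}}\Sigma_n\times H\to H$. The functor $p_*^{\wedge}\colon\mathcal{S}^{B_{G/H}G}\to\mathcal{S}^G$ is given by $(p_*^{\wedge}X)(\ast_G)=\bigwedge_{x\in G/H}X(x)$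 and $(p_*^{\wedge}X)(g)=\bigwedge_{x}X(g_x)\colon\bigwedge_{x\in G/H}X(x)\to\bigwedge_{x\in G/H}X(gx)$, and on a natural transformation $f$ by $\bigwedge_x f_x$. The functor $\underline{n}^{\wedge}\colon\mathcal{S}^{B_{\underline{n}}\Sigma_n\times H}\to\mathcal{S}^{\Sigma_n\wr H}$ is given by $(\underline{n}^{\wedge}X)(\ast_{\Sigma_n\wr H})=\bigwedge_{i\in\underline{n}}X(i)$ and $(\underline{n}^{\wedge}X)(\sigma,h_1,\dots,h_n)=\bigwedge_{i\in\underline{n}}X(\sigma_i,h_i)\colon\bigwedge_{i}X(i)\to\bigwedge_{i}X(\sigma(i))$, and on a natural transformation $f$ by $\bigwedge_i f_i$. Norm maps: the Hill--Hopkins--Ravenel norm $\mathcal{S}^H\to\mathcal{S}^G$ is the composite of the equivalence $\mathcal{S}^H\to\mathcal{S}^{B_{G/H}G}$ given by precomposition with a chosen inverse equivalence $\kappa$ to $\iota$, followed by $p_*^{\wedge}$. The Greenlees--May norm is the composite of the $n$-fold smash power functor $\wedge^n\colon\mathcal{S}^H\to\mathcal{S}^{\Sigma_n\wr H}$, which is $\underline{n}^{\wedge}\circ c$, followed by $\alpha^*$. *)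

theory Defs
  imports "HOL-Analysis.Analysis" "HOL-Algebra.Left_Coset" "HOL-Algebra.Sym_Groups"
begin

section \<open>Compact Lie groups\<close>

type_synonym vec = "nat \<Rightarrow> real"

text \<open>Vectors of \<open>\<real>^d\<close> are the points of \<^term>\<open>Euclidean_space d\<close>: sequences vanishing from
  index \<open>d\<close> on. This allows dimension \<open>0\<close>, so that finite groups are Lie groups.
  \<open>C_times k d W f\<close>: \<open>f\<close> is of class \<open>C^k\<close> on the open set \<open>W\<close> of \<open>\<real>^d\<close>.\<close>

primrec C_times :: "nat \<Rightarrow> nat \<Rightarrow> vec set \<Rightarrow> (vec \<Rightarrow> real) \<Rightarrow> bool" where
  "C_times 0 d W f \<longleftrightarrow> continuous_map (subtopology (Euclidean_space d) W) euclideanreal f"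
| "C_times (Suc k) d W f \<longleftrightarrow>
     continuous_map (subtopology (Euclidean_space d) W) euclideanreal f \<and>
     (\<forall>i<d. \<exists>f'. (\<forall>x\<in>W. ((\<lambda>s. f (x(i := s))) has_real_derivative f' x) (at (x i))) \<and>
                 C_times k d W f')"

definition smooth_map :: "nat \<Rightarrow> nat \<Rightarrow> vec set \<Rightarrow> (vec \<Rightarrow> vec) \<Rightarrow> bool" where
  "smooth_map d e W f \<longleftrightarrow>
     openin (Euclidean_space d) W \<and> (\<forall>j<e. \<forall>k. C_times k d W (\<lambda>x. f x j))"

definition left_part :: "nat \<Rightarrow> vec \<Rightarrow> vec" where
  "left_part d z = (\<lambda>i. if i < d then z i else 0)"

definition right_part :: "nat \<Rightarrow> vec \<Rightarrow> vec" where
  "right_part d z = (\<lambda>i. if i < d then z (d + i) else 0)"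

definition smooth_atlas :: "'g topology \<Rightarrow> nat \<Rightarrow> ('g set \<times> ('g \<Rightarrow> vec)) set \<Rightarrow> bool" where
  "smooth_atlas T d \<A> \<longleftrightarrow>
     (\<Union>(U, \<phi>)\<in>\<A>. U) = topspace T \<and>
     (\<forall>(U, \<phi>)\<in>\<A>. openin T U \<and> openin (Euclidean_space d) (\<phi> ` U) \<and>
        homeomorphic_map (subtopology T U) (subtopology (Euclidean_space d) (\<phi> ` U)) \<phi>) \<and>
     (\<forall>(U, \<phi>)\<in>\<A>. \<forall>(V, \<psi>)\<in>\<A>. smooth_map d d (\<phi> ` (U \<inter> V)) (\<lambda>x. \<psi> (inv_into U \<phi> x)))"

text \<open>Multiplication is tested in charts on \<open>\<real>^(d+d) = \<real>^d \<times> \<real>^d\<close>. Second countability is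
  automatic for compact manifolds.\<close>

definition compact_lie_group ::
    "('g, 'b) monoid_scheme \<Rightarrow> 'g topology \<Rightarrow> nat \<Rightarrow> ('g set \<times> ('g \<Rightarrow> vec)) set \<Rightarrow> bool" where
  "compact_lie_group G T d \<A> \<longleftrightarrow>
     group G \<and> topspace T = carrier G \<and> compact_space T \<and> Hausdorff_space T \<and>
     smooth_atlas T d \<A> \<and>
     continuous_map (prod_topology T T) T (\<lambda>(x, y). x \<otimes>\<^bsub>G\<^esub> y) \<and>
     continuous_map T T (\<lambda>x. inv\<^bsub>G\<^esub> x) \<and>
     (\<forall>(U, \<phi>)\<in>\<A>. \<forall>(V, \<psi>)\<in>\<A>. \<forall>(W, \<theta>)\<in>\<A>.
        smooth_map (d + d) d
          {z \<in> topspace (Euclidean_space (d + d)).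
             left_part d z \<in> \<phi> ` U \<and> right_part d z \<in> \<psi> ` V \<and>
             inv_into U \<phi> (left_part d z) \<otimes>\<^bsub>G\<^esub> inv_into V \<psi> (right_part d z) \<in> W}
          (\<lambda>z. \<theta> (inv_into U \<phi> (left_part d z) \<otimes>\<^bsub>G\<^esub> inv_into V \<psi> (right_part d z)))) \<and>
     (\<forall>(U, \<phi>)\<in>\<A>. \<forall>(V, \<psi>)\<in>\<A>.
        smooth_map d d (\<phi> ` {x \<in> U. inv\<^bsub>G\<^esub> x \<in> V}) (\<lambda>x. \<psi> (inv\<^bsub>G\<^esub> (inv_into U \<phi> x))))"


section \<open>Categories, functors, functor categories\<close>

record ('o, 'm) category =
  Ob :: "'o set"
  Ar :: "'m set"
  Dom :: "'m \<Rightarrow> 'o"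
  Cod :: "'m \<Rightarrow> 'o"
  Idn :: "'o \<Rightarrow> 'm"
  Cmp :: "'m \<Rightarrow> 'm \<Rightarrow> 'm"

definition is_category :: "('o, 'm) category \<Rightarrow> bool" where
  "is_category C \<longleftrightarrow>
     (\<forall>f\<in>Ar C. Dom C f \<in> Ob C \<and> Cod C f \<in> Ob C) \<and>
     (\<forall>x\<in>Ob C. Idn C x \<in> Ar C \<and> Dom C (Idn C x) = x \<and> Cod C (Idn C x) = x) \<and>
     (\<forall>f\<in>Ar C. \<forall>g\<in>Ar C. Dom C g = Cod C f \<longrightarrow>
        Cmp C g f \<in> Ar C \<and> Dom C (Cmp C g f) = Dom C f \<and> Cod C (Cmp C g f) = Cod C g) \<and>
     (\<forall>f\<in>Ar C. Cmp C f (Idn C (Dom C f)) = f \<and> Cmp C (Idn C (Cod C f)) f = f) \<and>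
     (\<forall>f\<in>Ar C. \<forall>g\<in>Ar C. \<forall>h\<in>Ar C. Dom C g = Cod C f \<longrightarrow> Dom C h = Cod C g \<longrightarrow>
        Cmp C h (Cmp C g f) = Cmp C (Cmp C h g) f)"

definition is_iso :: "('o, 'm) category \<Rightarrow> 'm \<Rightarrow> bool" where
  "is_iso C f \<longleftrightarrow> f \<in> Ar C \<and>
     (\<exists>g\<in>Ar C. Dom C g = Cod C f \<and> Cod C g = Dom C f \<and>
        Cmp C g f = Idn C (Dom C f) \<and> Cmp C f g = Idn C (Cod C f))"

record ('o, 'm, 'p, 'n) fctr =
  Src :: "('o, 'm) category"
  Tgt :: "('p, 'n) category"
  Fo :: "'o \<Rightarrow> 'p"
  Fa :: "'m \<Rightarrow> 'n"

text \<open>Object and arrow maps are extensional, so equality of records is equality of functors.\<close>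

definition is_functor ::
    "('o, 'm) category \<Rightarrow> ('p, 'n) category \<Rightarrow> ('o, 'm, 'p, 'n) fctr \<Rightarrow> bool" where
  "is_functor C D F \<longleftrightarrow>
     is_category C \<and> is_category D \<and> Src F = C \<and> Tgt F = D \<and>
     Fo F \<in> Ob C \<rightarrow>\<^sub>E Ob D \<and> Fa F \<in> Ar C \<rightarrow>\<^sub>E Ar D \<and>
     (\<forall>f\<in>Ar C. Dom D (Fa F f) = Fo F (Dom C f) \<and> Cod D (Fa F f) = Fo F (Cod C f)) \<and>
     (\<forall>x\<in>Ob C. Fa F (Idn C x) = Idn D (Fo F x)) \<and>
     (\<forall>f\<in>Ar C. \<forall>g\<in>Ar C. Dom C g = Cod C f \<longrightarrow>
        Fa F (Cmp C g f) = Cmp D (Fa F g) (Fa F f))"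

definition fid :: "('o, 'm) category \<Rightarrow> ('o, 'm, 'o, 'm) fctr" where
  "fid C = \<lparr>Src = C, Tgt = C, Fo = (\<lambda>x\<in>Ob C. x), Fa = (\<lambda>f\<in>Ar C. f)\<rparr>"

definition fcomp ::
    "('p, 'n, 'q, 'k) fctr \<Rightarrow> ('o, 'm, 'p, 'n) fctr \<Rightarrow> ('o, 'm, 'q, 'k) fctr"
    (infixr \<open>\<circ>\<^sub>F\<close> 55) where
  "G \<circ>\<^sub>F F = \<lparr>Src = Src F, Tgt = Tgt G,
     Fo = (\<lambda>x\<in>Ob (Src F). Fo G (Fo F x)), Fa = (\<lambda>f\<in>Ar (Src F). Fa G (Fa F f))\<rparr>"

definition nat_trans ::
    "('o, 'm) category \<Rightarrow> ('p, 'n) category \<Rightarrow>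
     ('o, 'm, 'p, 'n) fctr \<Rightarrow> ('o, 'm, 'p, 'n) fctr \<Rightarrow> ('o \<Rightarrow> 'n) \<Rightarrow> bool" where
  "nat_trans C D F F' \<eta> \<longleftrightarrow>
     is_functor C D F \<and> is_functor C D F' \<and> \<eta> \<in> Ob C \<rightarrow>\<^sub>E Ar D \<and>
     (\<forall>x\<in>Ob C. Dom D (\<eta> x) = Fo F x \<and> Cod D (\<eta> x) = Fo F' x) \<and>
     (\<forall>f\<in>Ar C. Cmp D (\<eta> (Cod C f)) (Fa F f) = Cmp D (Fa F' f) (\<eta> (Dom C f)))"

definition nat_iso ::
    "('o, 'm) category \<Rightarrow> ('p, 'n) category \<Rightarrow>
     ('o, 'm, 'p, 'n) fctr \<Rightarrow> ('o, 'm, 'p, 'n) fctr \<Rightarrow> ('o \<Rightarrow> 'n) \<Rightarrow> bool" where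
  "nat_iso C D F F' \<eta> \<longleftrightarrow> nat_trans C D F F' \<eta> \<and> (\<forall>x\<in>Ob C. is_iso D (\<eta> x))"

type_synonym ('o, 'm, 'p, 'n) ntrans =
  "('o, 'm, 'p, 'n) fctr \<times> ('o, 'm, 'p, 'n) fctr \<times> ('o \<Rightarrow> 'n)"

definition fun_cat ::
    "('o, 'm) category \<Rightarrow> ('p, 'n) category \<Rightarrow>
     (('o, 'm, 'p, 'n) fctr, ('o, 'm, 'p, 'n) ntrans) category" where
  "fun_cat K C =
     \<lparr>Ob = {F. is_functor K C F},
      Ar = {(F, F', \<eta>). nat_trans K C F F' \<eta>},
      Dom = (\<lambda>(F, F', \<eta>). F),
      Cod = (\<lambda>(F, F', \<eta>). F'),
      Idn = (\<lambda>F. (F, F, \<lambda>x\<in>Ob K. Idn C (Fo F x))),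
      Cmp = (\<lambda>(F1, F2, \<theta>) (F0, F1', \<eta>). (F0, F2, \<lambda>x\<in>Ob K. Cmp C (\<theta> x) (\<eta> x)))\<rparr>"

text \<open>The functor \<open>U\<^sup>*\<close> from \<open>C^L\<close> to \<open>C^K\<close> given by precomposition with \<open>U\<close> from \<open>K\<close> to \<open>L\<close>.\<close>

definition precomp ::
    "('p, 'n) category \<Rightarrow> ('k, 'l, 'o, 'm) fctr \<Rightarrow>
     (('o, 'm, 'p, 'n) fctr, ('o, 'm, 'p, 'n) ntrans,
      ('k, 'l, 'p, 'n) fctr, ('k, 'l, 'p, 'n) ntrans) fctr" where
  "precomp C U =
     \<lparr>Src = fun_cat (Tgt U) C, Tgt = fun_cat (Src U) C,
      Fo = (\<lambda>F\<in>Ob (fun_cat (Tgt U) C). F \<circ>\<^sub>F U),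
      Fa = (\<lambda>(F, F', \<eta>)\<in>Ar (fun_cat (Tgt U) C).
              (F \<circ>\<^sub>F U, F' \<circ>\<^sub>F U, \<lambda>x\<in>Ob (Src U). \<eta> (Fo U x)))\<rparr>"

definition group_cat :: "('g, 'b) monoid_scheme \<Rightarrow> (unit, 'g) category" where
  "group_cat G = \<lparr>Ob = {()}, Ar = carrier G, Dom = (\<lambda>_. ()), Cod = (\<lambda>_. ()),
     Idn = (\<lambda>_. \<one>\<^bsub>G\<^esub>), Cmp = (\<lambda>g f. g \<otimes>\<^bsub>G\<^esub> f)\<rparr>"

text \<open>The pair \<open>(g, x)\<close> is the morphism \<open>g\<^sub>x\<close> from \<open>x\<close> to \<open>gx\<close>.\<close>

definition translation_groupoid ::
    "('g, 'b) monoid_scheme \<Rightarrow> 'x set \<Rightarrow> ('g \<Rightarrow> 'x \<Rightarrow> 'x) \<Rightarrow> ('x, 'g \<times> 'x) category" where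
  "translation_groupoid G X act =
     \<lparr>Ob = X, Ar = carrier G \<times> X, Dom = (\<lambda>(g, x). x), Cod = (\<lambda>(g, x). act g x),
      Idn = (\<lambda>x. (\<one>\<^bsub>G\<^esub>, x)), Cmp = (\<lambda>(g', y) (g, x). (g' \<otimes>\<^bsub>G\<^esub> g, x))\<rparr>"

definition prod_cat ::
    "('o, 'm) category \<Rightarrow> ('p, 'n) category \<Rightarrow> ('o \<times> 'p, 'm \<times> 'n) category" where
  "prod_cat C D =
     \<lparr>Ob = Ob C \<times> Ob D, Ar = Ar C \<times> Ar D, Dom = map_prod (Dom C) (Dom D),
      Cod = map_prod (Cod C) (Cod D), Idn = map_prod (Idn C) (Idn D),
      Cmp = (\<lambda>(g, g') (f, f'). (Cmp C g f, Cmp D g' f'))\<rparr>"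

definition snd_fctr ::
    "('o, 'm) category \<Rightarrow> ('p, 'n) category \<Rightarrow> ('o \<times> 'p, 'm \<times> 'n, 'p, 'n) fctr" where
  "snd_fctr C D = \<lparr>Src = prod_cat C D, Tgt = D,
     Fo = restrict snd (Ob (prod_cat C D)), Fa = restrict snd (Ar (prod_cat C D))\<rparr>"


section \<open>Compactly generated weak Hausdorff spaces\<close>

text \<open>It suffices to test with compact Hausdorff spaces \<open>K\<close> of points in \<^typ>\<open>'a set set\<close>:
  if \<open>u\<close> is a map from an arbitrary compact Hausdorff space to \<open>X\<close>, choose one point in each
  nonempty fibre; the closure of the set of these points has the same image under \<open>u\<close>, and it
  has at most \<open>2^2^|X|\<close> points.\<close>

definition weak_hausdorff :: "'a topology \<Rightarrow> bool" where
  "weak_hausdorff X \<longleftrightarrow>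
     (\<forall>(K :: 'a set set topology) u. compact_space K \<and> Hausdorff_space K \<and> continuous_map K X u
        \<longrightarrow> closedin X (u ` topspace K))"

text \<open>The k-ification of a weak Hausdorff space. Since images of compact Hausdorff spaces in a
  weak Hausdorff space are compact Hausdorff, it suffices to test on compact Hausdorff
  subspaces. (The library's \<^const>\<open>kification\<close> tests on all compact subsets, Hausdorff or not.)\<close>

definition kify :: "'a topology \<Rightarrow> 'a topology" where
  "kify X = topology (\<lambda>U. U \<subseteq> topspace X \<and>
     (\<forall>C\<subseteq>topspace X. compact_space (subtopology X C) \<and> Hausdorff_space (subtopology X C)
        \<longrightarrow> openin (subtopology X C) (U \<inter> C)))"

lemma openin_kify:
  "openin (kify X) U \<longleftrightarrow> U \<subseteq> topspace X \<and>
     (\<forall>C\<subseteq>topspace X. compact_space (subtopology X C) \<and> Hausdorff_space (subtopology X C)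
        \<longrightarrow> openin (subtopology X C) (U \<inter> C))"
proof -
  have "istopology (\<lambda>U. U \<subseteq> topspace X \<and>
     (\<forall>C\<subseteq>topspace X. compact_space (subtopology X C) \<and> Hausdorff_space (subtopology X C)
        \<longrightarrow> openin (subtopology X C) (U \<inter> C)))" (is "istopology ?P")
    unfolding istopology_def
  proof (rule conjI; intro allI impI)
    fix S T assume S: "?P S" and T: "?P T"
    show "?P (S \<inter> T)"
    proof (intro conjI allI impI)
      show "S \<inter> T \<subseteq> topspace X" using S by blast
      fix C assume C: "C \<subseteq> topspace X"
        "compact_space (subtopology X C) \<and> Hausdorff_space (subtopology X C)"
      have "openin (subtopology X C) ((S \<inter> C) \<inter> (T \<inter> C))"
        by (rule openin_Int) (use S T C in blast)+
      moreover have "S \<inter> T \<inter> C = (S \<inter> C) \<inter> (T \<inter> C)" by blast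
      ultimately show "openin (subtopology X C) (S \<inter> T \<inter> C)" by metis
    qed
  next
    fix \<K> assume *: "\<forall>K\<in>\<K>. ?P K"
    show "?P (\<Union>\<K>)"
    proof (intro conjI allI impI)
      show "\<Union>\<K> \<subseteq> topspace X" using * by blast
      fix C assume C: "C \<subseteq> topspace X"
        "compact_space (subtopology X C) \<and> Hausdorff_space (subtopology X C)"
      have "openin (subtopology X C) (\<Union>((\<lambda>K. K \<inter> C) ` \<K>))"
        by (rule openin_Union) (use * C in blast)
      moreover have "\<Union>\<K> \<inter> C = \<Union>((\<lambda>K. K \<inter> C) ` \<K>)" by blast
      ultimately show "openin (subtopology X C) (\<Union>\<K> \<inter> C)" by metis
    qed
  qed
  then show ?thesis by (simp add: kify_def topology_inverse')
qed

definition cgwh :: "'a topology \<Rightarrow> bool" where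
  "cgwh X \<longleftrightarrow> weak_hausdorff X \<and> kify X = X"

definition quot_topology :: "'a topology \<Rightarrow> 'a rel \<Rightarrow> 'a set topology" where
  "quot_topology X E =
     topology (\<lambda>U. U \<subseteq> topspace X // E \<and> openin X {x \<in> topspace X. E `` {x} \<in> U})"

lemma openin_quot_topology:
  "openin (quot_topology X E) U \<longleftrightarrow>
     U \<subseteq> topspace X // E \<and> openin X {x \<in> topspace X. E `` {x} \<in> U}"
proof -
  define p where "p U = {x \<in> topspace X. E `` {x} \<in> U}" for U
  have "istopology (\<lambda>U. U \<subseteq> topspace X // E \<and> openin X (p U))"
    unfolding istopology_def
  proof (rule conjI; intro allI impI)
    fix S T
    assume S: "S \<subseteq> topspace X // E \<and> openin X (p S)" and T: "T \<subseteq> topspace X // E \<and> openin X (p T)"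
    have "p (S \<inter> T) = p S \<inter> p T" by (auto simp: p_def)
    then have "openin X (p (S \<inter> T))" using S T by (simp add: openin_Int)
    moreover have "S \<inter> T \<subseteq> topspace X // E" by (rule subset_trans[OF Int_lower1]) (use S in simp)
    ultimately show "S \<inter> T \<subseteq> topspace X // E \<and> openin X (p (S \<inter> T))" by (intro conjI)
  next
    fix \<K> assume *: "\<forall>K\<in>\<K>. K \<subseteq> topspace X // E \<and> openin X (p K)"
    have "p (\<Union>\<K>) = \<Union>(p ` \<K>)" by (auto simp: p_def)
    moreover have "openin X (\<Union>(p ` \<K>))" by (rule openin_Union) (use * in auto)
    ultimately have "openin X (p (\<Union>\<K>))" by simp
    moreover have "\<Union>\<K> \<subseteq> topspace X // E" by (rule Sup_least) (use * in simp)
    ultimately show "\<Union>\<K> \<subseteq> topspace X // E \<and> openin X (p (\<Union>\<K>))" by (intro conjI)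
  qed
  then have "istopology (\<lambda>U. U \<subseteq> topspace X // E \<and> openin X {x \<in> topspace X. E `` {x} \<in> U})"
    unfolding p_def .
  then show ?thesis by (simp add: quot_topology_def topology_inverse')
qed

text \<open>The smallest equivalence relation containing \<open>R\<close> with weak Hausdorff quotient; forming the
  quotient by it is the colimit-type quotient in compactly generated weak Hausdorff spaces.\<close>

definition wh_equiv :: "'a topology \<Rightarrow> 'a rel \<Rightarrow> 'a rel" where
  "wh_equiv X R =
     \<Inter> {E. equiv (topspace X) E \<and> R \<subseteq> E \<and> weak_hausdorff (quot_topology X E)}"


section \<open>Orthogonal spectra\<close>

text \<open>An orthogonal spectrum is a continuous pointed functor to pointed compactly generated weak
  Hausdorff spaces from the topological category with objects \<open>\<real>^n\<close> and morphism spaces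
  \<open>J n m\<close>, the Thom space of the bundle of pairs \<open>(A, w)\<close>, where \<open>A\<close> is a linear isometric
  embedding of \<open>\<real>^n\<close> into \<open>\<real>^m\<close> and \<open>w\<close> is orthogonal to its image. As the base of this bundle is
  compact, the Thom space is the one-point compactification; the point at infinity is
  \<^const>\<open>None\<close>. Composition is \<open>(B, v) \<circ> (A, w) = (B A, v + B w)\<close>.\<close>

type_synonym mat = "nat \<Rightarrow> nat \<Rightarrow> real"

type_synonym jmor = "(mat \<times> vec) option"

definition mat_mult :: "nat \<Rightarrow> mat \<Rightarrow> mat \<Rightarrow> mat" where
  "mat_mult k B A = (\<lambda>i j. \<Sum>l<k. B i l * A l j)"

definition mat_vec :: "nat \<Rightarrow> mat \<Rightarrow> vec \<Rightarrow> vec" where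
  "mat_vec k B w = (\<lambda>i. \<Sum>l<k. B i l * w l)"

definition J_points :: "nat \<Rightarrow> nat \<Rightarrow> (mat \<times> vec) set" where
  "J_points n m = {(A, w).
     (\<forall>l a. A l a \<noteq> 0 \<longrightarrow> l < m \<and> a < n) \<and> (\<forall>l. w l \<noteq> 0 \<longrightarrow> l < m) \<and>
     (\<forall>a<n. \<forall>b<n. (\<Sum>l<m. A l a * A l b) = (if a = b then 1 else 0)) \<and>
     (\<forall>a<n. (\<Sum>l<m. A l a * w l) = 0)}"

definition J :: "nat \<Rightarrow> nat \<Rightarrow> jmor topology" where
  "J n m = Alexandroff_compactification (top_of_set (J_points n m))"

definition J_id :: "nat \<Rightarrow> jmor" where
  "J_id n = Some (\<lambda>l a. if l = a \<and> a < n then 1 else 0, \<lambda>_. 0)"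

text \<open>\<open>J_comp m g f\<close> is \<open>g \<circ> f\<close> for \<open>f\<close> with target \<open>\<real>^m\<close>.\<close>

definition J_comp :: "nat \<Rightarrow> jmor \<Rightarrow> jmor \<Rightarrow> jmor" where
  "J_comp m g f = (case (g, f) of
       (Some (B, v), Some (A, w)) \<Rightarrow> Some (mat_mult m B A, \<lambda>l. v l + mat_vec m B w l)
     | _ \<Rightarrow> None)"

record 'a spectrum =
  Sp :: "nat \<Rightarrow> 'a topology"
  bpt :: "nat \<Rightarrow> 'a"
  act :: "nat \<Rightarrow> nat \<Rightarrow> jmor \<Rightarrow> 'a \<Rightarrow> 'a"

definition orthogonal_spectrum :: "'a spectrum \<Rightarrow> bool" where
  "orthogonal_spectrum X \<longleftrightarrow>
     (\<forall>n. cgwh (Sp X n) \<and> bpt X n \<in> topspace (Sp X n)) \<and>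
     (\<forall>n m. continuous_map (kify (prod_topology (J n m) (Sp X n))) (Sp X m)
              (\<lambda>(f, x). act X n m f x)) \<and>
     (\<forall>n m. \<forall>f\<in>topspace (J n m). act X n m f (bpt X n) = bpt X m) \<and>
     (\<forall>n m. \<forall>x\<in>topspace (Sp X n). act X n m None x = bpt X m) \<and>
     (\<forall>n. \<forall>x\<in>topspace (Sp X n). act X n n (J_id n) x = x) \<and>
     (\<forall>n m p. \<forall>f\<in>topspace (J n m). \<forall>g\<in>topspace (J m p). \<forall>x\<in>topspace (Sp X n).
        act X n p (J_comp m g f) x = act X m p g (act X n m f x))"

definition spectrum_map :: "'a spectrum \<Rightarrow> 'a spectrum \<Rightarrow> (nat \<Rightarrow> 'a \<Rightarrow> 'a) \<Rightarrow> bool" where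
  "spectrum_map X Y f \<longleftrightarrow>
     orthogonal_spectrum X \<and> orthogonal_spectrum Y \<and>
     (\<forall>n. f n \<in> extensional (topspace (Sp X n)) \<and> continuous_map (Sp X n) (Sp Y n) (f n) \<and>
          f n (bpt X n) = bpt Y n) \<and>
     (\<forall>n m. \<forall>j\<in>topspace (J n m). \<forall>x\<in>topspace (Sp X n).
        f m (act X n m j x) = act Y n m j (f n x))"

type_synonym 'a spmor = "'a spectrum \<times> 'a spectrum \<times> (nat \<Rightarrow> 'a \<Rightarrow> 'a)"

definition spectrum_id :: "'a spectrum \<Rightarrow> nat \<Rightarrow> 'a \<Rightarrow> 'a" where
  "spectrum_id X n = (\<lambda>x\<in>topspace (Sp X n). x)"

definition Spectra :: "('a spectrum, 'a spmor) category" where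
  "Spectra =
     \<lparr>Ob = {X. orthogonal_spectrum X},
      Ar = {(X, Y, f). spectrum_map X Y f},
      Dom = (\<lambda>(X, Y, f). X),
      Cod = (\<lambda>(X, Y, f). Y),
      Idn = (\<lambda>X. (X, X, spectrum_id X)),
      Cmp = (\<lambda>(Y', Z, g) (X, Y, f). (X, Z, \<lambda>n. compose (topspace (Sp X n)) (g n) (f n)))\<rparr>"


section \<open>Smash products of orthogonal spectra\<close>

text \<open>The smash product of \<open>X 0, \<dots>, X (r - 1)\<close> is their Day convolution: level \<open>m\<close> is the coend over
  \<open>n 0, \<dots>, n (r - 1)\<close> of \<open>J(\<real>^(n 0) \<oplus> \<dots> \<oplus> \<real>^(n (r - 1)), \<real>^m) \<and> X 0 (n 0) \<and> \<dots> \<and> X (r - 1) (n (r - 1))\<close>.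
  A linear isometric embedding \<open>A\<close> of the direct sum is the family of its restrictions \<open>A i\<close> to the
  summands.\<close>

type_synonym jsum = "((nat \<Rightarrow> mat) \<times> vec) option"

definition Jsum_points :: "nat \<Rightarrow> (nat \<Rightarrow> nat) \<Rightarrow> nat \<Rightarrow> ((nat \<Rightarrow> mat) \<times> vec) set" where
  "Jsum_points r n m = {(A, w).
     (\<forall>i l a. A i l a \<noteq> 0 \<longrightarrow> i < r \<and> l < m \<and> a < n i) \<and> (\<forall>l. w l \<noteq> 0 \<longrightarrow> l < m) \<and>
     (\<forall>i<r. \<forall>k<r. \<forall>a<n i. \<forall>b<n k.
        (\<Sum>l<m. A i l a * A k l b) = (if i = k \<and> a = b then 1 else 0)) \<and>
     (\<forall>i<r. \<forall>a<n i. (\<Sum>l<m. A i l a * w l) = 0)}"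

definition Jsum :: "nat \<Rightarrow> (nat \<Rightarrow> nat) \<Rightarrow> nat \<Rightarrow> jsum topology" where
  "Jsum r n m = Alexandroff_compactification (top_of_set (Jsum_points r n m))"

text \<open>\<open>F \<circ> (f 0 \<oplus> \<dots> \<oplus> f (r - 1))\<close> where \<open>f i\<close> has target \<open>\<real>^(n i)\<close>.\<close>

definition Jsum_pre :: "nat \<Rightarrow> (nat \<Rightarrow> nat) \<Rightarrow> jsum \<Rightarrow> (nat \<Rightarrow> jmor) \<Rightarrow> jsum" where
  "Jsum_pre r n F f = (case F of
       None \<Rightarrow> None
     | Some (A, w) \<Rightarrow>
         if \<exists>i<r. f i = None then None
         else Some (\<lambda>i. if i < r then mat_mult (n i) (A i) (fst (the (f i))) else (\<lambda>_ _. 0),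
                    \<lambda>l. w l + (\<Sum>i<r. mat_vec (n i) (A i) (snd (the (f i))) l)))"

text \<open>\<open>g \<circ> F\<close> where \<open>F\<close> has target \<open>\<real>^m\<close>.\<close>

definition Jsum_post :: "nat \<Rightarrow> jmor \<Rightarrow> jsum \<Rightarrow> jsum" where
  "Jsum_post m g F = (case (g, F) of
       (Some (B, v), Some (A, w)) \<Rightarrow> Some (\<lambda>i. mat_mult m B (A i), \<lambda>l. v l + mat_vec m B w l)
     | _ \<Rightarrow> None)"

type_synonym 'a presmash = "(nat \<Rightarrow> nat) \<times> jsum \<times> (nat \<Rightarrow> 'a)"

definition presmash :: "nat \<Rightarrow> (nat \<Rightarrow> 'a spectrum) \<Rightarrow> nat \<Rightarrow> 'a presmash topology" where
  "presmash r X m =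
     sum_topology
       (\<lambda>n. kify (prod_topology (Jsum r n m) (product_topology (\<lambda>i. Sp (X i) (n i)) {..<r})))
       ({..<r} \<rightarrow>\<^sub>E UNIV)"

definition coend_rel :: "nat \<Rightarrow> (nat \<Rightarrow> 'a spectrum) \<Rightarrow> nat \<Rightarrow> 'a presmash rel" where
  "coend_rel r X m =
     {((n', Jsum_pre r n F f, x), (n, F, \<lambda>i\<in>{..<r}. act (X i) (n' i) (n i) (f i) (x i))) | n' n F f x.
        n' \<in> {..<r} \<rightarrow>\<^sub>E UNIV \<and> n \<in> {..<r} \<rightarrow>\<^sub>E UNIV \<and> F \<in> topspace (Jsum r n m) \<and>
        (\<forall>i<r. f i \<in> topspace (J (n' i) (n i))) \<and>
        x \<in> (\<Pi>\<^sub>E i\<in>{..<r}. topspace (Sp (X i) (n' i)))}"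

definition smash_base :: "nat \<Rightarrow> (nat \<Rightarrow> 'a spectrum) \<Rightarrow> nat \<Rightarrow> 'a presmash set" where
  "smash_base r X m =
     {(n, F, x) \<in> topspace (presmash r X m). F = None \<or> (\<exists>i<r. x i = bpt (X i) (n i))}"

definition smash_rel :: "nat \<Rightarrow> (nat \<Rightarrow> 'a spectrum) \<Rightarrow> nat \<Rightarrow> 'a presmash rel" where
  "smash_rel r X m = wh_equiv (presmash r X m)
     (coend_rel r X m \<union> smash_base r X m \<times> smash_base r X m)"

type_synonym 'a smash_pt = "'a presmash set"

text \<open>The smash product of spectra with points in \<^typ>\<open>'a\<close> has points in \<^typ>\<open>'a smash_pt\<close>, so
  functors formed with smash products change the type of points.
  A map \<open>h\<close> of representatives induces \<open>c \<mapsto> E `` (h ` c)\<close> on equivalence classes.\<close>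

definition smash :: "nat \<Rightarrow> (nat \<Rightarrow> 'a spectrum) \<Rightarrow> 'a smash_pt spectrum" where
  "smash r X =
     \<lparr>Sp = (\<lambda>m. quot_topology (presmash r X m) (smash_rel r X m)),
      bpt = (\<lambda>m. smash_rel r X m `` smash_base r X m),
      act = (\<lambda>m m' g c. smash_rel r X m' `` ((\<lambda>(n, F, x). (n, Jsum_post m g F, x)) ` c))\<rparr>"

text \<open>The map from \<open>X 0 \<and> \<dots> \<and> X (r - 1)\<close> to \<open>Y 0 \<and> \<dots> \<and> Y (r - 1)\<close> induced by a permutation \<open>p\<close> of the
  indices and maps \<open>f i\<close> from \<open>X i\<close> to \<open>Y (p i)\<close>.\<close>

definition presmash_map ::
    "nat \<Rightarrow> (nat \<Rightarrow> nat) \<Rightarrow> (nat \<Rightarrow> nat \<Rightarrow> 'a \<Rightarrow> 'a) \<Rightarrow> 'a presmash \<Rightarrow> 'a presmash" where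
  "presmash_map r p f = (\<lambda>(n, F, x). let q = inv_into {..<r} p in
     (\<lambda>j\<in>{..<r}. n (q j),
      map_option (\<lambda>(A, w). (\<lambda>j. if j < r then A (q j) else (\<lambda>_ _. 0), w)) F,
      \<lambda>j\<in>{..<r}. f (q j) (n (q j)) (x (q j))))"

definition smash_map ::
    "nat \<Rightarrow> (nat \<Rightarrow> nat) \<Rightarrow> (nat \<Rightarrow> 'a spectrum) \<Rightarrow> (nat \<Rightarrow> 'a spectrum) \<Rightarrow>
     (nat \<Rightarrow> nat \<Rightarrow> 'a \<Rightarrow> 'a) \<Rightarrow> 'a smash_pt spmor" where
  "smash_map r p X Y f =
     (smash r X, smash r Y,
      \<lambda>m. \<lambda>c\<in>topspace (Sp (smash r X) m). smash_rel r Y m `` (presmash_map r p f ` c))"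

text \<open>Unordered smash products: the smash product over a finite set \<open>A\<close> is formed along a chosen
  enumeration of \<open>A\<close>; other choices give canonically isomorphic results. The map induced by a
  bijection \<open>\<phi>\<close> from \<open>A\<close> to \<open>B\<close> and maps \<open>f i\<close> from \<open>X i\<close> to \<open>Y (\<phi> i)\<close> permutes the factors accordingly.\<close>

definition enum :: "'i set \<Rightarrow> nat \<Rightarrow> 'i" where
  "enum A = (SOME e. bij_betw e {..<card A} A)"

definition Smash :: "'i set \<Rightarrow> ('i \<Rightarrow> 'a spectrum) \<Rightarrow> 'a smash_pt spectrum" where
  "Smash A X = smash (card A) (X \<circ> enum A)"

definition Smash_map ::
    "'i set \<Rightarrow> 'j set \<Rightarrow> ('i \<Rightarrow> 'j) \<Rightarrow> ('i \<Rightarrow> 'a spectrum) \<Rightarrow> ('j \<Rightarrow> 'a spectrum) \<Rightarrow>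
     ('i \<Rightarrow> nat \<Rightarrow> 'a \<Rightarrow> 'a) \<Rightarrow> 'a smash_pt spmor" where
  "Smash_map A B \<phi> X Y f =
     smash_map (card A) (\<lambda>k. inv_into {..<card B} (enum B) (\<phi> (enum A k)))
       (X \<circ> enum A) (Y \<circ> enum B) (f \<circ> enum A)"

definition underlying :: "'a spmor \<Rightarrow> nat \<Rightarrow> 'a \<Rightarrow> 'a" where
  "underlying = (\<lambda>(X, Y, f). f)"


section \<open>Groupoids and functors determined by a transversal\<close>

definition coset_groupoid :: "('g, 'b) monoid_scheme \<Rightarrow> 'g set \<Rightarrow> ('g set, 'g \<times> 'g set) category" where
  "coset_groupoid G H = translation_groupoid G (lcosets\<^bsub>G\<^esub> H) (\<lambda>g x. g <#\<^bsub>G\<^esub> x)"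

definition index_groupoid :: "nat \<Rightarrow> (nat, (nat \<Rightarrow> nat) \<times> nat) category" where
  "index_groupoid n = translation_groupoid (sym_group n) {1..n} (\<lambda>\<sigma> i. \<sigma> i)"

abbreviation subgroup_cat :: "('g, 'b) monoid_scheme \<Rightarrow> 'g set \<Rightarrow> (unit, 'g) category" where
  "subgroup_cat G H \<equiv> group_cat (G\<lparr>carrier := H\<rparr>)"

definition index_cat ::
    "('g, 'b) monoid_scheme \<Rightarrow> 'g set \<Rightarrow> nat \<Rightarrow> (nat \<times> unit, ((nat \<Rightarrow> nat) \<times> nat) \<times> 'g) category" where
  "index_cat G H n = prod_cat (index_groupoid n) (subgroup_cat G H)"

definition wreath :: "('g, 'b) monoid_scheme \<Rightarrow> 'g set \<Rightarrow> nat \<Rightarrow> ((nat \<Rightarrow> nat) \<times> (nat \<Rightarrow> 'g)) monoid" where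
  "wreath G H n =
     \<lparr>carrier = {\<sigma>. \<sigma> permutes {1..n}} \<times> ({1..n} \<rightarrow>\<^sub>E H),
      mult = (\<lambda>(\<sigma>, h) (\<tau>, k). (\<sigma> \<circ> \<tau>, \<lambda>i\<in>{1..n}. h (\<tau> i) \<otimes>\<^bsub>G\<^esub> k i)),
      one = (id, \<lambda>i\<in>{1..n}. \<one>\<^bsub>G\<^esub>)\<rparr>"

definition transversal :: "('g, 'b) monoid_scheme \<Rightarrow> 'g set \<Rightarrow> nat \<Rightarrow> (nat \<Rightarrow> 'g) \<Rightarrow> bool" where
  "transversal G H n t \<longleftrightarrow>
     (\<forall>i\<in>{1..n}. t i \<in> carrier G) \<and> bij_betw (\<lambda>i. t i <#\<^bsub>G\<^esub> H) {1..n} (lcosets\<^bsub>G\<^esub> H)"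

definition tr_sigma :: "('g, 'b) monoid_scheme \<Rightarrow> 'g set \<Rightarrow> nat \<Rightarrow> (nat \<Rightarrow> 'g) \<Rightarrow> 'g \<Rightarrow> nat \<Rightarrow> nat" where
  "tr_sigma G H n t g i =
     (if i \<in> {1..n} then THE j. j \<in> {1..n} \<and> (\<exists>h\<in>H. g \<otimes>\<^bsub>G\<^esub> t i = t j \<otimes>\<^bsub>G\<^esub> h) else i)"

definition tr_h :: "('g, 'b) monoid_scheme \<Rightarrow> 'g set \<Rightarrow> nat \<Rightarrow> (nat \<Rightarrow> 'g) \<Rightarrow> 'g \<Rightarrow> nat \<Rightarrow> 'g" where
  "tr_h G H n t g i = (THE h. h \<in> H \<and> g \<otimes>\<^bsub>G\<^esub> t i = t (tr_sigma G H n t g i) \<otimes>\<^bsub>G\<^esub> h)"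

definition tr_index :: "('g, 'b) monoid_scheme \<Rightarrow> 'g set \<Rightarrow> nat \<Rightarrow> (nat \<Rightarrow> 'g) \<Rightarrow> 'g set \<Rightarrow> nat" where
  "tr_index G H n t x = (THE i. i \<in> {1..n} \<and> x = t i <#\<^bsub>G\<^esub> H)"

definition alpha ::
    "('g, 'b) monoid_scheme \<Rightarrow> 'g set \<Rightarrow> nat \<Rightarrow> (nat \<Rightarrow> 'g) \<Rightarrow>
     (unit, 'g, unit, (nat \<Rightarrow> nat) \<times> (nat \<Rightarrow> 'g)) fctr" where
  "alpha G H n t =
     \<lparr>Src = group_cat G, Tgt = group_cat (wreath G H n),
      Fo = (\<lambda>_. ()),
      Fa = (\<lambda>g\<in>carrier G. (tr_sigma G H n t g, \<lambda>i\<in>{1..n}. tr_h G H n t g i))\<rparr>"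

definition kappa ::
    "('g, 'b) monoid_scheme \<Rightarrow> 'g set \<Rightarrow> nat \<Rightarrow> (nat \<Rightarrow> 'g) \<Rightarrow> ('g set, 'g \<times> 'g set, unit, 'g) fctr" where
  "kappa G H n t =
     \<lparr>Src = coset_groupoid G H, Tgt = subgroup_cat G H,
      Fo = (\<lambda>x\<in>lcosets\<^bsub>G\<^esub> H. ()),
      Fa = (\<lambda>(g, x)\<in>carrier G \<times> (lcosets\<^bsub>G\<^esub> H). tr_h G H n t g (tr_index G H n t x))\<rparr>"

definition beta ::
    "('g, 'b) monoid_scheme \<Rightarrow> 'g set \<Rightarrow> nat \<Rightarrow> (nat \<Rightarrow> 'g) \<Rightarrow>
     ('g set, 'g \<times> 'g set, nat \<times> unit, ((nat \<Rightarrow> nat) \<times> nat) \<times> 'g) fctr" where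
  "beta G H n t =
     \<lparr>Src = coset_groupoid G H, Tgt = index_cat G H n,
      Fo = (\<lambda>x\<in>lcosets\<^bsub>G\<^esub> H. (tr_index G H n t x, ())),
      Fa = (\<lambda>(g, x)\<in>carrier G \<times> (lcosets\<^bsub>G\<^esub> H).
              ((tr_sigma G H n t g, tr_index G H n t x), tr_h G H n t g (tr_index G H n t x)))\<rparr>"

definition iota :: "('g, 'b) monoid_scheme \<Rightarrow> 'g set \<Rightarrow> (unit, 'g, 'g set, 'g \<times> 'g set) fctr" where
  "iota G H =
     \<lparr>Src = subgroup_cat G H, Tgt = coset_groupoid G H,
      Fo = (\<lambda>_. \<one>\<^bsub>G\<^esub> <#\<^bsub>G\<^esub> H), Fa = (\<lambda>h\<in>H. (h, \<one>\<^bsub>G\<^esub> <#\<^bsub>G\<^esub> H))\<rparr>"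


subsection \<open>Transversal data are well defined, and \<open>kappa\<close> is an equivalence inverse to \<open>iota\<close>\<close>

lemma l_coset_eq_iff:
  assumes "group G" "subgroup H G" "a \<in> carrier G" "b \<in> carrier G"
  shows "a <#\<^bsub>G\<^esub> H = b <#\<^bsub>G\<^esub> H \<longleftrightarrow> (\<exists>h\<in>H. a = b \<otimes>\<^bsub>G\<^esub> h)"
proof -
  interpret group G by fact
  interpret subgroup H G by fact
  show ?thesis
  proof
    assume "a <#\<^bsub>G\<^esub> H = b <#\<^bsub>G\<^esub> H"
    then have "a \<in> b <#\<^bsub>G\<^esub> H" using lcos_self[OF assms(3,2)] by simp
    then show "\<exists>h\<in>H. a = b \<otimes>\<^bsub>G\<^esub> h" by (auto simp: l_coset_def)
  next
    assume "\<exists>h\<in>H. a = b \<otimes>\<^bsub>G\<^esub> h"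
    then obtain h where h: "h \<in> H" "a = b \<otimes>\<^bsub>G\<^esub> h" by blast
    then have "a <#\<^bsub>G\<^esub> H = b <#\<^bsub>G\<^esub> (h <#\<^bsub>G\<^esub> H)"
      using assms(4) subset by (simp add: lcos_m_assoc)
    moreover have "h <#\<^bsub>G\<^esub> H = H"
      using coset_join3[OF _ assms(2) h(1)] h(1) by simp
    ultimately show "a <#\<^bsub>G\<^esub> H = b <#\<^bsub>G\<^esub> H" by simp
  qed
qed

lemma lcosets_shift:
  assumes "group G" "subgroup H G" "a \<in> carrier G" "g \<in> carrier G"
  shows "g <#\<^bsub>G\<^esub> (a <#\<^bsub>G\<^esub> H) = (g \<otimes>\<^bsub>G\<^esub> a) <#\<^bsub>G\<^esub> H"
  using group.lcos_m_assoc[OF assms(1) subgroup.subset[OF assms(2)] assms(4,3)] .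

context
  fixes G :: "('g, 'b) monoid_scheme" and H n t
  assumes G: "group G" and H: "subgroup H G" and tr: "transversal G H n t"
begin

lemma tr_carrier: "i \<in> {1..n} \<Longrightarrow> t i \<in> carrier G"
  using tr by (simp add: transversal_def)

lemma tr_cases: assumes "x \<in> lcosets\<^bsub>G\<^esub> H" obtains i where "i \<in> {1..n}" "x = t i <#\<^bsub>G\<^esub> H"
  using tr assms unfolding transversal_def bij_betw_def by blast

lemma tr_in: "i \<in> {1..n} \<Longrightarrow> t i <#\<^bsub>G\<^esub> H \<in> lcosets\<^bsub>G\<^esub> H"
  using tr_carrier by (auto simp: LCOSETS_def)

lemma tr_inj: "i \<in> {1..n} \<Longrightarrow> j \<in> {1..n} \<Longrightarrow> t i <#\<^bsub>G\<^esub> H = t j <#\<^bsub>G\<^esub> H \<Longrightarrow> i = j"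
  using tr unfolding transversal_def bij_betw_def by (blast dest: inj_onD)

lemma tr_index_eq: "i \<in> {1..n} \<Longrightarrow> tr_index G H n t (t i <#\<^bsub>G\<^esub> H) = i"
  unfolding tr_index_def by (rule the_equality) (use tr_inj in blast)+

lemma tr_sigma_ex1:
  assumes "g \<in> carrier G" "i \<in> {1..n}"
  shows "\<exists>!j. j \<in> {1..n} \<and> (\<exists>h\<in>H. g \<otimes>\<^bsub>G\<^esub> t i = t j \<otimes>\<^bsub>G\<^esub> h)"
proof -
  interpret group G by (rule G)
  have c: "g \<otimes>\<^bsub>G\<^esub> t i \<in> carrier G" using assms tr_carrier by simp
  then have "(g \<otimes>\<^bsub>G\<^esub> t i) <#\<^bsub>G\<^esub> H \<in> lcosets\<^bsub>G\<^esub> H" by (auto simp: LCOSETS_def)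
  then obtain j where j: "j \<in> {1..n}" "(g \<otimes>\<^bsub>G\<^esub> t i) <#\<^bsub>G\<^esub> H = t j <#\<^bsub>G\<^esub> H" by (rule tr_cases)
  have iff: "(\<exists>h\<in>H. g \<otimes>\<^bsub>G\<^esub> t i = t k \<otimes>\<^bsub>G\<^esub> h) \<longleftrightarrow> (g \<otimes>\<^bsub>G\<^esub> t i) <#\<^bsub>G\<^esub> H = t k <#\<^bsub>G\<^esub> H"
    if "k \<in> {1..n}" for k
    using l_coset_eq_iff[OF G H c tr_carrier[OF that]] by simp
  show ?thesis
  proof (rule ex1I)
    show "j \<in> {1..n} \<and> (\<exists>h\<in>H. g \<otimes>\<^bsub>G\<^esub> t i = t j \<otimes>\<^bsub>G\<^esub> h)" using j iff[OF j(1)] by simp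
    fix k assume k: "k \<in> {1..n} \<and> (\<exists>h\<in>H. g \<otimes>\<^bsub>G\<^esub> t i = t k \<otimes>\<^bsub>G\<^esub> h)"
    then have "t k <#\<^bsub>G\<^esub> H = t j <#\<^bsub>G\<^esub> H" using iff[of k] j(2) by simp
    then show "k = j" using tr_inj k j(1) by blast
  qed
qed

lemma tr_decomp:
  assumes "g \<in> carrier G" "i \<in> {1..n}"
  shows "tr_sigma G H n t g i \<in> {1..n}" and "tr_h G H n t g i \<in> H"
    and "g \<otimes>\<^bsub>G\<^esub> t i = t (tr_sigma G H n t g i) \<otimes>\<^bsub>G\<^esub> tr_h G H n t g i"
proof -
  interpret group G by (rule G)
  interpret subgroup H G by (rule H)
  have *: "tr_sigma G H n t g i \<in> {1..n} \<and>
      (\<exists>h\<in>H. g \<otimes>\<^bsub>G\<^esub> t i = t (tr_sigma G H n t g i) \<otimes>\<^bsub>G\<^esub> h)"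
    using theI'[OF tr_sigma_ex1[OF assms]] assms(2) by (simp add: tr_sigma_def)
  then show s: "tr_sigma G H n t g i \<in> {1..n}" by blast
  obtain h where h: "h \<in> H" "g \<otimes>\<^bsub>G\<^esub> t i = t (tr_sigma G H n t g i) \<otimes>\<^bsub>G\<^esub> h" using * by blast
  have "tr_h G H n t g i = h"
    unfolding tr_h_def using h tr_carrier[OF s] by (intro the_equality) auto
  with h show "tr_h G H n t g i \<in> H"
    "g \<otimes>\<^bsub>G\<^esub> t i = t (tr_sigma G H n t g i) \<otimes>\<^bsub>G\<^esub> tr_h G H n t g i" by simp_all
qed

lemma tr_unique:
  assumes "g \<in> carrier G" "i \<in> {1..n}" "j \<in> {1..n}" "h \<in> H" "g \<otimes>\<^bsub>G\<^esub> t i = t j \<otimes>\<^bsub>G\<^esub> h"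
  shows "tr_sigma G H n t g i = j" and "tr_h G H n t g i = h"
proof -
  interpret group G by (rule G)
  interpret subgroup H G by (rule H)
  show s: "tr_sigma G H n t g i = j"
    using tr_sigma_ex1[OF assms(1,2)] tr_decomp[OF assms(1,2)] assms(3-5) by blast
  show "tr_h G H n t g i = h"
    using tr_decomp[OF assms(1,2)] assms(3-5) tr_carrier[OF assms(3)] s by simp
qed

lemma tr_one:
  assumes "i \<in> {1..n}"
  shows "tr_sigma G H n t \<one>\<^bsub>G\<^esub> i = i" and "tr_h G H n t \<one>\<^bsub>G\<^esub> i = \<one>\<^bsub>G\<^esub>"
proof -
  interpret group G by (rule G)
  note one = one_closed
  interpret subgroup H G by (rule H)
  have "\<one>\<^bsub>G\<^esub> \<otimes>\<^bsub>G\<^esub> t i = t i \<otimes>\<^bsub>G\<^esub> \<one>\<^bsub>G\<^esub>" using tr_carrier assms by simp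
  from tr_unique[OF one assms assms _ this] show "tr_sigma G H n t \<one>\<^bsub>G\<^esub> i = i"
    and "tr_h G H n t \<one>\<^bsub>G\<^esub> i = \<one>\<^bsub>G\<^esub>" by simp_all
qed

lemma tr_mult:
  assumes "g \<in> carrier G" "g' \<in> carrier G" "i \<in> {1..n}"
  shows "tr_sigma G H n t (g' \<otimes>\<^bsub>G\<^esub> g) i = tr_sigma G H n t g' (tr_sigma G H n t g i)"
    and "tr_h G H n t (g' \<otimes>\<^bsub>G\<^esub> g) i = tr_h G H n t g' (tr_sigma G H n t g i) \<otimes>\<^bsub>G\<^esub> tr_h G H n t g i"
proof -
  interpret group G by (rule G)
  interpret subgroup H G by (rule H)
  let ?j = "tr_sigma G H n t g i" and ?h = "tr_h G H n t g i"
  note d = tr_decomp[OF assms(1,3)]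
  note d' = tr_decomp[OF assms(2) d(1)]
  have "g' \<otimes>\<^bsub>G\<^esub> g \<otimes>\<^bsub>G\<^esub> t i = g' \<otimes>\<^bsub>G\<^esub> (t ?j \<otimes>\<^bsub>G\<^esub> ?h)"
    using assms tr_carrier d(3) by (simp add: m_assoc)
  also have "\<dots> = (g' \<otimes>\<^bsub>G\<^esub> t ?j) \<otimes>\<^bsub>G\<^esub> ?h"
    using assms tr_carrier[OF d(1)] d(2) by (simp add: m_assoc)
  also have "\<dots> = t (tr_sigma G H n t g' ?j) \<otimes>\<^bsub>G\<^esub> (tr_h G H n t g' ?j \<otimes>\<^bsub>G\<^esub> ?h)"
    unfolding d'(3) using tr_carrier[OF d'(1)] d'(2) d(2) by (simp add: m_assoc)
  finally have e: "g' \<otimes>\<^bsub>G\<^esub> g \<otimes>\<^bsub>G\<^esub> t i = \<dots>" .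
  have gg: "g' \<otimes>\<^bsub>G\<^esub> g \<in> carrier G" using assms by simp
  have hh: "tr_h G H n t g' ?j \<otimes>\<^bsub>G\<^esub> ?h \<in> H" using d(2) d'(2) by simp
  show "tr_sigma G H n t (g' \<otimes>\<^bsub>G\<^esub> g) i = tr_sigma G H n t g' ?j"
    "tr_h G H n t (g' \<otimes>\<^bsub>G\<^esub> g) i = tr_h G H n t g' ?j \<otimes>\<^bsub>G\<^esub> ?h"
    using tr_unique[OF gg assms(3) d'(1) hh e] by simp_all
qed

lemma tr_shift:
  assumes "g \<in> carrier G" "i \<in> {1..n}"
  shows "g <#\<^bsub>G\<^esub> (t i <#\<^bsub>G\<^esub> H) = t (tr_sigma G H n t g i) <#\<^bsub>G\<^esub> H"
proof -
  interpret group G by (rule G)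
  note d = tr_decomp[OF assms]
  have "g \<otimes>\<^bsub>G\<^esub> t i \<in> carrier G" using assms(1) tr_carrier[OF assms(2)] by simp
  then have "(g \<otimes>\<^bsub>G\<^esub> t i) <#\<^bsub>G\<^esub> H = t (tr_sigma G H n t g i) <#\<^bsub>G\<^esub> H"
    using l_coset_eq_iff[OF G H _ tr_carrier[OF d(1)]] d(2,3) by blast
  then show ?thesis using lcosets_shift[OF G H tr_carrier[OF assms(2)] assms(1)] by simp
qed

lemma tr_sigma_permutes: assumes g: "g \<in> carrier G" shows "tr_sigma G H n t g permutes {1..n}"
proof -
  interpret group G by (rule G)
  have i: "inv\<^bsub>G\<^esub> g \<in> carrier G" using g by simp
  have 1: "tr_sigma G H n t (inv\<^bsub>G\<^esub> g) (tr_sigma G H n t g k) = k" if "k \<in> {1..n}" for k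
    using tr_mult(1)[OF g i that] tr_one(1)[OF that] g by simp
  have 2: "tr_sigma G H n t g (tr_sigma G H n t (inv\<^bsub>G\<^esub> g) k) = k" if "k \<in> {1..n}" for k
    using tr_mult(1)[OF i g that] tr_one(1)[OF that] g by simp
  have "bij_betw (tr_sigma G H n t g) {1..n} {1..n}"
    by (rule bij_betw_byWitness[where f' = "tr_sigma G H n t (inv\<^bsub>G\<^esub> g)"])
       (use 1 2 tr_decomp(1)[OF g] tr_decomp(1)[OF i] in blast)+
  then show ?thesis by (rule bij_imp_permutes) (simp add: tr_sigma_def del: atLeastAtMost_iff)
qed

lemma is_category_group_cat:
  assumes "group K"
  shows "is_category (group_cat K)"
proof -
  interpret K: group K by fact
  show ?thesis unfolding is_category_def group_cat_def by (simp add: K.m_assoc)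
qed

lemma is_category_subgroup_cat: "is_category (subgroup_cat G H)"
  using is_category_group_cat subgroup.subgroup_is_group[OF H G] by auto

lemma coset_action:
  assumes g: "g \<in> carrier G" and x: "x \<in> lcosets\<^bsub>G\<^esub> H"
  shows "g <#\<^bsub>G\<^esub> x \<in> lcosets\<^bsub>G\<^esub> H"
proof -
  obtain i where i: "i \<in> {1..n}" "x = t i <#\<^bsub>G\<^esub> H" using x by (rule tr_cases)
  show ?thesis unfolding i(2) tr_shift[OF g i(1)] by (rule tr_in[OF tr_decomp(1)[OF g i(1)]])
qed

lemma is_category_coset_groupoid: "is_category (coset_groupoid G H)"
proof -
  interpret group G by (rule G)
  have 2: "\<one>\<^bsub>G\<^esub> <#\<^bsub>G\<^esub> x = x" if x: "x \<in> lcosets\<^bsub>G\<^esub> H" for x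
  proof -
    obtain i where i: "i \<in> {1..n}" "x = t i <#\<^bsub>G\<^esub> H" using x by (rule tr_cases)
    show ?thesis unfolding i(2) tr_shift[OF one_closed i(1)] tr_one(1)[OF i(1)] ..
  qed
  have 3: "(g' \<otimes>\<^bsub>G\<^esub> g) <#\<^bsub>G\<^esub> x = g' <#\<^bsub>G\<^esub> (g <#\<^bsub>G\<^esub> x)"
    if g: "g \<in> carrier G" "g' \<in> carrier G" and x: "x \<in> lcosets\<^bsub>G\<^esub> H" for g g' x
  proof -
    obtain i where i: "i \<in> {1..n}" "x = t i <#\<^bsub>G\<^esub> H" using x by (rule tr_cases)
    show ?thesis
      unfolding i(2) tr_shift[OF m_closed[OF g(2,1)] i(1)] tr_shift[OF g(1) i(1)]
        tr_shift[OF g(2) tr_decomp(1)[OF g(1) i(1)]] tr_mult(1)[OF g i(1)] ..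
  qed
  show ?thesis
    unfolding is_category_def coset_groupoid_def translation_groupoid_def
    by (simp add: coset_action 2 3 m_assoc)
qed

lemma is_functor_kappa: "is_functor (coset_groupoid G H) (subgroup_cat G H) (kappa G H n t)"
proof -
  interpret group G by (rule G)
  interpret subgroup H G by (rule H)
  have 1: "tr_h G H n t g (tr_index G H n t x) \<in> H"
    if g: "g \<in> carrier G" and x: "x \<in> lcosets\<^bsub>G\<^esub> H" for g x
  proof -
    obtain i where i: "i \<in> {1..n}" "x = t i <#\<^bsub>G\<^esub> H" using x by (rule tr_cases)
    show ?thesis unfolding i(2) tr_index_eq[OF i(1)] by (rule tr_decomp(2)[OF g i(1)])
  qed
  have 2: "tr_h G H n t \<one>\<^bsub>G\<^esub> (tr_index G H n t x) = \<one>\<^bsub>G\<^esub>" if x: "x \<in> lcosets\<^bsub>G\<^esub> H" for x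
  proof -
    obtain i where i: "i \<in> {1..n}" "x = t i <#\<^bsub>G\<^esub> H" using x by (rule tr_cases)
    show ?thesis unfolding i(2) tr_index_eq[OF i(1)] by (rule tr_one(2)[OF i(1)])
  qed
  have 3: "tr_h G H n t (g' \<otimes>\<^bsub>G\<^esub> g) (tr_index G H n t x) =
      tr_h G H n t g' (tr_index G H n t (g <#\<^bsub>G\<^esub> x)) \<otimes>\<^bsub>G\<^esub> tr_h G H n t g (tr_index G H n t x)"
    if g: "g \<in> carrier G" "g' \<in> carrier G" and x: "x \<in> lcosets\<^bsub>G\<^esub> H" for g g' x
  proof -
    obtain i where i: "i \<in> {1..n}" "x = t i <#\<^bsub>G\<^esub> H" using x by (rule tr_cases)
    show ?thesis
      unfolding i(2) tr_shift[OF g(1) i(1)] tr_index_eq[OF i(1)]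
        tr_index_eq[OF tr_decomp(1)[OF g(1) i(1)]] by (rule tr_mult(2)[OF g i(1)])
  qed
  show ?thesis
    unfolding is_functor_def
  proof (intro conjI)
    show "Fa (kappa G H n t) \<in> Ar (coset_groupoid G H) \<rightarrow>\<^sub>E Ar (subgroup_cat G H)"
      by (rule PiE_I) (auto simp: kappa_def coset_groupoid_def translation_groupoid_def group_cat_def 1)
    show "is_category (coset_groupoid G H)" by (rule is_category_coset_groupoid)
    show "is_category (subgroup_cat G H)" by (rule is_category_subgroup_cat)
  qed (simp_all add: kappa_def
      coset_groupoid_def translation_groupoid_def group_cat_def 2 3 coset_action)
qed



lemma is_functor_fid: "is_category C \<Longrightarrow> is_functor C C (fid C)"
  unfolding is_functor_def is_category_def fid_def by simp

lemma is_functor_fcomp: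
  assumes "is_functor C D F" "is_functor D E F'"
  shows "is_functor C E (F' \<circ>\<^sub>F F)"
proof -
  have ob: "Fo F x \<in> Ob D" if "x \<in> Ob C" for x
    using assms(1) that by (auto simp: is_functor_def dest: PiE_mem)
  have ar: "Fa F f \<in> Ar D" if "f \<in> Ar C" for f
    using assms(1) that by (auto simp: is_functor_def dest: PiE_mem)
  have ob': "Fo F' x \<in> Ob E" if "x \<in> Ob D" for x
    using assms(2) that by (auto simp: is_functor_def dest: PiE_mem)
  have ar': "Fa F' f \<in> Ar E" if "f \<in> Ar D" for f
    using assms(2) that by (auto simp: is_functor_def dest: PiE_mem)
  have C: "is_category C" and src: "Src F = C" using assms(1) by (simp_all add: is_functor_def)
  show ?thesis
    unfolding is_functor_def
  proof (intro conjI ballI impI)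
    fix f g assume fg: "f \<in> Ar C" "g \<in> Ar C" "Dom C g = Cod C f"
    then have gf: "Cmp C g f \<in> Ar C" using C by (simp add: is_category_def)
    have "Dom D (Fa F g) = Cod D (Fa F f)" using assms(1) fg by (simp add: is_functor_def)
    then show "Fa (F' \<circ>\<^sub>F F) (Cmp C g f) = Cmp E (Fa (F' \<circ>\<^sub>F F) g) (Fa (F' \<circ>\<^sub>F F) f)"
      using assms fg gf ar by (simp add: is_functor_def fcomp_def)
  next
    fix x assume "x \<in> Ob C"
    then show "Fa (F' \<circ>\<^sub>F F) (Idn C x) = Idn E (Fo (F' \<circ>\<^sub>F F) x)"
      using assms C ob by (simp add: is_functor_def fcomp_def is_category_def)
  qed (use assms C ob ar ob' ar' src in \<open>simp_all add: is_functor_def fcomp_def is_category_def\<close>)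
qed

lemma is_functor_iota: "is_functor (subgroup_cat G H) (coset_groupoid G H) (iota G H)"
proof -
  interpret group G by (rule G)
  interpret sub: subgroup H G by (rule H)
  have 1: "\<one>\<^bsub>G\<^esub> <#\<^bsub>G\<^esub> H = H" using sub.subset by (rule lcos_mult_one)
  have 2: "h <#\<^bsub>G\<^esub> H = H" if "h \<in> H" for h
    using coset_join3[OF _ H that] that by simp
  have 3: "H \<in> lcosets\<^bsub>G\<^esub> H" using 1 unfolding LCOSETS_def by force
  show ?thesis
    unfolding is_functor_def
  proof (intro conjI)
    show "Fo (iota G H) \<in> Ob (subgroup_cat G H) \<rightarrow>\<^sub>E Ob (coset_groupoid G H)"
      by (rule PiE_I) (simp_all add: iota_def coset_groupoid_def translation_groupoid_def group_cat_def 1 3)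
    show "Fa (iota G H) \<in> Ar (subgroup_cat G H) \<rightarrow>\<^sub>E Ar (coset_groupoid G H)"
      by (rule PiE_I) (auto simp: iota_def coset_groupoid_def translation_groupoid_def group_cat_def 1 3)
    show "is_category (coset_groupoid G H)" by (rule is_category_coset_groupoid)
    show "is_category (subgroup_cat G H)" by (rule is_category_subgroup_cat)
  qed (simp_all add: iota_def
      coset_groupoid_def translation_groupoid_def group_cat_def 1 2 3)
qed

lemma kappa_inverse_iota:
  "\<exists>\<epsilon> \<eta>. nat_iso (subgroup_cat G H) (subgroup_cat G H)
             (kappa G H n t \<circ>\<^sub>F iota G H) (fid (subgroup_cat G H)) \<epsilon> \<and>
         nat_iso (coset_groupoid G H) (coset_groupoid G H)
             (iota G H \<circ>\<^sub>F kappa G H n t) (fid (coset_groupoid G H)) \<eta>"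
proof -
  interpret group G by (rule G)
  interpret sub: subgroup H G by (rule H)
  have one: "\<one>\<^bsub>G\<^esub> <#\<^bsub>G\<^esub> H = H" using sub.subset by (rule lcos_mult_one)
  have e: "H \<in> lcosets\<^bsub>G\<^esub> H" using one unfolding LCOSETS_def by force
  then obtain j where j: "j \<in> {1..n}" "H = t j <#\<^bsub>G\<^esub> H" by (rule tr_cases)
  have tj: "t j \<in> H" using lcos_self[OF tr_carrier[OF j(1)] H] j(2) by simp
  have ij: "tr_index G H n t H = j" using tr_index_eq[OF j(1)] j(2) by simp
  have lH: "h <#\<^bsub>G\<^esub> H = H" if "h \<in> H" for h
    using coset_join3[OF _ H that] that by simp
  have invH: "inv\<^bsub>G\<lparr>carrier := H\<rparr>\<^esub> h = inv\<^bsub>G\<^esub> h" if "h \<in> H" for h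
    using m_inv_consistent[OF H that] .
  have nat1: "t j \<otimes>\<^bsub>G\<^esub> tr_h G H n t h j = h \<otimes>\<^bsub>G\<^esub> t j" if h: "h \<in> H" for h
  proof -
    have hG: "h \<in> carrier G" using h by simp
    have "tr_sigma G H n t h j = j"
      using tr_shift[OF hG j(1)] lH[OF h] j tr_inj tr_decomp(1)[OF hG j(1)] by metis
    then show ?thesis using tr_decomp(3)[OF hG j(1)] by simp
  qed
  have s: "t (tr_index G H n t x) \<in> carrier G" "t (tr_index G H n t x) <#\<^bsub>G\<^esub> H = x"
    if x: "x \<in> lcosets\<^bsub>G\<^esub> H" for x
  proof -
    obtain i where i: "i \<in> {1..n}" "x = t i <#\<^bsub>G\<^esub> H" using x by (rule tr_cases)
    show "t (tr_index G H n t x) \<in> carrier G" "t (tr_index G H n t x) <#\<^bsub>G\<^esub> H = x"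
      using i tr_index_eq[OF i(1)] tr_carrier[OF i(1)] by simp_all
  qed
  have nat2: "t (tr_index G H n t (g <#\<^bsub>G\<^esub> x)) \<otimes>\<^bsub>G\<^esub> tr_h G H n t g (tr_index G H n t x) =
      g \<otimes>\<^bsub>G\<^esub> t (tr_index G H n t x)"
    if g: "g \<in> carrier G" and x: "x \<in> lcosets\<^bsub>G\<^esub> H" for g x
  proof -
    obtain i where i: "i \<in> {1..n}" "x = t i <#\<^bsub>G\<^esub> H" using x by (rule tr_cases)
    show ?thesis
      unfolding i(2) tr_shift[OF g i(1)] tr_index_eq[OF i(1)]
        tr_index_eq[OF tr_decomp(1)[OF g i(1)]] by (rule tr_decomp(3)[OF g i(1), symmetric])
  qed
  have bck: "inv\<^bsub>G\<^esub> t (tr_index G H n t x) <#\<^bsub>G\<^esub> x = H" if "x \<in> lcosets\<^bsub>G\<^esub> H" for x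
    using lcosets_shift[OF G H s(1)[OF that], of "inv\<^bsub>G\<^esub> t (tr_index G H n t x)"] s[OF that] one
    by (simp add: l_inv)
  have hH: "tr_h G H n t g (tr_index G H n t x) \<in> H"
    if g: "g \<in> carrier G" and x: "x \<in> lcosets\<^bsub>G\<^esub> H" for g x
  proof -
    obtain i where i: "i \<in> {1..n}" "x = t i <#\<^bsub>G\<^esub> H" using x by (rule tr_cases)
    show ?thesis unfolding i(2) tr_index_eq[OF i(1)] by (rule tr_decomp(2)[OF g i(1)])
  qed
  let ?\<epsilon> = "\<lambda>_::unit. t j"
  let ?\<eta> = "\<lambda>x\<in>lcosets\<^bsub>G\<^esub> H. (t (tr_index G H n t x), H)"
  have "nat_iso (subgroup_cat G H) (subgroup_cat G H)
      (kappa G H n t \<circ>\<^sub>F iota G H) (fid (subgroup_cat G H)) ?\<epsilon>"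
    unfolding nat_iso_def nat_trans_def
  proof (intro conjI is_functor_fcomp[OF is_functor_iota is_functor_kappa]
      is_functor_fid[OF is_category_subgroup_cat] ballI)
    show "?\<epsilon> \<in> Ob (subgroup_cat G H) \<rightarrow>\<^sub>E Ar (subgroup_cat G H)"
      by (rule PiE_I) (use tj in \<open>simp_all add: group_cat_def\<close>)
  next
    fix x assume "x \<in> Ob (subgroup_cat G H)"
    show "is_iso (subgroup_cat G H) (t j)"
      unfolding is_iso_def
      by (intro conjI bexI[of _ "inv\<^bsub>G\<^esub> t j"]) (use tj in \<open>simp_all add: group_cat_def\<close>)
  next
    fix f assume "f \<in> Ar (subgroup_cat G H)"
    then have f: "f \<in> H" by (simp add: group_cat_def)
    then have "f \<in> carrier G" by simp
    then show "Cmp (subgroup_cat G H) (t j) (Fa (kappa G H n t \<circ>\<^sub>F iota G H) f) =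
         Cmp (subgroup_cat G H) (Fa (fid (subgroup_cat G H)) f) (t j)"
      using f nat1[OF f] e
      by (simp add: group_cat_def fcomp_def kappa_def iota_def fid_def one ij)
  qed (use tj in \<open>simp_all add: group_cat_def\<close>)
  moreover have "nat_iso (coset_groupoid G H) (coset_groupoid G H)
      (iota G H \<circ>\<^sub>F kappa G H n t) (fid (coset_groupoid G H)) ?\<eta>"
    unfolding nat_iso_def nat_trans_def
  proof (intro conjI is_functor_fcomp[OF is_functor_kappa is_functor_iota]
      is_functor_fid[OF is_category_coset_groupoid] ballI)
    show "?\<eta> \<in> Ob (coset_groupoid G H) \<rightarrow>\<^sub>E Ar (coset_groupoid G H)"
      by (rule PiE_I) (simp_all add: coset_groupoid_def translation_groupoid_def s e)
  next
    fix x assume "x \<in> Ob (coset_groupoid G H)"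
    then have x: "x \<in> lcosets\<^bsub>G\<^esub> H" by (simp add: coset_groupoid_def translation_groupoid_def)
    show "Dom (coset_groupoid G H) (?\<eta> x) = Fo (iota G H \<circ>\<^sub>F kappa G H n t) x"
      "Cod (coset_groupoid G H) (?\<eta> x) = Fo (fid (coset_groupoid G H)) x"
      using x s(2)[OF x]
      by (simp_all add: coset_groupoid_def translation_groupoid_def fcomp_def kappa_def iota_def
          fid_def one)
    show "is_iso (coset_groupoid G H) (?\<eta> x)"
      unfolding is_iso_def
      by (intro conjI bexI[of _ "(inv\<^bsub>G\<^esub> t (tr_index G H n t x), x)"])
         (use x s[OF x] e bck[OF x] in
           \<open>simp_all add: coset_groupoid_def translation_groupoid_def l_inv r_inv\<close>)
  next
    fix f assume "f \<in> Ar (coset_groupoid G H)"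
    then obtain g x where f: "f = (g, x)" "g \<in> carrier G" "x \<in> lcosets\<^bsub>G\<^esub> H"
      by (auto simp: coset_groupoid_def translation_groupoid_def)
    then show "Cmp (coset_groupoid G H) (?\<eta> (Cod (coset_groupoid G H) f))
           (Fa (iota G H \<circ>\<^sub>F kappa G H n t) f) =
         Cmp (coset_groupoid G H) (Fa (fid (coset_groupoid G H)) f)
           (?\<eta> (Dom (coset_groupoid G H) f))"
      using nat2[OF f(2,3)] coset_action[OF f(2,3)] hH[OF f(2,3)]
      by (simp add: coset_groupoid_def translation_groupoid_def fcomp_def kappa_def iota_def fid_def one)
  qed
  ultimately show ?thesis by blast
qed

end


section \<open>The functors of the diagram and the norm maps\<close>

definition c_functor where
  "c_functor G H n =
     precomp (Spectra :: ('a spectrum, 'a spmor) category)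
       (snd_fctr (index_groupoid n) (subgroup_cat G H))"

definition p_smash where
  "p_smash G H =
     (let B = fun_cat (coset_groupoid G H) (Spectra :: ('a spectrum, 'a spmor) category);
          Q = lcosets\<^bsub>G\<^esub> H;
          P = (\<lambda>X. \<lparr>Src = group_cat G, Tgt = (Spectra :: ('a smash_pt spectrum, 'a smash_pt spmor) category),
                    Fo = (\<lambda>_. Smash Q (Fo X)),
                    Fa = (\<lambda>g\<in>carrier G. Smash_map Q Q (\<lambda>x. g <#\<^bsub>G\<^esub> x) (Fo X) (Fo X)
                            (\<lambda>x. underlying (Fa X (g, x))))\<rparr>)
      in \<lparr>Src = B, Tgt = fun_cat (group_cat G) Spectra,
          Fo = restrict P (Ob B),
          Fa = (\<lambda>(X, Y, f)\<in>Ar B. (P X, P Y,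
                  \<lambda>_. Smash_map Q Q (\<lambda>x. x) (Fo X) (Fo Y) (\<lambda>x. underlying (f x))))\<rparr>)"

definition n_smash where
  "n_smash G H n =
     (let B = fun_cat (index_cat G H n) (Spectra :: ('a spectrum, 'a spmor) category);
          N = {1..n};
          P = (\<lambda>X. \<lparr>Src = group_cat (wreath G H n),
                    Tgt = (Spectra :: ('a smash_pt spectrum, 'a smash_pt spmor) category),
                    Fo = (\<lambda>_. Smash N (\<lambda>i. Fo X (i, ()))),
                    Fa = (\<lambda>(\<sigma>, h)\<in>carrier (wreath G H n).
                            Smash_map N N \<sigma> (\<lambda>i. Fo X (i, ())) (\<lambda>i. Fo X (i, ()))
                              (\<lambda>i. underlying (Fa X ((\<sigma>, i), h i))))\<rparr>)
      in \<lparr>Src = B, Tgt = fun_cat (group_cat (wreath G H n)) Spectra,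
          Fo = restrict P (Ob B),
          Fa = (\<lambda>(X, Y, f)\<in>Ar B. (P X, P Y,
                  \<lambda>_. Smash_map N N (\<lambda>i. i) (\<lambda>i. Fo X (i, ())) (\<lambda>i. Fo Y (i, ()))
                        (\<lambda>i. underlying (f (i, ())))))\<rparr>)"

definition smash_power where
  "smash_power G H n = n_smash G H n \<circ>\<^sub>F c_functor G H n"

text \<open>Objects of \<^term>\<open>index_cat G H n\<close> are pairs \<open>(i, ())\<close>. Here \<open>k\<close> is the chosen equivalence inverse to \<^const>\<open>iota\<close>.\<close>

definition hhr_norm where
  "hhr_norm G H k = p_smash G H \<circ>\<^sub>F precomp Spectra k"

definition gm_norm where
  "gm_norm G H n t = precomp Spectra (alpha G H n t) \<circ>\<^sub>F smash_power G H n"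

text \<open>The canonical isomorphism from \<open>\<And>\<^bsub>i\<^esub> X(i)\<close> to \<open>\<And>\<^bsub>x \<in> G/H\<^esub> (\<beta>\<^sup>*X)(x)\<close> which reindexes the unordered smash
  product along the bijection \<open>i \<mapsto> t\<^sub>i H\<close>; all component maps are identities.\<close>

definition reindex where
  "reindex G H n t X =
     (Fo (precomp Spectra (alpha G H n t) \<circ>\<^sub>F n_smash G H n) X,
      Fo (p_smash G H \<circ>\<^sub>F precomp Spectra (beta G H n t)) X,
      \<lambda>_::unit. Smash_map {1..n} (lcosets\<^bsub>G\<^esub> H) (\<lambda>i. t i <#\<^bsub>G\<^esub> H)
        (\<lambda>i. Fo X (i, ())) (Fo (X \<circ>\<^sub>F beta G H n t)) (\<lambda>i. spectrum_id (Fo X (i, ()))))"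

end

theory Submission
  imports Defs
begin

text \<open>Both norms of an \<open>H\<close>-spectrum \<open>X\<close> are smash products of \<open>n\<close> copies of \<open>X\<close>. The Hill--Hopkins--Ravenel
  norm indexes the factors by the cosets in \<open>G/H\<close>, the Greenlees--May norm by \<open>1, \<dots>, n\<close>, and the
  transversal gives a bijection \<open>i \<mapsto> t\<^sub>i H\<close> between the two index sets. For any \<open>X\<close> on
  \<open>B\<Sigma>\<^sub>n \<times> H\<close>, an element \<open>g\<close> sends the factor at \<open>i\<close> to the factor at \<open>\<sigma>\<^sub>g(i)\<close> by
  \<open>X((\<sigma>\<^sub>g)\<^sub>i, h\<^sub>i(g))\<close> on the side of \<open>\<alpha>\<close>. On the side of \<open>\<beta>\<close> it sends the factor at \<open>t\<^sub>i H\<close> to the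
  factor at \<open>g t\<^sub>i H\<close> by \<open>X(\<beta>(g\<^sub>i))\<close>. Since \<open>g t\<^sub>i H = t\<^bsub>\<sigma>\<^sub>g(i)\<^esub> H\<close> and \<open>\<beta>(g\<^sub>i) = ((\<sigma>\<^sub>g)\<^sub>i, h\<^sub>i(g))\<close>, the
  two agree factor by factor, so reindexing along the bijection is an equivariant natural isomorphism
  (\<open>nat_iso_reindex_component\<close>, \<open>nat_iso_reindex\<close>). The triangle is the equation \<open>\<kappa> = pr \<circ> \<beta>\<close>
  (\<open>kappa_triangle\<close>), and the comparison of the norms is the square restricted along \<open>c\<close>
  (\<open>nat_iso_norms\<close>).

  This argument rests on the fact that the unordered smash product is a functor: bijections of the
  index set and maps of the factors induce maps of smash products, compatibly with composition
  (\<open>Smash_map_arrow\<close>, \<open>Smash_map_compose\<close>, \<open>Smash_map_Idn\<close>). Most of the work is to prove this for Day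
  convolution of orthogonal spectra in compactly generated weak Hausdorff spaces. A level of the smash product is
  the quotient of a disjoint union of spaces \<open>J(\<real>^(n 0) \<oplus> \<dots> \<oplus> \<real>^(n (r - 1)), \<real>^m) \<times> X 0 (n 0) \<times> \<dots> \<times> X (r - 1) (n (r - 1))\<close>
  by the smallest equivalence relation that contains the coend relation, collapses the base points and
  has a weak Hausdorff quotient. Three points carry the proof.

  Equivalence relations with weak Hausdorff quotient are closed under intersection and under pullback
  along continuous maps. Hence the smallest one exists, and a continuous map which respects the
  generating pairs descends to the quotients (\<open>weak_hausdorff_wh_equiv\<close>, \<open>wh_equiv_map\<close>).

  The spaces \<open>J\<close> of isometric embeddings are one-point compactifications of locally compact Hausdorff
  spaces, hence compact Hausdorff, and taking products with such a space
  preserves quotient maps. As the k-ification of a space is a quotient of the disjoint union of its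
  compact Hausdorff subspaces, the action of \<open>J\<close> on a smash product is continuous as soon as it is
  continuous on compact Hausdorff pieces before passing to the quotient (\<open>continuous_map_prod_kify\<close>,
  \<open>continuous_map_smash_act\<close>).

  Composition of isometric embeddings extends continuously to the one-point compactifications, because
  it is proper: by Pythagoras, \<open>|v + B w|\<^sup>2 = |v|\<^sup>2 + |w|\<^sup>2\<close> for an isometry \<open>B\<close> with image orthogonal
  to \<open>v\<close> (\<open>Jsum_post_points\<close>, \<open>continuous_map_Jsum_post\<close>).\<close>

section \<open>Weak Hausdorff spaces and their quotients\<close>

lemma Hausdorff_space_jointly_injective:
  assumes cont: "\<And>i. i \<in> I \<Longrightarrow> continuous_map X (Y i) (f i)"
    and H: "\<And>i. i \<in> I \<Longrightarrow> Hausdorff_space (subtopology (Y i) (f i ` topspace X))"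
    and inj: "\<And>x y. x \<in> topspace X \<Longrightarrow> y \<in> topspace X \<Longrightarrow> (\<And>i. i \<in> I \<Longrightarrow> f i x = f i y) \<Longrightarrow> x = y"
  shows "Hausdorff_space X"
  unfolding Hausdorff_space_def
proof (intro allI impI)
  fix x y assume xy: "x \<in> topspace X \<and> y \<in> topspace X \<and> x \<noteq> y"
  then obtain i where i: "i \<in> I" "f i x \<noteq> f i y" using inj by metis
  let ?Y = "subtopology (Y i) (f i ` topspace X)"
  have c: "continuous_map X ?Y (f i)" using cont[OF i(1)] by (simp add: continuous_map_in_subtopology)
  then have "f i x \<in> topspace ?Y" "f i y \<in> topspace ?Y"
    using xy by (auto simp: continuous_map_def Pi_iff)
  then obtain U V where UV: "openin ?Y U" "openin ?Y V" "f i x \<in> U" "f i y \<in> V" "disjnt U V"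
    using H[OF i(1)] i(2) unfolding Hausdorff_space_def by metis
  show "\<exists>U V. openin X U \<and> openin X V \<and> x \<in> U \<and> y \<in> V \<and> disjnt U V"
    by (intro exI[of _ "{z \<in> topspace X. f i z \<in> U}"] exI[of _ "{z \<in> topspace X. f i z \<in> V}"] conjI
        openin_continuous_map_preimage[OF c] UV) (use xy UV in \<open>auto simp: disjnt_def\<close>)
qed

text \<open>The definition of \<open>weak_hausdorff\<close> tests only spaces with points in \<^typ>\<open>'a set set\<close>. To pass to an
  arbitrary \<open>K\<close>, choose one point \<open>s y\<close> in each nonempty fibre of \<open>u\<close>; the closure \<open>L\<close> of the chosen points
  is mapped onto the image of \<open>K\<close>. As \<open>K\<close> is Hausdorff, a point of \<open>L\<close> is determined by the traces of its
  neighbourhoods on the chosen points. These traces are sets of points of \<open>X\<close>, so \<open>L\<close> embeds into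
  \<^typ>\<open>'a set set\<close>.\<close>

lemma weak_hausdorff_closed_image:
  fixes X :: "'a topology" and K :: "'k topology"
  assumes X: "weak_hausdorff X" and K: "compact_space K" "Hausdorff_space K"
    and u: "continuous_map K X u"
  shows "closedin X (u ` topspace K)"
proof -
  define I where "I = u ` topspace K"
  define s where "s y = (SOME p. p \<in> topspace K \<and> u p = y)" for y
  have s: "s y \<in> topspace K \<and> u (s y) = y" if "y \<in> I" for y
    unfolding s_def by (rule someI_ex) (use that in \<open>auto simp: I_def\<close>)
  define L where "L = K closure_of (s ` I)"
  have LK: "L \<subseteq> topspace K" by (simp add: L_def closure_of_subset_topspace)
  have sL: "s ` I \<subseteq> L" unfolding L_def by (rule closure_of_subset) (use s in auto)
  \<comment> \<open>The traces of the neighbourhoods of \<open>p\<close> on the chosen points.\<close>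
  define e where "e p = {{y \<in> I. s y \<in> U} | U. openin K U \<and> p \<in> U}" for p
  have inj: "inj_on e L"
  proof (rule inj_onI, rule ccontr)
    fix p q assume p: "p \<in> L" and q: "q \<in> L" and e: "e p = e q" and "p \<noteq> q"
    then obtain U V where UV: "openin K U" "openin K V" "p \<in> U" "q \<in> V" "disjnt U V"
      using K(2) LK unfolding Hausdorff_space_def by (metis subsetD)
    have "{y \<in> I. s y \<in> U} \<in> e p" using UV by (auto simp: e_def)
    then have "{y \<in> I. s y \<in> U} \<in> e q" using e by simp
    then obtain W where W: "openin K W" "q \<in> W" "{y \<in> I. s y \<in> U} = {y \<in> I. s y \<in> W}"
      unfolding e_def by blast
    have "openin K (W \<inter> V)" "q \<in> W \<inter> V" using W UV by auto
    then obtain y where "y \<in> I" "s y \<in> W \<inter> V" using q unfolding L_def in_closure_of by blast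
    then show False using W(3) UV(5) by (auto simp: disjnt_def)
  qed
  let ?g = "inv_into L e"
  define M where "M = pullback_topology (e ` L) ?g (subtopology K L)"
  have tM: "topspace M = e ` L" using LK inj by (auto simp: M_def topspace_pullback_topology)
  have g: "continuous_map M (subtopology K L) ?g"
    using continuous_map_pullback[OF continuous_map_id, of "e ` L" ?g "subtopology K L"] by (simp add: M_def)
  have e: "continuous_map (subtopology K L) M e"
    unfolding M_def
  proof (rule continuous_map_pullback')
    show "continuous_map (subtopology K L) (subtopology K L) (?g \<circ> e)"
      by (rule continuous_map_eq[OF continuous_map_id]) (use inj in auto)
  qed auto
  have "compact_space (subtopology K L)"
    using closedin_compact_space[OF K(1)] by (simp add: L_def compactin_subspace)
  from image_compactin[OF this[unfolded compact_space_def] e]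
  have cM: "compact_space M" using tM LK by (simp add: compact_space_def inf.absorb2)
  have "Hausdorff_space M"
  proof (rule Hausdorff_space_injective_preimage[OF _ g])
    show "Hausdorff_space (subtopology K L)" using K(2) by (rule Hausdorff_space_subtopology)
    show "inj_on ?g (topspace M)" unfolding tM by (rule inj_on_inv_into) simp
  qed
  moreover have "continuous_map M X (u \<circ> ?g)"
    using g u by (meson continuous_map_compose continuous_map_in_subtopology)
  ultimately have "closedin X ((u \<circ> ?g) ` topspace M)"
    using X cM unfolding weak_hausdorff_def by blast
  moreover have "(u \<circ> ?g) ` topspace M = u ` L" using inj by (auto simp: tM image_comp)
  moreover have "u ` L = u ` topspace K"
  proof
    have "u ` topspace K \<subseteq> u ` s ` I" unfolding I_def[symmetric] using s by force
    then show "u ` topspace K \<subseteq> u ` L" using sL by blast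
  qed (use LK in blast)
  ultimately show ?thesis by simp
qed

text \<open>A map from a compact Hausdorff space to a weak Hausdorff space is closed onto its image, and a closed
  continuous image of a normal space with closed points is Hausdorff.\<close>

lemma weak_hausdorff_Hausdorff_image:
  assumes X: "weak_hausdorff X" and K: "compact_space K" "Hausdorff_space K"
    and u: "continuous_map K X u"
  shows "Hausdorff_space (subtopology X (u ` topspace K))"
proof -
  let ?Y = "subtopology X (u ` topspace K)"
  have closed: "closedin ?Y (u ` C)" if C: "closedin K C" for C
  proof -
    have sub: "C \<subseteq> topspace K" using C by (rule closedin_subset)
    have "closedin X (u ` topspace (subtopology K C))"
      by (rule weak_hausdorff_closed_image[OF X _ Hausdorff_space_subtopology[OF K(2)]
            continuous_map_from_subtopology[OF u]])
        (use closedin_compact_space[OF K(1) C] in \<open>simp add: compactin_subspace\<close>)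
    then have "closedin X (u ` C)" using sub by (simp add: inf.absorb2)
    moreover have "u ` C \<subseteq> u ` topspace K" using sub by blast
    ultimately show ?thesis by (rule closedin_subset_topspace)
  qed
  have tY: "topspace ?Y = u ` topspace K"
    using u by (auto simp: continuous_map_def Pi_iff)
  show ?thesis
  proof (rule Hausdorff_normal_space_closed_continuous_map_image)
    show "normal_space K" using K compact_Hausdorff_or_regular_imp_normal_space by blast
    show "closed_map K ?Y u" using closed by (simp add: closed_map_def)
    show "continuous_map K ?Y u" using u by (simp add: continuous_map_in_subtopology)
    show "u ` topspace K = topspace ?Y" using tY by simp
    show "t1_space ?Y" unfolding t1_space_closedin_singleton
    proof
      fix y assume "y \<in> topspace ?Y"
      then obtain p where p: "p \<in> topspace K" "y = u p" unfolding tY by blast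
      have "closedin K {p}"
        using Hausdorff_imp_t1_space[OF K(2)] p(1) by (simp add: t1_space_closedin_singleton)
      from closed[OF this] show "closedin ?Y {y}" by (simp add: p(2))
    qed
  qed
qed

text \<open>Let \<open>C\<close> be the image of a compact Hausdorff space in \<open>Z\<close>. The points of \<open>Z\<close> that every \<open>f i\<close> maps into
  \<open>f i ` C\<close> form a closed set \<open>D\<close> containing \<open>C\<close>. It is Hausdorff, because the sets \<open>f i ` C\<close> are Hausdorff
  and the \<open>f i\<close> separate points. So the compact set \<open>C\<close> is closed in \<open>D\<close> and hence in \<open>Z\<close>.\<close>

lemma weak_hausdorff_jointly_injective:
  assumes cont: "\<And>i. i \<in> I \<Longrightarrow> continuous_map Z (Y i) (f i)"
    and Y: "\<And>i. i \<in> I \<Longrightarrow> weak_hausdorff (Y i)"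
    and inj: "\<And>x y. x \<in> topspace Z \<Longrightarrow> y \<in> topspace Z \<Longrightarrow> (\<And>i. i \<in> I \<Longrightarrow> f i x = f i y) \<Longrightarrow> x = y"
  shows "weak_hausdorff Z"
  unfolding weak_hausdorff_def
proof (intro allI impI, elim conjE)
  fix K :: "'b set set topology" and u
  assume K: "compact_space K" "Hausdorff_space K" and u: "continuous_map K Z u"
  define C where "C = u ` topspace K"
  have CZ: "C \<subseteq> topspace Z" using u by (auto simp: C_def continuous_map_def Pi_iff)
  have comp: "continuous_map K (Y i) (f i \<circ> u)" if "i \<in> I" for i
    using continuous_map_compose[OF u cont[OF that]] .
  have img: "(f i \<circ> u) ` topspace K = f i ` C" for i by (auto simp: C_def)
  have closed: "closedin (Y i) (f i ` C)" and Haus: "Hausdorff_space (subtopology (Y i) (f i ` C))"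
    if "i \<in> I" for i
    using weak_hausdorff_closed_image[OF Y[OF that] K comp[OF that]]
      weak_hausdorff_Hausdorff_image[OF Y[OF that] K comp[OF that]] unfolding img by simp_all
  \<comment> \<open>The intersection with \<open>topspace Z\<close> covers the case of an empty family.\<close>
  define D where "D = topspace Z \<inter> \<Inter>((\<lambda>i. {z \<in> topspace Z. f i z \<in> f i ` C}) ` I)"
  have CD: "C \<subseteq> D" using CZ by (auto simp: D_def)
  have "closedin Z {z \<in> topspace Z. f i z \<in> f i ` C}" if "i \<in> I" for i
    using closedin_continuous_map_preimage[OF cont[OF that] closed[OF that]] .
  then have "closedin Z (\<Inter>(insert (topspace Z) ((\<lambda>i. {z \<in> topspace Z. f i z \<in> f i ` C}) ` I)))"
    by (intro closedin_Inter) auto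
  then have D: "closedin Z D" by (simp add: D_def)
  have tD: "topspace (subtopology Z D) = D" using D closedin_subset by fastforce
  have "Hausdorff_space (subtopology Z D)"
  proof (rule Hausdorff_space_jointly_injective[where I = I and f = f and Y = Y])
    fix i assume i: "i \<in> I"
    show "continuous_map (subtopology Z D) (Y i) (f i)"
      using cont[OF i] by (rule continuous_map_from_subtopology)
    have "f i ` D \<subseteq> f i ` C" using i by (auto simp: D_def)
    then have "subtopology (Y i) (f i ` D) = subtopology (subtopology (Y i) (f i ` C)) (f i ` D)"
      by (simp add: subtopology_subtopology inf.absorb2)
    then show "Hausdorff_space (subtopology (Y i) (f i ` topspace (subtopology Z D)))"
      unfolding tD by (simp add: Hausdorff_space_subtopology[OF Haus[OF i]])
  next
    fix x y assume "x \<in> topspace (subtopology Z D)" "y \<in> topspace (subtopology Z D)"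
      "\<And>i. i \<in> I \<Longrightarrow> f i x = f i y"
    then show "x = y" using inj by simp
  qed
  moreover have "compactin (subtopology Z D) C"
    using image_compactin[OF K(1)[unfolded compact_space_def] u] CD
    by (simp add: C_def compactin_subtopology)
  ultimately have "closedin (subtopology Z D) C" by (rule compactin_imp_closedin)
  then show "closedin Z (u ` topspace K)" using D closedin_trans_full unfolding C_def by blast
qed

lemma topspace_quot_topology [simp]: "topspace (quot_topology X E) = topspace X // E"
proof
  have "openin (quot_topology X E) (topspace X // E)"
    unfolding openin_quot_topology
    by (rule conjI) (auto simp: quotient_def intro: openin_subopen[THEN iffD2])
  then show "topspace X // E \<subseteq> topspace (quot_topology X E)" by (rule openin_subset)
  show "topspace (quot_topology X E) \<subseteq> topspace X // E"
    using openin_topspace[of "quot_topology X E"] unfolding openin_quot_topology by blast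
qed

lemma quotient_map_quot_topology: "quotient_map X (quot_topology X E) (\<lambda>x. E `` {x})"
  unfolding quotient_map_def by (auto simp: openin_quot_topology quotient_def)

text \<open>A map compatible with the relations sends each class into a single class, so a map given by
  \<open>c \<mapsto> E' `` (f ` c)\<close> on classes can be computed on one representative.\<close>

lemma image_class_eq:
  assumes "equiv A E" "equiv A' E'" and "\<And>a b. (a, b) \<in> E \<Longrightarrow> (f a, f b) \<in> E'" and "a \<in> A"
  shows "E' `` (f ` (E `` {a})) = E' `` {f a}"
proof -
  have "E' `` {f b} = E' `` {f a}" if "b \<in> E `` {a}" for b
    using that assms(2,3) by (metis Image_singleton_iff equiv_class_eq)
  moreover have "a \<in> E `` {a}" using assms(1,4) by (rule equiv_class_self)
  moreover have "E' `` (f ` S) = (\<Union>b\<in>S. E' `` {f b})" for S by blast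
  ultimately show ?thesis by blast
qed

lemma continuous_map_class_map:
  assumes E: "equiv (topspace X) E" "equiv (topspace X') E'" and f: "continuous_map X X' f"
    and rel: "\<And>a b. (a, b) \<in> E \<Longrightarrow> (f a, f b) \<in> E'"
  shows "continuous_map (quot_topology X E) (quot_topology X' E') (\<lambda>c. E' `` (f ` c))"
proof (rule continuous_compose_quotient_map[OF quotient_map_quot_topology])
  have "continuous_map X (quot_topology X' E') (\<lambda>a. E' `` {f a})"
    using continuous_map_compose[OF f quotient_imp_continuous_map[OF quotient_map_quot_topology]]
    by (simp add: o_def)
  then show "continuous_map X (quot_topology X' E') ((\<lambda>c. E' `` (f ` c)) \<circ> (\<lambda>x. E `` {x}))"
    by (rule continuous_map_eq) (simp add: image_class_eq[OF E rel])
qed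

text \<open>The quotient by an intersection of relations maps to the quotients by each of them, and these maps
  jointly separate points; so the intersection inherits a weak Hausdorff quotient. The total relation
  belongs to the family, since its quotient has at most one point.\<close>

lemma
  assumes R: "R \<subseteq> topspace X \<times> topspace X"
  shows equiv_wh_equiv: "equiv (topspace X) (wh_equiv X R)"
    and wh_equiv_superset: "R \<subseteq> wh_equiv X R"
    and weak_hausdorff_wh_equiv: "weak_hausdorff (quot_topology X (wh_equiv X R))"
proof -
  define F where "F = {E. equiv (topspace X) E \<and> R \<subseteq> E \<and> weak_hausdorff (quot_topology X E)}"
  have W: "wh_equiv X R = \<Inter> F" by (simp add: wh_equiv_def F_def)
  have total: "topspace X \<times> topspace X \<in> F"
  proof -
    have e: "equiv (topspace X) (topspace X \<times> topspace X)"
      by (auto simp: equiv_def refl_on_def sym_def trans_def)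
    have q: "topspace X // (topspace X \<times> topspace X) \<subseteq> {topspace X}" by (auto simp: quotient_def)
    have "weak_hausdorff (quot_topology X (topspace X \<times> topspace X))"
      unfolding weak_hausdorff_def
    proof (intro allI impI, elim conjE)
      fix K :: "'a set set set topology" and u
      let ?Q = "quot_topology X (topspace X \<times> topspace X)"
      assume "continuous_map K ?Q u"
      then have "u ` topspace K \<subseteq> topspace ?Q" by (auto simp: continuous_map_def Pi_iff)
      moreover have "topspace ?Q \<subseteq> {topspace X}" using q by simp
      ultimately have "u ` topspace K = {} \<or> u ` topspace K = topspace ?Q" by blast
      then show "closedin ?Q (u ` topspace K)" by (metis closedin_empty closedin_topspace)
    qed
    then show ?thesis using e R by (simp add: F_def)
  qed
  show e: "equiv (topspace X) (wh_equiv X R)"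
    unfolding W
  proof (rule equivI)
    have eF: "refl_on (topspace X) E" "sym E" "trans E" if "E \<in> F" for E
      using that unfolding F_def equiv_def by blast+
    show "\<Inter> F \<subseteq> topspace X \<times> topspace X" using total by (rule Inter_lower)
    show "refl_on (topspace X) (\<Inter> F)"
      using eF(1) unfolding refl_on_def by (intro ballI InterI) blast
    show "sym (\<Inter> F)" using eF(2) by (intro symI InterI) (meson InterD symD)
    show "trans (\<Inter> F)" using eF(3) by (intro transI InterI) (meson InterD transD)
  qed
  show "R \<subseteq> wh_equiv X R" by (auto simp: W F_def)
  show "weak_hausdorff (quot_topology X (wh_equiv X R))"
  proof (rule weak_hausdorff_jointly_injective[where I = F and Y = "quot_topology X"
        and f = "\<lambda>E c. E `` c"])
    fix E assume E: "E \<in> F"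
    then have eE: "equiv (topspace X) E" by (simp add: F_def)
    show "continuous_map (quot_topology X (wh_equiv X R)) (quot_topology X E) ((``) E)"
      using continuous_map_class_map[OF e eE continuous_map_id] E by (auto simp: W)
    show "weak_hausdorff (quot_topology X E)" using E by (simp add: F_def)
  next
    fix c c'
    assume "c \<in> topspace (quot_topology X (wh_equiv X R))"
      "c' \<in> topspace (quot_topology X (wh_equiv X R))" and eq: "\<And>E. E \<in> F \<Longrightarrow> E `` c = E `` c'"
    then obtain a b where a: "a \<in> topspace X" "c = wh_equiv X R `` {a}"
      and b: "b \<in> topspace X" "c' = wh_equiv X R `` {b}" by (auto elim!: quotientE)
    have "(a, b) \<in> E" if E: "E \<in> F" for E
    proof -
      have eE: "equiv (topspace X) E" using E by (simp add: F_def)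
      have "E `` c = E `` {a}" "E `` c' = E `` {b}"
        using image_class_eq[OF e eE, of "\<lambda>x. x"] a b E by (auto simp: W)
      then have "E `` {a} = E `` {b}" using eq[OF E] by simp
      then show ?thesis using eE b(1) by (rule eq_equiv_class)
    qed
    then have "(a, b) \<in> wh_equiv X R" by (simp add: W)
    then show "c = c'" unfolding a b by (rule equiv_class_eq[OF e])
  qed
qed

text \<open>The pullback along \<open>f\<close> of the relation on \<open>X'\<close> is an equivalence relation whose quotient injects
  continuously into a weak Hausdorff space. The smallest such relation is therefore contained in it.\<close>

lemma wh_equiv_map:
  assumes R: "R \<subseteq> topspace X \<times> topspace X" and R': "R' \<subseteq> topspace X' \<times> topspace X'"
    and f: "continuous_map X X' f" and rel: "\<And>a b. (a, b) \<in> R \<Longrightarrow> (f a, f b) \<in> wh_equiv X' R'"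
    and ab: "(a, b) \<in> wh_equiv X R"
  shows "(f a, f b) \<in> wh_equiv X' R'"
proof -
  define E' where "E' = wh_equiv X' R'"
  have e': "equiv (topspace X') E'" unfolding E'_def by (rule equiv_wh_equiv[OF R'])
  define E where "E = {(a, b). a \<in> topspace X \<and> b \<in> topspace X \<and> (f a, f b) \<in> E'}"
  have fX: "f x \<in> topspace X'" if "x \<in> topspace X" for x
    using f that by (auto simp: continuous_map_def Pi_iff)
  have e: "equiv (topspace X) E"
    using e' fX unfolding E_def equiv_def refl_on_def sym_def trans_def by blast
  have EE: "\<And>a b. (a, b) \<in> E \<Longrightarrow> (f a, f b) \<in> E'" by (simp add: E_def)
  have "weak_hausdorff (quot_topology X E)"
  proof (rule weak_hausdorff_jointly_injective[where I = "{()}" and f = "\<lambda>_ c. E' `` (f ` c)"])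
    show "continuous_map (quot_topology X E) (quot_topology X' E') (\<lambda>c. E' `` (f ` c))"
      by (rule continuous_map_class_map[OF e e' f EE])
    show "weak_hausdorff (quot_topology X' E')"
      unfolding E'_def by (rule weak_hausdorff_wh_equiv[OF R'])
    fix c c' assume "c \<in> topspace (quot_topology X E)" "c' \<in> topspace (quot_topology X E)"
      and "\<And>i. i \<in> {()} \<Longrightarrow> E' `` (f ` c) = E' `` (f ` c')"
    then obtain a b where a: "a \<in> topspace X" "c = E `` {a}" and b: "b \<in> topspace X" "c' = E `` {b}"
      and eq: "E' `` (f ` c) = E' `` (f ` c')" by (auto elim!: quotientE)
    then have "E' `` {f a} = E' `` {f b}"
      by (simp add: image_class_eq[OF e e' EE])
    then have "(f a, f b) \<in> E'" using e' fX[OF b(1)] by (rule eq_equiv_class)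
    then have "(a, b) \<in> E" using a b by (simp add: E_def)
    then show "c = c'" unfolding a b by (rule equiv_class_eq[OF e])
  qed
  then have "wh_equiv X R \<subseteq> E"
    unfolding wh_equiv_def using e R rel by (intro Inter_lower) (auto simp: E_def E'_def)
  then show ?thesis using ab by (auto simp: E_def E'_def)
qed

section \<open>k-ification\<close>

lemma topspace_kify [simp]: "topspace (kify X) = topspace X"
proof
  have "openin (kify X) (topspace X)"
    unfolding openin_kify by (simp add: openin_subtopology_Int)
  then show "topspace X \<subseteq> topspace (kify X)" by (rule openin_subset)
  show "topspace (kify X) \<subseteq> topspace X"
    using openin_topspace[of "kify X"] unfolding openin_kify by blast
qed

lemma openin_imp_openin_kify: "openin X U \<Longrightarrow> openin (kify X) U"
  unfolding openin_kify by (simp add: openin_subtopology_Int openin_subset)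

lemma continuous_map_kify_source: "continuous_map X Y f \<Longrightarrow> continuous_map (kify X) Y f"
  by (simp add: continuous_map_def openin_imp_openin_kify)

text \<open>The topology of \<open>kify X\<close> is finer than that of \<open>X\<close> but agrees with it on compact Hausdorff subsets, and
  the image of \<open>u\<close> is one.\<close>

lemma continuous_map_into_kify:
  assumes K: "compact_space K" and u: "continuous_map K X u"
    and H: "Hausdorff_space (subtopology X (u ` topspace K))"
  shows "continuous_map K (kify X) u"
  unfolding continuous_map_def
proof (intro conjI allI impI)
  show uX: "u \<in> topspace K \<rightarrow> topspace (kify X)" using u by (simp add: continuous_map_def)
  fix U assume U: "openin (kify X) U"
  let ?C = "u ` topspace K"
  have "?C \<subseteq> topspace X" using uX by auto
  moreover have "compact_space (subtopology X ?C)"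
    using image_compactin[OF K[unfolded compact_space_def] u] by (simp add: compactin_subspace)
  ultimately have "openin (subtopology X ?C) (U \<inter> ?C)" using U H unfolding openin_kify by blast
  moreover have "continuous_map K (subtopology X ?C) u"
    using u by (simp add: continuous_map_in_subtopology)
  ultimately have "openin K {x \<in> topspace K. u x \<in> U \<inter> ?C}"
    using openin_continuous_map_preimage by blast
  moreover have "{x \<in> topspace K. u x \<in> U \<inter> ?C} = {x \<in> topspace K. u x \<in> U}" by blast
  ultimately show "openin K {x \<in> topspace K. u x \<in> U}" by simp
qed

definition compact_Hausdorff_subsets :: "'a topology \<Rightarrow> 'a set set" where
  "compact_Hausdorff_subsets X = {C. C \<subseteq> topspace X \<and> compact_space (subtopology X C) \<and>
     Hausdorff_space (subtopology X C)}"

text \<open>This presentation of the k-ification turns questions about products with it into questions about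
  products of quotient maps.\<close>

lemma quotient_map_kify:
  "quotient_map (sum_topology (subtopology X) (compact_Hausdorff_subsets X)) (kify X) snd"
  unfolding quotient_map_def
proof (intro conjI allI impI)
  let ?K = "compact_Hausdorff_subsets X"
  \<comment> \<open>Points are compact Hausdorff, so the subsets cover the space.\<close>
  have pt: "{x} \<in> ?K" if "x \<in> topspace X" for x
    using that by (simp add: compact_Hausdorff_subsets_def compact_space_subtopology Hausdorff_space_def)
  show "snd ` topspace (sum_topology (subtopology X) ?K) = topspace (kify X)"
  proof (intro equalityI subsetI)
    fix x assume "x \<in> topspace (kify X)"
    then have "({x}, x) \<in> topspace (sum_topology (subtopology X) ?K)" using pt by simp
    then show "x \<in> snd ` topspace (sum_topology (subtopology X) ?K)"
      by (rule image_eqI[rotated]) simp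
  qed (clarsimp simp: compact_Hausdorff_subsets_def)
  fix U assume "U \<subseteq> topspace (kify X)"
  then have U: "U \<subseteq> topspace X" by simp
  have sub: "topspace (subtopology X C) = C" if "C \<in> ?K" for C
    using that by (auto simp: compact_Hausdorff_subsets_def)
  have pre: "{x. (C, x) \<in> {x \<in> topspace (sum_topology (subtopology X) ?K). snd x \<in> U}} = U \<inter> C"
    if "C \<in> ?K" for C
    using sub[OF that] that by auto
  have "{x \<in> topspace (sum_topology (subtopology X) ?K). snd x \<in> U} \<subseteq> Sigma ?K (topspace \<circ> subtopology X)"
    by auto
  then have "openin (sum_topology (subtopology X) ?K)
         {x \<in> topspace (sum_topology (subtopology X) ?K). snd x \<in> U} \<longleftrightarrow>
       (\<forall>C\<in>?K. openin (subtopology X C) (U \<inter> C))"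
    unfolding openin_sum_topology using pre by simp
  also have "\<dots> \<longleftrightarrow> openin (kify X) U"
    using U by (auto simp: openin_kify compact_Hausdorff_subsets_def)
  finally show "openin (sum_topology (subtopology X) ?K)
         {x \<in> topspace (sum_topology (subtopology X) ?K). snd x \<in> U} = openin (kify X) U" .
qed

lemma continuous_map_sum_topology:
  "continuous_map (sum_topology Y I) W f \<longleftrightarrow> (\<forall>i\<in>I. continuous_map (Y i) W (\<lambda>y. f (i, y)))"
proof
  assume f: "continuous_map (sum_topology Y I) W f"
  show "\<forall>i\<in>I. continuous_map (Y i) W (\<lambda>y. f (i, y))"
    using continuous_map_compose[OF continuous_map_component_injection f] by (simp add: o_def)
next
  assume f: "\<forall>i\<in>I. continuous_map (Y i) W (\<lambda>y. f (i, y))"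
  show "continuous_map (sum_topology Y I) W f"
    unfolding continuous_map_def openin_sum_topology
  proof (intro conjI allI impI ballI)
    show "f \<in> topspace (sum_topology Y I) \<rightarrow> topspace W"
      using f by (auto simp: continuous_map_def Pi_iff)
    fix U i assume U: "openin W U" and i: "i \<in> I"
    have "openin (Y i) {y \<in> topspace (Y i). f (i, y) \<in> U}"
      using f i U openin_continuous_map_preimage by blast
    moreover have "{y \<in> topspace (Y i). f (i, y) \<in> U} =
        {y. (i, y) \<in> {x \<in> topspace (sum_topology Y I). f x \<in> U}}" using i by auto
    ultimately show "openin (Y i) {y. (i, y) \<in> {x \<in> topspace (sum_topology Y I). f x \<in> U}}" by simp
  qed auto
qed

text \<open>The product with \<open>L\<close> distributes over disjoint unions.\<close>

lemma continuous_map_prod_sum_topology: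
  assumes f: "\<And>i. i \<in> I \<Longrightarrow> continuous_map (prod_topology L (Y i)) W (\<lambda>(j, y). f (j, i, y))"
  shows "continuous_map (prod_topology L (sum_topology Y I)) W f"
  unfolding continuous_map_def
proof (intro conjI allI impI)
  show "f \<in> topspace (prod_topology L (sum_topology Y I)) \<rightarrow> topspace W"
    using f by (fastforce simp: continuous_map_def Pi_iff)
  fix U assume U: "openin W U"
  show "openin (prod_topology L (sum_topology Y I))
      {z \<in> topspace (prod_topology L (sum_topology Y I)). f z \<in> U}" (is "openin _ ?V")
    unfolding openin_prod_topology_alt
  proof (intro allI impI)
    fix j z assume jz: "(j, z) \<in> ?V"
    obtain i y where z: "z = (i, y)" by (cases z)
    have i: "i \<in> I" "y \<in> topspace (Y i)" "j \<in> topspace L" "f (j, i, y) \<in> U" using jz z by auto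
    let ?W = "{q \<in> topspace (prod_topology L (Y i)). (\<lambda>(j, y). f (j, i, y)) q \<in> U}"
    have openW: "openin (prod_topology L (Y i)) ?W"
      using openin_continuous_map_preimage[OF f[OF i(1)] U] .
    have "(j, y) \<in> ?W" using i by simp
    with openW obtain A B where AB: "openin L A" "openin (Y i) B" "j \<in> A" "y \<in> B"
      "A \<times> B \<subseteq> ?W"
      by (blast dest: openin_prod_topology_alt[THEN iffD1, rule_format])
    have "openin (sum_topology Y I) (Pair i ` B)"
      using open_map_component_injection[OF i(1), of Y] AB(2) unfolding open_map_def by blast
    moreover have "A \<times> Pair i ` B \<subseteq> ?V" using AB(5) i(1) by auto
    ultimately show "\<exists>A B. openin L A \<and> openin (sum_topology Y I) B \<and> j \<in> A \<and> z \<in> B \<and> A \<times> B \<subseteq> ?V"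
      using AB(1,3,4) z by blast
  qed
qed

text \<open>By Whitehead's theorem the product with the locally compact Hausdorff space \<open>L\<close> preserves the quotient
  map onto \<open>kify X\<close>. So continuity on \<open>L \<times> kify X\<close> can be tested on the compact Hausdorff spaces \<open>L \<times> C\<close>.\<close>

lemma continuous_map_prod_kify:
  assumes L: "compact_space L" "Hausdorff_space L"
    and f: "\<And>C. C \<in> compact_Hausdorff_subsets X \<Longrightarrow> continuous_map (prod_topology L (subtopology X C)) W f"
  shows "continuous_map (prod_topology L (kify X)) W f"
proof (rule continuous_compose_quotient_map[OF quotient_map_prod_right[OF _ _ quotient_map_kify]])
  show "locally_compact_space L" using L by (simp add: compact_imp_locally_compact_space)
  show "Hausdorff_space L \<or> regular_space L" using L by simp
  show "continuous_map (prod_topology L (sum_topology (subtopology X) (compact_Hausdorff_subsets X))) W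
      (f \<circ> (\<lambda>(x, y). (x, snd y)))"
    by (rule continuous_map_prod_sum_topology) (simp add: o_def case_prod_unfold f)
qed

lemma continuous_map_from_kify:
  assumes "\<And>C. C \<in> compact_Hausdorff_subsets X \<Longrightarrow> continuous_map (subtopology X C) W f"
  shows "continuous_map (kify X) W f"
  by (rule continuous_compose_quotient_map[OF quotient_map_kify])
    (simp add: continuous_map_sum_topology assms o_def)

text \<open>This supplies the hypothesis of \<open>continuous_map_into_kify\<close> for the products that make up a smash product.
  The image of \<open>K\<close> lies in the product of its projections, which are Hausdorff since \<open>L\<close> is Hausdorff and
  the other factors are weak Hausdorff.\<close>

lemma Hausdorff_compact_image_prod_product:
  assumes L: "Hausdorff_space L" and Y: "\<And>i. i \<in> I \<Longrightarrow> weak_hausdorff (Y i)"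
    and K: "compact_space K" "Hausdorff_space K"
    and u: "continuous_map K (prod_topology L (product_topology Y I)) u"
  shows "Hausdorff_space (subtopology (prod_topology L (product_topology Y I)) (u ` topspace K))"
proof -
  let ?P = "product_topology Y I" and ?C = "u ` topspace K"
  let ?D = "\<lambda>i. (\<lambda>x. snd (u x) i) ` topspace K"
  have s: "continuous_map K ?P (\<lambda>x. snd (u x))"
    using u by (simp add: continuous_map_pairwise o_def)
  have D: "Hausdorff_space (subtopology (Y i) (?D i))" if "i \<in> I" for i
    using weak_hausdorff_Hausdorff_image[OF Y[OF that] K] s that
    by (simp add: continuous_map_componentwise)
  have "Hausdorff_space (product_topology (\<lambda>i. subtopology (Y i) (?D i)) I)"
    using D by (simp add: Hausdorff_space_product_topology)
  then have "Hausdorff_space (subtopology ?P (\<Pi>\<^sub>E i\<in>I. ?D i))" by (simp add: subtopology_product_topology)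
  then have "Hausdorff_space (prod_topology L (subtopology ?P (\<Pi>\<^sub>E i\<in>I. ?D i)))"
    using L by (simp add: Hausdorff_space_prod_topology)
  moreover have "prod_topology L (subtopology ?P (\<Pi>\<^sub>E i\<in>I. ?D i)) =
      subtopology (prod_topology L ?P) (topspace L \<times> (\<Pi>\<^sub>E i\<in>I. ?D i))"
    using prod_topology_subtopology(2)[of L ?P "\<Pi>\<^sub>E i\<in>I. ?D i"] by (simp add: subtopology_Times)
  ultimately have "Hausdorff_space (subtopology (subtopology (prod_topology L ?P)
      (topspace L \<times> (\<Pi>\<^sub>E i\<in>I. ?D i))) ?C)" by (simp add: Hausdorff_space_subtopology)
  moreover have "?C \<subseteq> topspace L \<times> (\<Pi>\<^sub>E i\<in>I. ?D i)"
  proof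
    fix z assume "z \<in> ?C"
    then obtain x where x: "x \<in> topspace K" "z = u x" by blast
    have "u x \<in> topspace (prod_topology L ?P)" using u x(1) by (auto simp: continuous_map_def Pi_iff)
    then have "fst (u x) \<in> topspace L" "snd (u x) \<in> extensional I"
      by (auto simp: PiE_def mem_Times_iff)
    then show "z \<in> topspace L \<times> (\<Pi>\<^sub>E i\<in>I. ?D i)" using x by (auto simp: PiE_def mem_Times_iff)
  qed
  ultimately show ?thesis by (simp add: subtopology_subtopology inf.absorb2)
qed

section \<open>The spaces of linear isometric embeddings\<close>

lemma compact_componentwise:
  fixes S :: "'i \<Rightarrow> 'b::topological_space set"
  assumes "\<And>i. compact (S i)"
  shows "compact {f. \<forall>i. f i \<in> S i}"
proof -
  have "compactin (product_topology (\<lambda>i. euclidean) UNIV) (\<Pi>\<^sub>E i\<in>UNIV. S i)"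
    using assms by (simp add: compactin_PiE)
  then show ?thesis by (simp add: euclidean_product_topology PiE_UNIV_domain Pi_def)
qed

lemma Jsum_points_iff:
  "(A, w) \<in> Jsum_points r n m \<longleftrightarrow>
     (\<forall>i l a. \<not> (i < r \<and> l < m \<and> a < n i) \<longrightarrow> A i l a = 0) \<and> (\<forall>l. \<not> l < m \<longrightarrow> w l = 0) \<and>
     (\<forall>i k a b. i < r \<longrightarrow> k < r \<longrightarrow> a < n i \<longrightarrow> b < n k \<longrightarrow>
        (\<Sum>l<m. A i l a * A k l b) = (if i = k \<and> a = b then 1 else 0)) \<and>
     (\<forall>i a. i < r \<longrightarrow> a < n i \<longrightarrow> (\<Sum>l<m. A i l a * w l) = 0)"
  unfolding Jsum_points_def mem_Collect_eq case_prod_conv by blast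

lemma J_points_iff:
  "(A, w) \<in> J_points n m \<longleftrightarrow>
     (\<forall>l a. \<not> (l < m \<and> a < n) \<longrightarrow> A l a = 0) \<and> (\<forall>l. \<not> l < m \<longrightarrow> w l = 0) \<and>
     (\<forall>a b. a < n \<longrightarrow> b < n \<longrightarrow> (\<Sum>l<m. A l a * A l b) = (if a = b then 1 else 0)) \<and>
     (\<forall>a. a < n \<longrightarrow> (\<Sum>l<m. A l a * w l) = 0)"
  unfolding J_points_def mem_Collect_eq case_prod_conv by blast

lemma Jsum_points_entry_bound:
  assumes "(A, w) \<in> Jsum_points r n m"
  shows "A i l a \<in> {-1..1}"
proof (cases "i < r \<and> l < m \<and> a < n i")
  case True
  then have "(\<Sum>l<m. A i l a * A i l a) = 1" using assms by (simp add: Jsum_points_iff)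
  moreover have "A i l a * A i l a \<le> (\<Sum>l<m. A i l a * A i l a)"
    by (rule member_le_sum) (use True in auto)
  ultimately have "(A i l a)\<^sup>2 \<le> 1" by (simp add: power2_eq_square)
  then show ?thesis by (simp add: abs_square_le_1 abs_le_iff)
next
  case False
  then show ?thesis using assms by (auto simp: Jsum_points_iff)
qed

text \<open>The columns of the matrices are unit vectors, so only the vector \<open>w\<close> can tend to infinity: its squared
  length is a proper function on the space of pairs \<open>(A, w)\<close>.\<close>

lemma compact_Jsum_sublevel: "compact {z \<in> Jsum_points r n m. (\<Sum>l<m. (snd z l)\<^sup>2) \<le> c}"
proof -
  define B where "B = {A :: nat \<Rightarrow> mat. \<forall>i. A i \<in> {M. \<forall>l. M l \<in> {v. \<forall>a. v a \<in> {-1..1}}}} \<times>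
    {w :: vec. \<forall>l. w l \<in> {- (1 + \<bar>c\<bar>)..1 + \<bar>c\<bar>}}"
  have "compact B"
    unfolding B_def by (intro compact_Times compact_componentwise compact_Icc)
  moreover define S where "S = {z :: (nat \<Rightarrow> mat) \<times> vec.
     (\<forall>i l a. \<not> (i < r \<and> l < m \<and> a < n i) \<longrightarrow> fst z i l a = 0) \<and> (\<forall>l. \<not> l < m \<longrightarrow> snd z l = 0) \<and>
     (\<forall>i k a b. i < r \<longrightarrow> k < r \<longrightarrow> a < n i \<longrightarrow> b < n k \<longrightarrow>
        (\<Sum>l<m. fst z i l a * fst z k l b) = (if i = k \<and> a = b then 1 else 0)) \<and>
     (\<forall>i a. i < r \<longrightarrow> a < n i \<longrightarrow> (\<Sum>l<m. fst z i l a * snd z l) = 0) \<and>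
     (\<Sum>l<m. (snd z l)\<^sup>2) \<le> c}"
  moreover have "closed S"
    unfolding S_def
    by (intro closed_Collect_conj closed_Collect_all closed_Collect_imp open_Collect_const
        closed_Collect_eq closed_Collect_le continuous_on_sum continuous_on_mult continuous_on_power
        continuous_on_const continuous_on_product_then_coordinatewise[where f = "\<lambda>z. fst z _ _"]
        continuous_on_product_then_coordinatewise[where f = "\<lambda>z. fst z _"]
        continuous_on_product_then_coordinatewise[where f = fst]
        continuous_on_product_then_coordinatewise[where f = snd]
        continuous_on_fst continuous_on_snd continuous_on_id)
  ultimately have "compact (B \<inter> S)" by blast
  moreover have "{z \<in> Jsum_points r n m. (\<Sum>l<m. (snd z l)\<^sup>2) \<le> c} = B \<inter> S"
  proof (intro equalityI subsetI)
    fix z assume "z \<in> B \<inter> S"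
    then show "z \<in> {z \<in> Jsum_points r n m. (\<Sum>l<m. (snd z l)\<^sup>2) \<le> c}"
      by (cases z) (simp add: Jsum_points_iff S_def)
  next
    fix z assume z: "z \<in> {z \<in> Jsum_points r n m. (\<Sum>l<m. (snd z l)\<^sup>2) \<le> c}"
    obtain A w where Aw: "z = (A, w)" by (cases z)
    have mem: "(A, w) \<in> Jsum_points r n m" and c: "(\<Sum>l<m. (w l)\<^sup>2) \<le> c" using z Aw by auto
    have "w l \<in> {- (1 + \<bar>c\<bar>)..1 + \<bar>c\<bar>}" for l
    proof (cases "l < m")
      case True
      have "(w l)\<^sup>2 \<le> (\<Sum>l<m. (w l)\<^sup>2)" by (rule member_le_sum) (use True in auto)
      then have "(w l)\<^sup>2 \<le> \<bar>c\<bar>" using c by linarith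
      also have "\<dots> \<le> (1 + \<bar>c\<bar>)\<^sup>2" by (simp add: power2_eq_square algebra_simps)
      finally have "\<bar>w l\<bar> \<le> 1 + \<bar>c\<bar>" by (simp add: abs_le_square_iff[symmetric])
      then show ?thesis by auto
    next
      case False
      then show ?thesis using mem by (simp add: Jsum_points_iff)
    qed
    then have "z \<in> B" unfolding B_def Aw using Jsum_points_entry_bound[OF mem] by simp
    moreover have "z \<in> S" using mem c unfolding Aw by (simp add: Jsum_points_iff S_def)
    ultimately show "z \<in> B \<inter> S" by blast
  qed
  ultimately show ?thesis by simp
qed

lemma compact_J_sublevel: "compact {z \<in> J_points n m. (\<Sum>l<m. (snd z l)\<^sup>2) \<le> c}"
proof -
  \<comment> \<open>An isometric embedding of one summand is a point of \<^const>\<open>Jsum_points\<close> with \<open>r = 1\<close>.\<close>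
  let ?f = "\<lambda>z :: (nat \<Rightarrow> mat) \<times> vec. (fst z 0, snd z)"
  let ?S = "{z \<in> Jsum_points 1 (\<lambda>_. n) m. (\<Sum>l<m. (snd z l)\<^sup>2) \<le> c}"
  have "compact (?f ` ?S)"
    by (intro compact_continuous_image compact_Jsum_sublevel continuous_on_Pair
        continuous_on_product_then_coordinatewise[where f = fst] continuous_on_fst continuous_on_snd
        continuous_on_id)
  moreover have "{z \<in> J_points n m. (\<Sum>l<m. (snd z l)\<^sup>2) \<le> c} = ?f ` ?S"
  proof (intro equalityI subsetI)
    fix z assume z: "z \<in> {z \<in> J_points n m. (\<Sum>l<m. (snd z l)\<^sup>2) \<le> c}"
    obtain A w where Aw: "z = (A, w)" by (cases z)
    have "(\<lambda>i. if i = 0 then A else (\<lambda>_ _. 0), w) \<in> ?S"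
      using z unfolding Aw by (auto simp: Jsum_points_iff J_points_iff)
    then show "z \<in> ?f ` ?S" unfolding Aw by (rule image_eqI[rotated]) simp
  qed (auto simp: Jsum_points_iff J_points_iff)
  ultimately show ?thesis by simp
qed

text \<open>A continuous function with compact sublevel sets makes \<open>S\<close> locally compact, since
  \<open>{z. N z \<le> N x + 1}\<close> is a compact neighbourhood of \<open>x\<close>.\<close>

lemma compact_Hausdorff_Alexandroff:
  fixes S :: "'a::metric_space set" and N :: "'a \<Rightarrow> real"
  assumes N: "continuous_on S N" and compact: "\<And>c. compact {z \<in> S. N z \<le> c}"
  shows "compact_space (Alexandroff_compactification (top_of_set S))"
    and "Hausdorff_space (Alexandroff_compactification (top_of_set S))"
proof -
  have "locally_compact_space (top_of_set S)"
    unfolding locally_compact_space_def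
  proof
    fix x assume x: "x \<in> topspace (top_of_set S)"
    have "continuous_map (top_of_set S) euclideanreal N" using N by simp
    then have "openin (top_of_set S) {z \<in> topspace (top_of_set S). N z \<in> {..<N x + 1}}"
      by (rule openin_continuous_map_preimage) simp
    then have "openin (top_of_set S) {z \<in> S. N z < N x + 1}" by simp
    moreover have "compactin (top_of_set S) {z \<in> S. N z \<le> N x + 1}"
      using compact by (simp add: compactin_subtopology)
    ultimately show "\<exists>U K. openin (top_of_set S) U \<and> compactin (top_of_set S) K \<and> x \<in> U \<and> U \<subseteq> K"
      by (rule_tac exI[of _ "{z \<in> S. N z < N x + 1}"], rule_tac exI[of _ "{z \<in> S. N z \<le> N x + 1}"])
        (use x in auto)
  qed
  then show "Hausdorff_space (Alexandroff_compactification (top_of_set S))"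
    by (simp add: Hausdorff_space_Alexandroff_compactification Hausdorff_space_subtopology)
qed simp

lemma continuous_on_sqnorm: "continuous_on S (\<lambda>z. \<Sum>l<m. (snd z l :: real)\<^sup>2)"
  by (intro continuous_on_sum continuous_on_power
      continuous_on_product_then_coordinatewise[where f = snd] continuous_on_snd continuous_on_id)

lemma compact_space_J: "compact_space (J n m)" and Hausdorff_space_J: "Hausdorff_space (J n m)"
  unfolding J_def
  using compact_Hausdorff_Alexandroff[OF continuous_on_sqnorm compact_J_sublevel] by blast+

lemma Hausdorff_space_Jsum: "Hausdorff_space (Jsum r n m)"
  unfolding Jsum_def
  using compact_Hausdorff_Alexandroff[OF continuous_on_sqnorm compact_Jsum_sublevel] by blast

lemma topspace_J: "topspace (J n m) = insert None (Some ` J_points n m)"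
  by (simp add: J_def)

lemma topspace_Jsum: "topspace (Jsum r n m) = insert None (Some ` Jsum_points r n m)"
  by (simp add: Jsum_def)

text \<open>One-point compactification is functorial for proper maps \<open>f\<close> defined on an open subspace \<open>Y\<close> of \<open>X\<close>,
  embedded by \<open>e\<close>; the complement of \<open>Y\<close> goes to infinity. Properness makes the preimages of compact sets
  compact, hence closed in \<open>X\<close>, and so the preimages of neighbourhoods of infinity open.\<close>

lemma continuous_map_Alexandroff_extension:
  assumes X: "Hausdorff_space X" and e: "open_map Y X e" "continuous_map Y X e"
    and f: "continuous_map Y R f"
    and proper: "\<And>C. compactin R C \<Longrightarrow> closedin R C \<Longrightarrow> compactin Y {y \<in> topspace Y. f y \<in> C}"
    and F: "\<And>y. y \<in> topspace Y \<Longrightarrow> F (e y) = Some (f y)"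
      "\<And>x. x \<in> topspace X - e ` topspace Y \<Longrightarrow> F x = None"
  shows "continuous_map X (Alexandroff_compactification R) F"
  unfolding continuous_map_def
proof (intro conjI allI impI)
  have fR: "f y \<in> topspace R" if "y \<in> topspace Y" for y
    using f that by (auto simp: continuous_map_def Pi_iff)
  have eX: "e y \<in> topspace X" if "y \<in> topspace Y" for y
    using e that by (auto simp: continuous_map_def Pi_iff)
  show "F \<in> topspace X \<rightarrow> topspace (Alexandroff_compactification R)"
  proof
    fix x assume x: "x \<in> topspace X"
    show "F x \<in> topspace (Alexandroff_compactification R)"
    proof (cases "x \<in> e ` topspace Y")
      case True
      then show ?thesis using F(1) fR by auto
    qed (use F(2)[of x] x in simp)
  qed
  fix U assume "openin (Alexandroff_compactification R) U"
  then consider V where "openin R V" "U = Some ` V"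
    | C where "compactin R C" "closedin R C" "U = insert None (Some ` (topspace R - C))"
    unfolding openin_Alexandroff_compactification by blast
  then show "openin X {x \<in> topspace X. F x \<in> U}"
  proof cases
    case 1
    have "{x \<in> topspace X. F x \<in> U} = e ` {y \<in> topspace Y. f y \<in> V}"
    proof (intro equalityI subsetI)
      fix x assume x: "x \<in> {x \<in> topspace X. F x \<in> U}"
      then have "F x \<noteq> None" using 1 by auto
      then have "x \<in> e ` topspace Y" using F(2)[of x] x by (cases "x \<in> e ` topspace Y") auto
      then obtain y where y: "y \<in> topspace Y" "x = e y" by blast
      then show "x \<in> e ` {y \<in> topspace Y. f y \<in> V}" using x F(1)[OF y(1)] 1 by auto
    qed (use F eX 1 in auto)
    then show ?thesis
      using e(1) openin_continuous_map_preimage[OF f 1(1)] by (simp add: open_map_def)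
  next
    case 2
    have "{x \<in> topspace X. F x \<in> U} = topspace X - e ` {y \<in> topspace Y. f y \<in> C}"
    proof (intro equalityI subsetI)
      fix x assume x: "x \<in> {x \<in> topspace X. F x \<in> U}"
      have False if "y \<in> topspace Y" "x = e y" "f y \<in> C" for y
        using x F(1)[OF that(1)] that 2 by auto
      then show "x \<in> topspace X - e ` {y \<in> topspace Y. f y \<in> C}" using x by blast
    next
      fix x assume x: "x \<in> topspace X - e ` {y \<in> topspace Y. f y \<in> C}"
      show "x \<in> {x \<in> topspace X. F x \<in> U}"
      proof (cases "x \<in> e ` topspace Y")
        case True
        then obtain y where y: "y \<in> topspace Y" "x = e y" by blast
        then have "f y \<notin> C" using x by blast
        then show ?thesis using x F(1)[OF y(1)] y fR 2(3) by auto
      next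
        case False
        then show ?thesis using x F(2)[of x] 2(3) by auto
      qed
    qed
    moreover have "closedin X (e ` {y \<in> topspace Y. f y \<in> C})"
      using compactin_imp_closedin[OF X] image_compactin[OF proper[OF 2(1,2)] e(2)] by blast
    ultimately show ?thesis by (simp add: openin_diff)
  qed
qed

section \<open>Composition of isometric embeddings\<close>

text \<open>The matrix \<open>B\<close> is moved to the other side of the inner product. The
  norms and inner products of the vectors \<open>B u\<close> thus depend only on those of the columns of \<open>B\<close>.\<close>

lemma mat_vec_inner:
  "(\<Sum>l<m. mat_vec k B u l * x l) = (\<Sum>p<k. u p * (\<Sum>l<m. B l p * x l))"
proof -
  have "(\<Sum>l<m. mat_vec k B u l * x l) = (\<Sum>l<m. \<Sum>p<k. u p * (B l p * x l))"
    by (simp add: mat_vec_def sum_distrib_left sum_distrib_right mult_ac)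
  also have "\<dots> = (\<Sum>p<k. \<Sum>l<m. u p * (B l p * x l))" by (rule sum.swap)
  finally show ?thesis by (simp add: sum_distrib_left)
qed

lemma inner_mat_vec:
  "(\<Sum>l<m. x l * mat_vec k C v l) = (\<Sum>q<k. v q * (\<Sum>l<m. x l * C l q))"
  using mat_vec_inner[of k C v x m] by (simp add: mult.commute)

lemma mat_mult_column: "mat_mult k B A l a = mat_vec k B (\<lambda>p. A p a) l"
  by (simp add: mat_mult_def mat_vec_def)

lemma sum_Kronecker: "(\<Sum>q<(k::nat). v q * (if p = q then 1 else 0)) = (if p < k then v p else (0::real))"
proof -
  have "(\<Sum>q<k. v q * (if p = q then 1 else 0)) = (\<Sum>q<k. if q = p then v q else 0)"
    by (rule sum.cong) auto
  then show ?thesis by simp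
qed

lemma mat_vec_isometry:
  assumes "\<And>p q. p < k \<Longrightarrow> q < k \<Longrightarrow> (\<Sum>l<m. B l p * B l q) = (if p = q then 1 else 0)"
  shows "(\<Sum>l<m. mat_vec k B u l * mat_vec k B v l) = (\<Sum>p<k. u p * v p)"
proof -
  have "(\<Sum>l<m. B l p * mat_vec k B v l) = v p" if "p < k" for p
  proof -
    have "(\<Sum>l<m. B l p * mat_vec k B v l) = (\<Sum>q<k. v q * (if p = q then 1 else 0))"
      unfolding inner_mat_vec by (rule sum.cong) (use assms that in auto)
    then show ?thesis using that by (simp only: sum_Kronecker if_True)
  qed
  then show ?thesis by (simp add: mat_vec_inner)
qed

lemma mat_vec_orthogonal:
  assumes "\<And>p. p < k \<Longrightarrow> (\<Sum>l<m. B l p * x l) = 0"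
  shows "(\<Sum>l<m. mat_vec k B u l * x l) = 0"
  using assms by (simp add: mat_vec_inner)

lemma mat_vec_mat_mult: "mat_vec n (mat_mult m B A) w = mat_vec m B (mat_vec n A w)"
proof
  fix l
  have "(\<Sum>j<n. (\<Sum>k<m. B l k * A k j) * w j) = (\<Sum>j<n. \<Sum>k<m. B l k * (A k j * w j))"
    by (simp add: sum_distrib_right mult.assoc)
  also have "\<dots> = (\<Sum>k<m. \<Sum>j<n. B l k * (A k j * w j))" by (rule sum.swap)
  finally show "mat_vec n (mat_mult m B A) w l = mat_vec m B (mat_vec n A w) l"
    by (simp add: mat_vec_def mat_mult_def sum_distrib_left)
qed

lemma mat_mult_assoc: "mat_mult n (mat_mult m B A) C = mat_mult m B (mat_mult n A C)"
proof (intro ext)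
  fix l a
  show "mat_mult n (mat_mult m B A) C l a = mat_mult m B (mat_mult n A C) l a"
    unfolding mat_mult_column[of n _ C] mat_vec_mat_mult mat_mult_column[of m B "mat_mult n A C"] ..
qed

lemma mat_vec_add: "mat_vec k B (\<lambda>l. v l + w l) = (\<lambda>l. mat_vec k B v l + mat_vec k B w l)"
  by (simp add: mat_vec_def algebra_simps sum.distrib)

lemma mat_vec_sum: "mat_vec k B (\<lambda>l. \<Sum>i\<in>I. w i l) = (\<lambda>l. \<Sum>i\<in>I. mat_vec k B (w i) l)"
  unfolding mat_vec_def by (simp add: sum_distrib_left sum.swap[of _ I])

text \<open>Besides closure under composition, this gives the equation by which composition is proper: \<open>B\<close> is an
  isometry and \<open>v\<close> is orthogonal to its image, so Pythagoras applies to \<open>v + B w\<close>.\<close>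

lemma Jsum_post_points:
  assumes B: "(B, v) \<in> J_points m m'" and A: "(A, w) \<in> Jsum_points r n m"
  shows "(\<lambda>i. mat_mult m B (A i), \<lambda>l. v l + mat_vec m B w l) \<in> Jsum_points r n m'"
    and "(\<Sum>l<m'. (v l + mat_vec m B w l)\<^sup>2) = (\<Sum>l<m'. (v l)\<^sup>2) + (\<Sum>l<m. (w l)\<^sup>2)"
proof -
  have iso: "(\<Sum>l<m'. mat_vec m B x l * mat_vec m B y l) = (\<Sum>p<m. x p * y p)" for x y
    by (rule mat_vec_isometry) (use B in \<open>simp add: J_points_iff\<close>)
  have orth: "(\<Sum>l<m'. mat_vec m B x l * v l) = 0" for x
    by (rule mat_vec_orthogonal) (use B in \<open>simp add: J_points_iff\<close>)
  have z: "mat_vec m B x l = 0" if "\<not> l < m'" for x l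
    using B that by (simp add: J_points_iff mat_vec_def)
  have z': "mat_mult m B (A i) l a = 0" if "\<not> (i < r \<and> l < m' \<and> a < n i)" for i l a
  proof (cases "l < m'")
    case True
    then have "A i p a = 0" for p using A that by (simp add: Jsum_points_iff)
    then show ?thesis by (simp add: mat_mult_def)
  qed (simp add: mat_mult_column z)
  show "(\<lambda>i. mat_mult m B (A i), \<lambda>l. v l + mat_vec m B w l) \<in> Jsum_points r n m'"
    unfolding Jsum_points_iff
  proof (intro conjI allI impI)
    fix l assume "\<not> l < m'" then show "v l + mat_vec m B w l = 0"
      using z B by (simp add: J_points_iff)
  next
    fix i k a b assume "i < r" "k < r" "a < n i" "b < n k"
    then show "(\<Sum>l<m'. mat_mult m B (A i) l a * mat_mult m B (A k) l b) = (if i = k \<and> a = b then 1 else 0)"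
      using A by (simp add: mat_mult_column iso Jsum_points_iff)
  next
    fix i a assume "i < r" "a < n i"
    then show "(\<Sum>l<m'. mat_mult m B (A i) l a * (v l + mat_vec m B w l)) = 0"
      using A by (simp add: mat_mult_column distrib_left sum.distrib iso orth Jsum_points_iff)
  qed (fact z')
  have "(\<Sum>l<m'. (v l + mat_vec m B w l)\<^sup>2) =
      (\<Sum>l<m'. (v l)\<^sup>2) + 2 * (\<Sum>l<m'. mat_vec m B w l * v l) + (\<Sum>l<m'. mat_vec m B w l * mat_vec m B w l)"
    by (simp add: power2_sum power2_eq_square sum.distrib sum_distrib_left algebra_simps)
  then show "(\<Sum>l<m'. (v l + mat_vec m B w l)\<^sup>2) = (\<Sum>l<m'. (v l)\<^sup>2) + (\<Sum>l<m. (w l)\<^sup>2)"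
    by (simp add: orth iso power2_eq_square)
qed

text \<open>The images of different summands under \<open>A\<close> are orthogonal, which leaves only the products of columns
  within one summand; there \<open>A i\<close> is an isometry and the claim reduces to the one for \<open>(B i, v i)\<close>.\<close>

lemma Jsum_pre_points:
  assumes A: "(A, w) \<in> Jsum_points r n m"
    and f: "\<And>i. i < r \<Longrightarrow> (B i, v i) \<in> J_points (n' i) (n i)"
  shows "(\<lambda>i. if i < r then mat_mult (n i) (A i) (B i) else (\<lambda>_ _. 0),
      \<lambda>l. w l + (\<Sum>i<r. mat_vec (n i) (A i) (v i) l)) \<in> Jsum_points r n' m"
proof -
  have AA: "(\<Sum>l<m. A i l a * A k l b) = (if i = k \<and> a = b then 1 else 0)"
    if "i < r" "k < r" "a < n i" "b < n k" for i k a b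
    using A that by (simp add: Jsum_points_iff)
  have same: "(\<Sum>l<m. mat_vec (n i) (A i) x l * mat_vec (n i) (A i) y l) = (\<Sum>p<n i. x p * y p)"
    if "i < r" for i x y
    by (rule mat_vec_isometry) (simp add: AA that)
  have diff: "(\<Sum>l<m. mat_vec (n i) (A i) x l * mat_vec (n k) (A k) y l) = 0"
    if "i < r" "k < r" "i \<noteq> k" for i k x y
    by (rule mat_vec_orthogonal) (simp add: inner_mat_vec AA that)
  have orth: "(\<Sum>l<m. mat_vec (n i) (A i) x l * w l) = 0" if "i < r" for i x
    by (rule mat_vec_orthogonal) (use A that in \<open>simp add: Jsum_points_iff\<close>)
  have z: "mat_vec (n i) (A i) x l = 0" if "\<not> l < m" for i x l
    using A that by (simp add: Jsum_points_iff mat_vec_def)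
  show ?thesis
    unfolding Jsum_points_iff
  proof (intro conjI allI impI)
    fix i l a assume n: "\<not> (i < r \<and> l < m \<and> a < n' i)"
    show "(if i < r then mat_mult (n i) (A i) (B i) else (\<lambda>_ _. 0)) l a = 0"
    proof (cases "i < r \<and> l < m")
      case True
      then have "B i p a = 0" for p using n f[of i] by (simp add: J_points_iff)
      then show ?thesis by (simp add: mat_mult_def)
    qed (auto simp: mat_mult_column z)
  next
    fix l assume "\<not> l < m" then show "w l + (\<Sum>i<r. mat_vec (n i) (A i) (v i) l) = 0"
      using z A by (simp add: Jsum_points_iff)
  next
    fix i k a b assume i: "i < r" "k < r" "a < n' i" "b < n' k"
    then show "(\<Sum>l<m. (if i < r then mat_mult (n i) (A i) (B i) else (\<lambda>_ _. 0)) l a *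
        (if k < r then mat_mult (n k) (A k) (B k) else (\<lambda>_ _. 0)) l b) = (if i = k \<and> a = b then 1 else 0)"
      using f[of i] by (cases "i = k") (simp_all add: mat_mult_column same diff J_points_iff)
  next
    fix i a assume i: "i < r" "a < n' i"
    have "(\<Sum>l<m. mat_vec (n i) (A i) (\<lambda>p. B i p a) l * (\<Sum>k<r. mat_vec (n k) (A k) (v k) l)) =
        (\<Sum>k<r. \<Sum>l<m. mat_vec (n i) (A i) (\<lambda>p. B i p a) l * mat_vec (n k) (A k) (v k) l)"
      by (simp add: sum_distrib_left sum.swap[of _ "{..<m}"])
    also have "\<dots> = 0"
    proof (rule sum.neutral, rule ballI)
      fix k assume "k \<in> {..<r}"
      then show "(\<Sum>l<m. mat_vec (n i) (A i) (\<lambda>p. B i p a) l * mat_vec (n k) (A k) (v k) l) = 0"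
        using i f[of i] by (cases "i = k") (simp_all add: same diff J_points_iff)
    qed
    finally show "(\<Sum>l<m. (if i < r then mat_mult (n i) (A i) (B i) else (\<lambda>_ _. 0)) l a *
        (w l + (\<Sum>i<r. mat_vec (n i) (A i) (v i) l))) = 0"
      using i by (simp add: mat_mult_column distrib_left sum.distrib orth)
  qed
qed

lemma Jsum_pre_in:
  assumes F: "F \<in> topspace (Jsum r n m)" and f: "\<And>i. i < r \<Longrightarrow> f i \<in> topspace (J (n' i) (n i))"
  shows "Jsum_pre r n F f \<in> topspace (Jsum r n' m)"
proof (cases "F = None \<or> (\<exists>i<r. f i = None)")
  case True
  then show ?thesis by (auto simp: Jsum_pre_def topspace_Jsum split: option.splits)
next
  case False
  then obtain A w where F': "F = Some (A, w)" "(A, w) \<in> Jsum_points r n m"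
    using F by (auto simp: topspace_Jsum)
  have "(fst (the (f i)), snd (the (f i))) \<in> J_points (n' i) (n i)" if "i < r" for i
    using f[OF that] False that by (auto simp: topspace_J)
  from Jsum_pre_points[OF F'(2) this] show ?thesis
    using False by (simp add: Jsum_pre_def F' topspace_Jsum)
qed

lemma open_map_map_prod:
  assumes "open_map X X' f" "open_map Y Y' g"
  shows "open_map (prod_topology X Y) (prod_topology X' Y') (map_prod f g)"
  unfolding open_map_def
proof (intro allI impI)
  fix U assume U: "openin (prod_topology X Y) U"
  show "openin (prod_topology X' Y') (map_prod f g ` U)"
    unfolding openin_prod_topology_alt
  proof (intro allI impI)
    fix x' y' assume "(x', y') \<in> map_prod f g ` U"
    then obtain x y where xy: "(x, y) \<in> U" "x' = f x" "y' = g y" by auto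
    obtain A B where "openin X A" "openin Y B" "x \<in> A" "y \<in> B" "A \<times> B \<subseteq> U"
      using U xy(1) by (blast dest: openin_prod_topology_alt[THEN iffD1, rule_format])
    moreover from this have "f ` A \<times> g ` B \<subseteq> map_prod f g ` U" by force
    ultimately have "openin X' (f ` A) \<and> openin Y' (g ` B) \<and> x' \<in> f ` A \<and> y' \<in> g ` B \<and>
        f ` A \<times> g ` B \<subseteq> map_prod f g ` U"
      using assms xy unfolding open_map_def by blast
    then show "\<exists>A B. openin X' A \<and> openin Y' B \<and> x' \<in> A \<and> y' \<in> B \<and> A \<times> B \<subseteq> map_prod f g ` U"
      by blast
  qed
qed

text \<open>If \<open>N \<circ> f\<close> dominates a function with compact sublevel sets, then \<open>f\<close> is proper, because \<open>N\<close> is bounded on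
  compact sets.\<close>

lemma compactin_preimage_norm:
  fixes S :: "'a::metric_space set" and R :: "'b::metric_space set"
  assumes N: "continuous_on R N" and compact: "\<And>c. compact {z \<in> S. M z \<le> (c::real)}"
    and f: "continuous_on S f" "f ` S \<subseteq> R" and le: "\<And>z. z \<in> S \<Longrightarrow> M z \<le> N (f z)"
    and C: "compactin (top_of_set R) C" "closedin (top_of_set R) C"
  shows "compactin (top_of_set S) {z \<in> topspace (top_of_set S). f z \<in> C}"
proof -
  have C': "compact C" "C \<subseteq> R" using C(1) by (auto simp: compactin_subtopology)
  have "compact (N ` C)" using C' N by (meson compact_continuous_image continuous_on_subset)
  then have "bdd_above (N ` C)" by (intro bounded_imp_bdd_above compact_imp_bounded)
  then obtain c where c: "\<And>y. y \<in> C \<Longrightarrow> N y \<le> c" unfolding bdd_above_def by blast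
  have "continuous_map (top_of_set S) (top_of_set R) f"
    using f by (auto simp: continuous_map_in_subtopology)
  from closedin_continuous_map_preimage[OF this C(2)]
  have "closedin (top_of_set S) {z \<in> S. f z \<in> C}" by simp
  moreover have "compactin (top_of_set S) {z \<in> S. M z \<le> c}"
    using compact by (auto simp: compactin_subtopology)
  ultimately have "compactin (top_of_set S) ({z \<in> S. M z \<le> c} \<inter> {z \<in> S. f z \<in> C})"
    by (intro compact_Int_closedin)
  moreover have "{z \<in> S. M z \<le> c} \<inter> {z \<in> S. f z \<in> C} = {z \<in> S. f z \<in> C}"
    using le c by fastforce
  ultimately show ?thesis by simp
qed

lemma continuous_map_Jsum_post:
  "continuous_map (prod_topology (J m m') (Jsum r n m)) (Jsum r n m') (\<lambda>(g, F). Jsum_post m g F)"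
proof -
  let ?P = "J_points m m'" and ?Q = "Jsum_points r n m" and ?R = "Jsum_points r n m'"
  let ?f = "\<lambda>z :: (mat \<times> vec) \<times> (nat \<Rightarrow> mat) \<times> vec.
    (\<lambda>i. mat_mult m (fst (fst z)) (fst (snd z) i),
     \<lambda>l. snd (fst z) l + mat_vec m (fst (fst z)) (snd (snd z)) l)"
  \<comment> \<open>\<open>?M\<close> is the squared length \<open>|v|\<^sup>2 + |w|\<^sup>2\<close>, which composition turns into that of \<open>v + B w\<close>.\<close>
  let ?M = "\<lambda>z :: (mat \<times> vec) \<times> (nat \<Rightarrow> mat) \<times> vec.
    (\<Sum>l<m'. (snd (fst z) l)\<^sup>2) + (\<Sum>l<m. (snd (snd z) l)\<^sup>2)"
  have 1: "continuous_on S (\<lambda>z :: (mat \<times> vec) \<times> (nat \<Rightarrow> mat) \<times> vec. fst (fst z) l k)" for S l k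
    by (intro continuous_on_product_then_coordinatewise[where f = "\<lambda>z. fst (fst z) _"]
        continuous_on_product_then_coordinatewise[where f = "\<lambda>z. fst (fst z)"]
        continuous_on_fst continuous_on_id)
  have 2: "continuous_on S (\<lambda>z :: (mat \<times> vec) \<times> (nat \<Rightarrow> mat) \<times> vec. snd (fst z) l)" for S l
    by (intro continuous_on_product_then_coordinatewise[where f = "\<lambda>z. snd (fst z)"]
        continuous_on_fst continuous_on_snd continuous_on_id)
  have 3: "continuous_on S (\<lambda>z :: (mat \<times> vec) \<times> (nat \<Rightarrow> mat) \<times> vec. fst (snd z) i l k)" for S i l k
    by (intro continuous_on_product_then_coordinatewise[where f = "\<lambda>z. fst (snd z) _ _"]
        continuous_on_product_then_coordinatewise[where f = "\<lambda>z. fst (snd z) _"]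
        continuous_on_product_then_coordinatewise[where f = "\<lambda>z. fst (snd z)"]
        continuous_on_fst continuous_on_snd continuous_on_id)
  have 4: "continuous_on S (\<lambda>z :: (mat \<times> vec) \<times> (nat \<Rightarrow> mat) \<times> vec. snd (snd z) l)" for S l
    by (intro continuous_on_product_then_coordinatewise[where f = "\<lambda>z. snd (snd z)"]
        continuous_on_snd continuous_on_id)
  have f: "continuous_on S ?f" for S
    unfolding mat_mult_def mat_vec_def
    by (intro continuous_on_Pair continuous_on_coordinatewise_then_product continuous_on_sum
        continuous_on_add continuous_on_mult 1 2 3 4)
  have fR: "?f ` (?P \<times> ?Q) \<subseteq> ?R"
    using Jsum_post_points(1) by auto
  have cont: "continuous_map (prod_topology (top_of_set ?P) (top_of_set ?Q)) (top_of_set ?R) ?f"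
    using f fR by (auto simp: continuous_map_in_subtopology)
  have sub: "compact {z \<in> ?P \<times> ?Q. ?M z \<le> c}" for c
  proof -
    have "compact ({z \<in> ?P. (\<Sum>l<m'. (snd z l)\<^sup>2) \<le> c} \<times> {z \<in> ?Q. (\<Sum>l<m. (snd z l)\<^sup>2) \<le> c})"
      by (intro compact_Times compact_J_sublevel compact_Jsum_sublevel)
    moreover have "closed {z. ?M z \<le> c}"
      by (intro closed_Collect_le continuous_on_add continuous_on_sum continuous_on_power
          continuous_on_const 2 4)
    moreover have "{z \<in> ?P \<times> ?Q. ?M z \<le> c} =
      ({z \<in> ?P. (\<Sum>l<m'. (snd z l)\<^sup>2) \<le> c} \<times> {z \<in> ?Q. (\<Sum>l<m. (snd z l)\<^sup>2) \<le> c}) \<inter> {z. ?M z \<le> c}"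
    proof -
      have pos: "(\<Sum>l<k. (x l)\<^sup>2) \<ge> 0" for x :: vec and k
        by (simp add: sum_nonneg)
      have "(\<Sum>l<m'. (snd x l)\<^sup>2) \<le> c \<and> (\<Sum>l<m. (snd y l)\<^sup>2) \<le> c" if "?M (x, y) \<le> c"
        for x :: "mat \<times> vec" and y :: "(nat \<Rightarrow> mat) \<times> vec"
        using that pos[where x = "snd x" and k = m'] pos[where x = "snd y" and k = m] unfolding fst_conv snd_conv by linarith
      then show ?thesis by (intro equalityI subsetI) (auto simp: mem_Times_iff)
    qed
    ultimately show ?thesis by (simp only: compact_Int_closed)
  qed
  have proper: "compactin (prod_topology (top_of_set ?P) (top_of_set ?Q))
      {z \<in> topspace (prod_topology (top_of_set ?P) (top_of_set ?Q)). ?f z \<in> C}"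
    if C: "compactin (top_of_set ?R) C" "closedin (top_of_set ?R) C" for C
    unfolding prod_topology_subtopology_eu
    by (rule compactin_preimage_norm[OF continuous_on_sqnorm[where m = m'] sub f fR _ C])
      (use Jsum_post_points(2) in auto)
  have e: "open_map (prod_topology (top_of_set ?P) (top_of_set ?Q)) (prod_topology (J m m') (Jsum r n m)) (map_prod Some Some)"
    unfolding J_def Jsum_def by (intro open_map_map_prod open_map_Some)
  have e': "continuous_map (prod_topology (top_of_set ?P) (top_of_set ?Q)) (prod_topology (J m m') (Jsum r n m)) (map_prod Some Some)"
    unfolding J_def Jsum_def map_prod_def case_prod_unfold
    by (intro continuous_map_pairedI continuous_map_compose[OF continuous_map_fst continuous_map_Some, unfolded o_def]
        continuous_map_compose[OF continuous_map_snd continuous_map_Some, unfolded o_def])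
  show ?thesis
    unfolding Jsum_def[of r n m']
    by (rule continuous_map_Alexandroff_extension[OF _ e e' cont proper])
      (auto simp: Hausdorff_space_prod_topology Hausdorff_space_J Hausdorff_space_Jsum
        Jsum_post_def topspace_J topspace_Jsum split: option.split)
qed

text \<open>Here \<open>q\<close> is the inverse of the permutation that moves the summands: the summand \<open>j\<close> of the result is the
  summand \<open>q j\<close> of the argument.\<close>

definition Jsum_perm :: "nat \<Rightarrow> (nat \<Rightarrow> nat) \<Rightarrow> jsum \<Rightarrow> jsum" where
  "Jsum_perm r q = map_option (\<lambda>(A, w). (\<lambda>j. if j < r then A (q j) else (\<lambda>_ _. 0), w))"

lemma Jsum_perm_points:
  assumes q: "inj_on q {..<r}" "q ` {..<r} \<subseteq> {..<r}" and A: "(A, w) \<in> Jsum_points r n m"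
    and n': "\<And>j. j < r \<Longrightarrow> n' j = n (q j)"
  shows "(\<lambda>j. if j < r then A (q j) else (\<lambda>_ _. 0), w) \<in> Jsum_points r n' m"
proof -
  have qr: "q j < r" if "j < r" for j using q(2) that by auto
  have qi: "q j = q k \<longleftrightarrow> j = k" if "j < r" "k < r" for j k using q(1) that by (auto dest: inj_onD)
  show ?thesis
    using A unfolding Jsum_points_iff by (auto simp: qr qi n')
qed

lemma continuous_map_Jsum_perm:
  assumes q: "inj_on q {..<r}" "q ` {..<r} \<subseteq> {..<r}" and n': "\<And>j. j < r \<Longrightarrow> n' j = n (q j)"
  shows "continuous_map (Jsum r n m) (Jsum r n' m) (Jsum_perm r q)"
proof -
  let ?f = "\<lambda>z :: (nat \<Rightarrow> mat) \<times> vec. (\<lambda>j. if j < r then fst z (q j) else (\<lambda>_ _. 0), snd z)"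
  let ?S = "Jsum_points r n m" and ?R = "Jsum_points r n' m"
  have 1: "continuous_on S (\<lambda>z :: (nat \<Rightarrow> mat) \<times> vec. if j < r then fst z (q j) else (\<lambda>_ _. 0))" for S j
    by (cases "j < r") (simp_all add: continuous_on_product_then_coordinatewise[where f = fst]
        continuous_on_fst)
  have f: "continuous_on S ?f" for S
    by (intro continuous_on_Pair continuous_on_coordinatewise_then_product 1 continuous_on_snd continuous_on_id)
  have fR: "?f ` ?S \<subseteq> ?R" using Jsum_perm_points[OF q] n' by auto
  have cont: "continuous_map (top_of_set ?S) (top_of_set ?R) ?f"
    using f fR by (auto simp: continuous_map_in_subtopology)
  have proper: "compactin (top_of_set ?S) {z \<in> topspace (top_of_set ?S). ?f z \<in> C}"
    if C: "compactin (top_of_set ?R) C" "closedin (top_of_set ?R) C" for C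
    by (rule compactin_preimage_norm[OF continuous_on_sqnorm compact_Jsum_sublevel f fR _ C]) auto
  show ?thesis
    unfolding Jsum_def
    by (rule continuous_map_Alexandroff_extension[OF _ open_map_Some continuous_map_Some cont proper])
      (auto simp: Hausdorff_space_Jsum[unfolded Jsum_def] Jsum_perm_def case_prod_unfold)
qed

lemma Jsum_perm_in:
  assumes q: "inj_on q {..<r}" "q ` {..<r} \<subseteq> {..<r}" and F: "F \<in> topspace (Jsum r n m)"
    and n': "\<And>j. j < r \<Longrightarrow> n' j = n (q j)"
  shows "Jsum_perm r q F \<in> topspace (Jsum r n' m)"
  using continuous_map_Jsum_perm[where m = m and n = n and n' = n', OF q] n' F
  by (auto simp: continuous_map_def Pi_iff)

lemma Jsum_post_in:
  assumes "g \<in> topspace (J m m')" "F \<in> topspace (Jsum r n m)"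
  shows "Jsum_post m g F \<in> topspace (Jsum r n m')"
  using continuous_map_Jsum_post[of m m' r n] assms by (fastforce simp: continuous_map_def Pi_iff)

lemma Jsum_post_pre: "Jsum_post m g (Jsum_pre r n F f) = Jsum_pre r n (Jsum_post m g F) f"
proof (cases "g = None \<or> F = None \<or> (\<exists>i<r. f i = None)")
  case True
  have "Jsum_pre r n F f = None" if "\<exists>i<r. f i = None" for F
    using that by (cases F) (auto simp: Jsum_pre_def)
  with True show ?thesis by (auto simp: Jsum_pre_def Jsum_post_def split: option.split)
next
  case False
  then obtain B v A w where [simp]: "g = Some (B, v)" "F = Some (A, w)" by auto
  have "\<not> (\<exists>i<r. f i = None)" using False by blast
  then show ?thesis
    by (auto simp: Jsum_post_def Jsum_pre_def mat_mult_assoc mat_vec_add mat_vec_sum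
        mat_vec_mat_mult fun_eq_iff) (simp add: mat_mult_def)
qed

lemma Jsum_post_comp: "Jsum_post m (J_comp k g f) F = Jsum_post k g (Jsum_post m f F)"
  by (cases g; cases f; cases F)
    (auto simp: Jsum_post_def J_comp_def mat_mult_assoc mat_vec_add mat_vec_mat_mult add.assoc)

lemma Jsum_post_id:
  assumes "F \<in> topspace (Jsum r n m)"
  shows "Jsum_post m (J_id m) F = F"
proof -
  have *: "mat_vec m (\<lambda>l a. if l = a \<and> a < m then 1 else 0) x l = x l" if "\<not> l < m \<Longrightarrow> x l = 0" for x :: vec and l
  proof -
    have "mat_vec m (\<lambda>l a. if l = a \<and> a < m then 1 else 0) x l = (\<Sum>a<m. x a * (if l = a then 1 else 0))"
      unfolding mat_vec_def by (rule sum.cong) auto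
    then show ?thesis using that by (auto simp: sum_Kronecker)
  qed
  show ?thesis
    using assms
    by (auto simp: topspace_Jsum Jsum_post_def J_id_def mat_mult_column Jsum_points_iff * fun_eq_iff)
qed

lemma Jsum_post_None [simp]: "Jsum_post m None F = None" "Jsum_post m g None = None"
  by (auto simp: Jsum_post_def split: option.splits)

lemma Jsum_perm_pre:
  assumes q: "bij_betw q {..<r} {..<r}"
  shows "Jsum_perm r q (Jsum_pre r n F f) =
    Jsum_pre r (\<lambda>j\<in>{..<r}. n (q j)) (Jsum_perm r q F) (\<lambda>j. f (q j))"
proof (cases F)
  case None
  then show ?thesis by (simp add: Jsum_pre_def Jsum_perm_def)
next
  case (Some z)
  obtain A w where z: "z = (A, w)" by (cases z)
  have qr: "q j < r" if "j < r" for j using q that by (auto simp: bij_betw_def)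
  have ex: "(\<exists>i<r. f i = None) \<longleftrightarrow> (\<exists>j<r. f (q j) = None)"
    using q by (metis bij_betw_iff_bijections lessThan_iff)
  have s: "(\<Sum>j<r. mat_vec (n (q j)) (A (q j)) (snd (the (f (q j)))) l) =
      (\<Sum>i<r. mat_vec (n i) (A i) (snd (the (f i))) l)" for l
    by (rule sum.reindex_bij_betw[OF q])
  have s': "(\<Sum>j<r. mat_vec ((\<lambda>j\<in>{..<r}. n (q j)) j) (if j < r then A (q j) else (\<lambda>_ _. 0)) (snd (the (f (q j)))) l) =
      (\<Sum>i<r. mat_vec (n i) (A i) (snd (the (f i))) l)" for l
    unfolding s[symmetric] by (rule sum.cong) auto
  show ?thesis
  proof (cases "\<exists>i<r. f i = None")
    case True
    then have "\<exists>j<r. f (q j) = None" using ex by simp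
    then show ?thesis using True unfolding Some z by (simp add: Jsum_pre_def Jsum_perm_def)
  next
    case False
    then have "\<not> (\<exists>j<r. f (q j) = None)" using ex by simp
    then show ?thesis
      unfolding Some z Jsum_pre_def Jsum_perm_def option.map option.case prod.case if_not_P[OF False]
      by (simp add: s' del: restrict_apply) (auto simp: fun_eq_iff qr s)
  qed
qed

lemma Jsum_perm_post: "Jsum_perm r q (Jsum_post m g F) = Jsum_post m g (Jsum_perm r q F)"
  by (cases g; cases F) (auto simp: Jsum_perm_def Jsum_post_def fun_eq_iff mat_mult_def)

text \<open>Embeddings of a single summand, so that statements about \<^const>\<open>Jsum_points\<close> specialise to
  \<^const>\<open>J_points\<close>.\<close>

lemma J_points_Jsum_points:
  "(A, w) \<in> J_points n m \<longleftrightarrow> (\<lambda>i. if i = 0 then A else (\<lambda>_ _. 0), w) \<in> Jsum_points (Suc 0) (\<lambda>_. n) m"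
  by (auto simp: J_points_iff Jsum_points_iff)

lemma J_comp_in:
  assumes "f \<in> topspace (J n m)" "g \<in> topspace (J m p)"
  shows "J_comp m g f \<in> topspace (J n p)"
proof (cases "f = None \<or> g = None")
  case True
  then show ?thesis by (auto simp: J_comp_def topspace_J split: option.split)
next
  case False
  then obtain A w B v where fg: "f = Some (A, w)" "(A, w) \<in> J_points n m"
    "g = Some (B, v)" "(B, v) \<in> J_points m p"
    using assms by (auto simp: topspace_J)
  have "(\<lambda>i. mat_mult m B (if i = 0 then A else (\<lambda>_ _. 0)), \<lambda>l. v l + mat_vec m B w l)
      \<in> Jsum_points (Suc 0) (\<lambda>_. n) p"
    using Jsum_post_points(1)[OF fg(4) fg(2)[unfolded J_points_Jsum_points]] .
  moreover have "(\<lambda>i. mat_mult m B (if i = 0 then A else (\<lambda>_ _. 0))) =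
      (\<lambda>i :: nat. if i = 0 then mat_mult m B A else (\<lambda>_ _. 0))"
    by (intro ext) (simp add: mat_mult_def)
  ultimately have "(mat_mult m B A, \<lambda>l. v l + mat_vec m B w l) \<in> J_points n p"
    by (simp only: J_points_Jsum_points)
  then show ?thesis by (simp add: fg J_comp_def topspace_J)
qed

lemma J_id_in: "J_id n \<in> topspace (J n n)"
proof -
  have "(\<Sum>l<n. (if l = a \<and> a < n then 1 else 0) * (if l = b \<and> b < n then 1 else 0)) =
      (if a = b then 1 else (0 :: real))" if "a < n" "b < n" for a b
  proof -
    have "(\<Sum>l<n. (if l = a \<and> a < n then 1 else 0) * (if l = b \<and> b < n then 1 else 0)) =
        (\<Sum>l<n. if l = a then (if a = b then 1 else 0) else (0 :: real))"
      by (rule sum.cong) (use that in auto)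
    then show ?thesis using that by simp
  qed
  then show ?thesis by (simp add: topspace_J J_id_def J_points_iff)
qed

section \<open>Smash products are orthogonal spectra\<close>

lemma
  assumes "orthogonal_spectrum X"
  shows orthogonal_spectrum_weak_hausdorff: "weak_hausdorff (Sp X n)"
    and orthogonal_spectrum_bpt: "bpt X n \<in> topspace (Sp X n)"
    and orthogonal_spectrum_act_in:
      "f \<in> topspace (J n m) \<Longrightarrow> x \<in> topspace (Sp X n) \<Longrightarrow> act X n m f x \<in> topspace (Sp X m)"
proof -
  show "weak_hausdorff (Sp X n)" "bpt X n \<in> topspace (Sp X n)"
    using assms by (simp_all add: orthogonal_spectrum_def cgwh_def)
  have "continuous_map (kify (prod_topology (J n m) (Sp X n))) (Sp X m) (\<lambda>(f, x). act X n m f x)"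
    using assms by (simp add: orthogonal_spectrum_def)
  then show "f \<in> topspace (J n m) \<Longrightarrow> x \<in> topspace (Sp X n) \<Longrightarrow> act X n m f x \<in> topspace (Sp X m)"
    by (fastforce simp: continuous_map_def Pi_iff)
qed

lemma topspace_presmash:
  "(n, F, x) \<in> topspace (presmash r X m) \<longleftrightarrow>
     n \<in> {..<r} \<rightarrow>\<^sub>E UNIV \<and> F \<in> topspace (Jsum r n m) \<and> x \<in> (\<Pi>\<^sub>E i\<in>{..<r}. topspace (Sp (X i) (n i)))"
  by (auto simp: presmash_def)

definition smash_generators :: "nat \<Rightarrow> (nat \<Rightarrow> 'a spectrum) \<Rightarrow> nat \<Rightarrow> 'a presmash rel" where
  "smash_generators r X m = coend_rel r X m \<union> smash_base r X m \<times> smash_base r X m"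

lemma smash_rel_generators: "smash_rel r X m = wh_equiv (presmash r X m) (smash_generators r X m)"
  by (simp add: smash_rel_def smash_generators_def)

lemma smash_base_iff:
  "(n, F, x) \<in> smash_base r X m \<longleftrightarrow>
     (n, F, x) \<in> topspace (presmash r X m) \<and> (F = None \<or> (\<exists>i<r. x i = bpt (X i) (n i)))"
  by (auto simp: smash_base_def)

text \<open>A relation that is not contained in the square of the space has no equivalence relation above it, and
  \<^const>\<open>wh_equiv\<close> would be an intersection over the empty family. So the facts on \<^const>\<open>smash_rel\<close> rest on
  this inclusion.\<close>

lemma smash_generators_subset:
  assumes X: "\<forall>i<r. orthogonal_spectrum (X i)"
  shows "smash_generators r X m \<subseteq> topspace (presmash r X m) \<times> topspace (presmash r X m)"
proof -
  have "smash_base r X m \<subseteq> topspace (presmash r X m)" by (auto simp: smash_base_def)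
  moreover have "coend_rel r X m \<subseteq> topspace (presmash r X m) \<times> topspace (presmash r X m)"
    unfolding coend_rel_def
  proof clarsimp
    fix n' n F f x
    assume *: "n' \<in> {..<r} \<rightarrow>\<^sub>E (UNIV :: nat set)" "n \<in> {..<r} \<rightarrow>\<^sub>E (UNIV :: nat set)"
      "F \<in> topspace (Jsum r n m)" "\<forall>i<r. f i \<in> topspace (J (n' i) (n i))"
      "x \<in> (\<Pi>\<^sub>E i\<in>{..<r}. topspace (Sp (X i) (n' i)))"
    then have "Jsum_pre r n F f \<in> topspace (Jsum r n' m)" by (intro Jsum_pre_in) auto
    moreover have "act (X i) (n' i) (n i) (f i) (x i) \<in> topspace (Sp (X i) (n i))" if "i < r" for i
      by (rule orthogonal_spectrum_act_in[OF X[rule_format, OF that]]) (use * that in auto)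
    ultimately show "(n', Jsum_pre r n F f, x) \<in> topspace (presmash r X m) \<and>
       (n, F, \<lambda>i\<in>{..<r}. act (X i) (n' i) (n i) (f i) (x i)) \<in> topspace (presmash r X m)"
      unfolding topspace_presmash using * by auto
  qed
  ultimately show ?thesis unfolding smash_generators_def by blast
qed

lemma
  assumes X: "\<forall>i<r. orthogonal_spectrum (X i)"
  shows equiv_smash_rel: "equiv (topspace (presmash r X m)) (smash_rel r X m)"
    and smash_rel_superset: "smash_generators r X m \<subseteq> smash_rel r X m"
    and weak_hausdorff_smash: "weak_hausdorff (quot_topology (presmash r X m) (smash_rel r X m))"
  unfolding smash_rel_generators
  by (rule equiv_wh_equiv[OF smash_generators_subset[OF X]]
      wh_equiv_superset[OF smash_generators_subset[OF X]]
      weak_hausdorff_wh_equiv[OF smash_generators_subset[OF X]])+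

text \<open>The common form of the action of \<open>J\<close>, with \<open>L\<close> the space of operators, and of the maps induced by a
  permutation. The source is a disjoint union of k-ifications; on \<open>L \<times> C\<close> with \<open>C\<close> compact Hausdorff the
  map has a Hausdorff image, so it is continuous into the k-ification of the target.\<close>

lemma continuous_map_prod_presmash:
  assumes L: "compact_space L" "Hausdorff_space L"
    and Y: "\<forall>i<r. orthogonal_spectrum (Y i)"
    and \<nu>: "\<And>n. n \<in> {..<r} \<rightarrow>\<^sub>E UNIV \<Longrightarrow> \<nu> n \<in> {..<r} \<rightarrow>\<^sub>E UNIV"
    and a: "\<And>n. n \<in> {..<r} \<rightarrow>\<^sub>E UNIV \<Longrightarrow> continuous_map (prod_topology L (Jsum r n m)) (Jsum r (\<nu> n) m') (\<lambda>(g, F). a n g F)"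
    and \<xi>: "\<And>n. n \<in> {..<r} \<rightarrow>\<^sub>E UNIV \<Longrightarrow> continuous_map (product_topology (\<lambda>i. Sp (X i) (n i)) {..<r})
               (product_topology (\<lambda>i. Sp (Y i) (\<nu> n i)) {..<r}) (\<xi> n)"
  shows "continuous_map (prod_topology L (presmash r X m)) (presmash r Y m')
    (\<lambda>(g, n, F, x). (\<nu> n, a n g F, \<xi> n x))"
  unfolding presmash_def[of r X]
proof (rule continuous_map_prod_sum_topology)
  fix n assume n: "n \<in> {..<r} \<rightarrow>\<^sub>E (UNIV :: nat set)"
  let ?Q = "prod_topology (Jsum r n m) (product_topology (\<lambda>i. Sp (X i) (n i)) {..<r})"
  let ?Q' = "prod_topology (Jsum r (\<nu> n) m') (product_topology (\<lambda>i. Sp (Y i) (\<nu> n i)) {..<r})"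
  let ?u = "\<lambda>(g, F, x). (a n g F, \<xi> n x)"
  have "continuous_map (prod_topology L (kify ?Q)) (kify ?Q') ?u"
  proof (rule continuous_map_prod_kify[OF L])
    fix C assume C: "C \<in> compact_Hausdorff_subsets ?Q"
    let ?K = "prod_topology L (subtopology ?Q C)"
    have K: "compact_space ?K" "Hausdorff_space ?K"
      using L C by (simp_all add: compact_Hausdorff_subsets_def compact_space_prod_topology Hausdorff_space_prod_topology)
    have g: "continuous_map ?K L fst" by (rule continuous_map_fst)
    have z: "continuous_map ?K ?Q snd"
      using continuous_map_snd[of L "subtopology ?Q C"] by (simp add: continuous_map_in_subtopology)
    have F: "continuous_map ?K (Jsum r n m) (\<lambda>k. fst (snd k))"
      and x: "continuous_map ?K (product_topology (\<lambda>i. Sp (X i) (n i)) {..<r}) (\<lambda>k. snd (snd k))"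
      using z by (simp_all add: continuous_map_pairwise o_def)
    have "continuous_map ?K (Jsum r (\<nu> n) m') (\<lambda>k. a n (fst k) (fst (snd k)))"
      using continuous_map_compose[OF continuous_map_pairedI[OF g F] a[OF n]] by (simp add: o_def)
    moreover have "continuous_map ?K (product_topology (\<lambda>i. Sp (Y i) (\<nu> n i)) {..<r}) (\<lambda>k. \<xi> n (snd (snd k)))"
      using continuous_map_compose[OF x \<xi>[OF n]] by (simp add: o_def)
    ultimately have u: "continuous_map ?K ?Q' ?u"
      by (simp add: continuous_map_pairedI case_prod_unfold)
    show "continuous_map ?K (kify ?Q') ?u"
      by (rule continuous_map_into_kify[OF K(1) u], rule Hausdorff_compact_image_prod_product[OF _ _ K u])
        (use Y in \<open>simp_all add: Hausdorff_space_Jsum orthogonal_spectrum_weak_hausdorff\<close>)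
  qed
  moreover have "continuous_map (kify ?Q') (presmash r Y m') (Pair (\<nu> n))"
    unfolding presmash_def by (rule continuous_map_component_injection[OF \<nu>[OF n]])
  ultimately have "continuous_map (prod_topology L (kify ?Q)) (presmash r Y m') (Pair (\<nu> n) \<circ> ?u)"
    by (rule continuous_map_compose)
  then show "continuous_map (prod_topology L (kify ?Q)) (presmash r Y m')
      (\<lambda>(g, y). case (g, n, y) of (g, n, F, x) \<Rightarrow> (\<nu> n, a n g F, \<xi> n x))"
    by (simp add: o_def case_prod_unfold)
qed

lemma continuous_map_presmash:
  assumes Y: "\<forall>i<r. orthogonal_spectrum (Y i)"
    and \<nu>: "\<And>n. n \<in> {..<r} \<rightarrow>\<^sub>E UNIV \<Longrightarrow> \<nu> n \<in> {..<r} \<rightarrow>\<^sub>E UNIV"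
    and a: "\<And>n. n \<in> {..<r} \<rightarrow>\<^sub>E UNIV \<Longrightarrow> continuous_map (Jsum r n m) (Jsum r (\<nu> n) m') (a n)"
    and \<xi>: "\<And>n. n \<in> {..<r} \<rightarrow>\<^sub>E UNIV \<Longrightarrow> continuous_map (product_topology (\<lambda>i. Sp (X i) (n i)) {..<r})
               (product_topology (\<lambda>i. Sp (Y i) (\<nu> n i)) {..<r}) (\<xi> n)"
  shows "continuous_map (presmash r X m) (presmash r Y m') (\<lambda>(n, F, x). (\<nu> n, a n F, \<xi> n x))"
proof -
  \<comment> \<open>A map without a parameter is one whose parameter ranges over a single point.\<close>
  let ?L = "discrete_topology {()}"
  have L: "compact_space ?L" "Hausdorff_space ?L" by (simp_all add: compact_space_discrete_topology)
  have a': "continuous_map (prod_topology ?L (Jsum r n m)) (Jsum r (\<nu> n) m') (\<lambda>(g, F). a n F)"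
    if "n \<in> {..<r} \<rightarrow>\<^sub>E UNIV" for n
    using continuous_map_compose[OF continuous_map_snd a[OF that]] by (simp add: o_def case_prod_unfold)
  have "continuous_map (presmash r X m) (prod_topology ?L (presmash r X m)) (\<lambda>z. ((), z))"
    by (intro continuous_map_pairedI) auto
  from continuous_map_compose[OF this continuous_map_prod_presmash[where a = "\<lambda>n _. a n", OF L Y \<nu> a' \<xi>]]
  show ?thesis by (simp add: o_def)
qed

text \<open>A continuous map of representatives descends to the smash products if it preserves the coend relation
  and the set that is collapsed to the base point.\<close>

lemma smash_rel_map:
  assumes X: "\<forall>i<r. orthogonal_spectrum (X i)" and Y: "\<forall>i<r. orthogonal_spectrum (Y i)"
    and \<phi>: "continuous_map (presmash r X m) (presmash r Y m') \<phi>"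
    and coend: "\<And>a b. (a, b) \<in> coend_rel r X m \<Longrightarrow> (\<phi> a, \<phi> b) \<in> coend_rel r Y m'"
    and base: "\<And>a. a \<in> smash_base r X m \<Longrightarrow> \<phi> a \<in> smash_base r Y m'"
  shows "(a, b) \<in> smash_rel r X m \<Longrightarrow> (\<phi> a, \<phi> b) \<in> smash_rel r Y m'"
  unfolding smash_rel_generators
proof (rule wh_equiv_map[OF smash_generators_subset[OF X] smash_generators_subset[OF Y] \<phi>])
  fix a b assume "(a, b) \<in> smash_generators r X m"
  then have "(\<phi> a, \<phi> b) \<in> smash_generators r Y m'"
    using coend base unfolding smash_generators_def by blast
  then have "(\<phi> a, \<phi> b) \<in> smash_rel r Y m'" by (rule subsetD[OF smash_rel_superset[OF Y]])
  then show "(\<phi> a, \<phi> b) \<in> wh_equiv (presmash r Y m') (smash_generators r Y m')"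
    unfolding smash_rel_generators .
qed

definition presmash_post :: "nat \<Rightarrow> jmor \<Rightarrow> 'a presmash \<Rightarrow> 'a presmash" where
  "presmash_post m g = (\<lambda>(n, F, x). (n, Jsum_post m g F, x))"

lemma presmash_post_in:
  "g \<in> topspace (J m m') \<Longrightarrow> z \<in> topspace (presmash r X m) \<Longrightarrow>
     presmash_post m g z \<in> topspace (presmash r X m')"
  by (cases z) (simp add: presmash_post_def topspace_presmash Jsum_post_in)

lemma presmash_post_base:
  assumes "g \<in> topspace (J m m')" "z \<in> smash_base r X m"
  shows "presmash_post m g z \<in> smash_base r X m'"
proof -
  obtain n F x where z: "z = (n, F, x)" by (cases z)
  have "(n, Jsum_post m g F, x) \<in> topspace (presmash r X m')"
    using presmash_post_in[OF assms(1), of z r X] assms(2) unfolding z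
    by (simp add: presmash_post_def smash_base_iff)
  then show ?thesis using assms(2) unfolding z by (auto simp: presmash_post_def smash_base_iff)
qed

lemma continuous_map_presmash_post:
  assumes X: "\<forall>i<r. orthogonal_spectrum (X i)"
  shows "continuous_map (prod_topology (J m m') (presmash r X m)) (presmash r X m')
    (\<lambda>(g, z). presmash_post m g z)"
proof -
  have "continuous_map (prod_topology (J m m') (presmash r X m)) (presmash r X m')
     (\<lambda>(g, n, F, x). (n, Jsum_post m g F, x))"
    by (rule continuous_map_prod_presmash[where a = "\<lambda>n. Jsum_post m" and \<xi> = "\<lambda>n x. x" and
        \<nu> = "\<lambda>n. n", OF compact_space_J Hausdorff_space_J X])
      (auto simp: continuous_map_Jsum_post)
  then show ?thesis by (simp add: presmash_post_def case_prod_unfold)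
qed

lemma continuous_map_presmash_post_fixed:
  assumes X: "\<forall>i<r. orthogonal_spectrum (X i)" and g: "g \<in> topspace (J m m')"
  shows "continuous_map (presmash r X m) (presmash r X m') (presmash_post m g)"
proof -
  have "continuous_map (presmash r X m) (prod_topology (J m m') (presmash r X m)) (\<lambda>z. (g, z))"
    using g by (intro continuous_map_pairedI) auto
  from continuous_map_compose[OF this continuous_map_presmash_post[OF X]]
  show ?thesis by (simp add: o_def)
qed

lemma smash_rel_post:
  assumes X: "\<forall>i<r. orthogonal_spectrum (X i)" and g: "g \<in> topspace (J m m')"
    and ab: "(a, b) \<in> smash_rel r X m"
  shows "(presmash_post m g a, presmash_post m g b) \<in> smash_rel r X m'"
proof (rule smash_rel_map[OF X X continuous_map_presmash_post_fixed[OF X g] _ presmash_post_base[OF g] ab])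
  fix a b assume "(a, b) \<in> coend_rel r X m"
  then show "(presmash_post m g a, presmash_post m g b) \<in> coend_rel r X m'"
    unfolding coend_rel_def
  proof clarsimp
    fix n' n F f x
    assume *: "n' \<in> {..<r} \<rightarrow>\<^sub>E (UNIV :: nat set)" "n \<in> {..<r} \<rightarrow>\<^sub>E (UNIV :: nat set)"
      "F \<in> topspace (Jsum r n m)" "\<forall>i<r. f i \<in> topspace (J (n' i) (n i))"
      "x \<in> (\<Pi>\<^sub>E i\<in>{..<r}. topspace (Sp (X i) (n' i)))"
    show "\<exists>n'a na Fa fa xa. presmash_post m g (n', Jsum_pre r n F f, x) = (n'a, Jsum_pre r na Fa fa, xa) \<and>
        presmash_post m g (n, F, \<lambda>i\<in>{..<r}. act (X i) (n' i) (n i) (f i) (x i)) =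
          (na, Fa, \<lambda>i\<in>{..<r}. act (X i) (n'a i) (na i) (fa i) (xa i)) \<and>
        n'a \<in> {..<r} \<rightarrow>\<^sub>E UNIV \<and> na \<in> {..<r} \<rightarrow>\<^sub>E UNIV \<and> Fa \<in> topspace (Jsum r na m') \<and>
        (\<forall>i<r. fa i \<in> topspace (J (n'a i) (na i))) \<and>
        xa \<in> (\<Pi>\<^sub>E i\<in>{..<r}. topspace (Sp (X i) (n'a i)))"
      by (rule exI[of _ n'], rule exI[of _ n], rule exI[of _ "Jsum_post m g F"], rule exI[of _ f], rule exI[of _ x])
        (use * in \<open>simp add: presmash_post_def Jsum_post_pre Jsum_post_in[OF g]\<close>)
  qed
qed

lemma smash_act_class:
  assumes X: "\<forall>i<r. orthogonal_spectrum (X i)" and g: "g \<in> topspace (J m m')"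
    and z: "z \<in> topspace (presmash r X m)"
  shows "act (smash r X) m m' g (smash_rel r X m `` {z}) = smash_rel r X m' `` {presmash_post m g z}"
proof -
  have "act (smash r X) m m' g (smash_rel r X m `` {z}) =
      smash_rel r X m' `` (presmash_post m g ` (smash_rel r X m `` {z}))"
    by (simp add: smash_def presmash_post_def)
  then show ?thesis
    using image_class_eq[OF equiv_smash_rel[OF X] equiv_smash_rel[OF X] smash_rel_post[OF X g] z] by simp
qed

lemma topspace_smash: "topspace (Sp (smash r X) m) = topspace (presmash r X m) // smash_rel r X m"
  by (simp add: smash_def)

lemma smash_class_in:
  "z \<in> topspace (presmash r X m) \<Longrightarrow> smash_rel r X m `` {z} \<in> topspace (Sp (smash r X) m)"
  by (simp add: topspace_smash quotientI)

lemma smash_bpt_class: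
  assumes X: "\<forall>i<r. orthogonal_spectrum (X i)" and z: "z \<in> smash_base r X m"
  shows "bpt (smash r X) m = smash_rel r X m `` {z}"
proof -
  have zb: "(z, b) \<in> smash_rel r X m" if "b \<in> smash_base r X m" for b
    by (rule subsetD[OF smash_rel_superset[OF X]]) (use z that in \<open>simp_all add: smash_generators_def\<close>)
  have "smash_rel r X m `` {b} = smash_rel r X m `` {z}" if "b \<in> smash_base r X m" for b
    using equiv_class_eq[OF equiv_smash_rel[OF X] zb[OF that]] by simp
  then have "smash_rel r X m `` smash_base r X m = smash_rel r X m `` {z}" using z by blast
  then show ?thesis by (simp add: smash_def)
qed

lemma smash_base_None:
  assumes X: "\<forall>i<r. orthogonal_spectrum (X i)"
  shows "(\<lambda>i\<in>{..<r}. 0, None, \<lambda>i\<in>{..<r}. bpt (X i) 0) \<in> smash_base r X m"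
  using X by (auto simp: orthogonal_spectrum_bpt smash_base_iff topspace_presmash topspace_Jsum)

text \<open>A weak Hausdorff quotient of a k-space is a k-space: the projection maps every compact Hausdorff subset
  of a summand onto a compact Hausdorff subset, so it is continuous into the k-ification of the quotient.\<close>

lemma kify_smash:
  assumes X: "\<forall>i<r. orthogonal_spectrum (X i)"
  shows "kify (Sp (smash r X) m) = Sp (smash r X) m"
proof -
  let ?Z = "Sp (smash r X) m" and ?q = "\<lambda>z. smash_rel r X m `` {z}"
  have Z: "?Z = quot_topology (presmash r X m) (smash_rel r X m)" by (simp add: smash_def)
  have q: "quotient_map (presmash r X m) ?Z ?q" unfolding Z by (rule quotient_map_quot_topology)
  have wh: "weak_hausdorff ?Z" unfolding Z by (rule weak_hausdorff_smash[OF X])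
  have qk: "continuous_map (presmash r X m) (kify ?Z) ?q"
    unfolding presmash_def continuous_map_sum_topology
  proof (rule ballI, rule continuous_map_from_kify)
    fix n C assume n: "n \<in> {..<r} \<rightarrow>\<^sub>E (UNIV :: nat set)"
      and C: "C \<in> compact_Hausdorff_subsets
        (prod_topology (Jsum r n m) (product_topology (\<lambda>i. Sp (X i) (n i)) {..<r}))"
        (is "_ \<in> compact_Hausdorff_subsets ?Q")
    let ?K = "subtopology ?Q C"
    have K: "compact_space ?K" "Hausdorff_space ?K" using C by (simp_all add: compact_Hausdorff_subsets_def)
    have tK: "topspace ?K = C" using C by (auto simp: compact_Hausdorff_subsets_def)
    have "continuous_map ?K (kify ?Q) id"
      by (rule continuous_map_into_kify[OF K(1)]) (use K tK in \<open>simp_all add: subtopology_subtopology\<close>)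
    then have "continuous_map ?K (presmash r X m) (Pair n \<circ> id)"
      by (rule continuous_map_compose) (unfold presmash_def, rule continuous_map_component_injection[OF n])
    then have u: "continuous_map ?K ?Z (?q \<circ> (Pair n \<circ> id))"
      by (rule continuous_map_compose) (rule quotient_imp_continuous_map[OF q])
    have "continuous_map ?K (kify ?Z) (?q \<circ> (Pair n \<circ> id))"
      by (rule continuous_map_into_kify[OF K(1) u weak_hausdorff_Hausdorff_image[OF wh K u]])
    then show "continuous_map ?K (kify ?Z) (\<lambda>y. ?q (n, y))" by (simp add: o_def)
  qed
  have "openin ?Z U" if U: "openin (kify ?Z) U" for U
  proof -
    have "openin (presmash r X m) {z \<in> topspace (presmash r X m). ?q z \<in> U}"
      using openin_continuous_map_preimage[OF qk U] .
    moreover have "U \<subseteq> topspace ?Z" using U openin_subset by fastforce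
    ultimately show ?thesis using q unfolding quotient_map_def by blast
  qed
  then show ?thesis unfolding topology_eq using openin_imp_openin_kify by blast
qed

text \<open>As \<open>J\<close> is compact Hausdorff, its product with the projection to classes is a quotient map, and the action
  is continuous because it is so on representatives.\<close>

lemma continuous_map_smash_act:
  assumes X: "\<forall>i<r. orthogonal_spectrum (X i)"
  shows "continuous_map (prod_topology (J m m') (Sp (smash r X) m)) (Sp (smash r X) m')
    (\<lambda>(g, c). act (smash r X) m m' g c)"
proof (rule continuous_compose_quotient_map)
  let ?q = "\<lambda>m z. smash_rel r X m `` {z}"
  have q: "quotient_map (presmash r X m) (Sp (smash r X) m) (?q m)" for m
    by (simp add: smash_def quotient_map_quot_topology)
  show "quotient_map (prod_topology (J m m') (presmash r X m)) (prod_topology (J m m') (Sp (smash r X) m))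
      (\<lambda>(g, z). (g, ?q m z))"
    by (rule quotient_map_prod_right[OF _ _ q])
      (simp_all add: compact_imp_locally_compact_space compact_space_J Hausdorff_space_J)
  have "continuous_map (prod_topology (J m m') (presmash r X m)) (Sp (smash r X) m')
      (?q m' \<circ> (\<lambda>(g, z). presmash_post m g z))"
    by (rule continuous_map_compose[OF continuous_map_presmash_post[OF X] quotient_imp_continuous_map[OF q]])
  then show "continuous_map (prod_topology (J m m') (presmash r X m)) (Sp (smash r X) m')
      ((\<lambda>(g, c). act (smash r X) m m' g c) \<circ> (\<lambda>(g, z). (g, ?q m z)))"
    by (rule continuous_map_eq) (auto simp: smash_act_class[OF X])
qed

theorem orthogonal_spectrum_smash:
  assumes X: "\<forall>i<r. orthogonal_spectrum (X i)"
  shows "orthogonal_spectrum (smash r X)"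
  unfolding orthogonal_spectrum_def
proof (intro conjI allI ballI)
  note cl = smash_act_class[OF X]
  have cases: "\<exists>z. z \<in> topspace (presmash r X m) \<and> c = smash_rel r X m `` {z}"
    if "c \<in> topspace (Sp (smash r X) m)" for c m
    using that unfolding topspace_smash by (metis quotientE)
  show "cgwh (Sp (smash r X) m)" for m
    unfolding cgwh_def using kify_smash[OF X] weak_hausdorff_smash[OF X] by (simp add: smash_def)
  note b = smash_base_None[OF X]
  have b': "z \<in> topspace (presmash r X m)" if "z \<in> smash_base r X m" for z m
    using that by (auto simp: smash_base_def)
  show "bpt (smash r X) m \<in> topspace (Sp (smash r X) m)" for m
    unfolding smash_bpt_class[OF X b] by (rule smash_class_in[OF b'[OF b]])
  show "continuous_map (kify (prod_topology (J m m') (Sp (smash r X) m))) (Sp (smash r X) m')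
      (\<lambda>(f, x). act (smash r X) m m' f x)" for m m'
    by (rule continuous_map_kify_source[OF continuous_map_smash_act[OF X]])
  show "act (smash r X) m m' g (bpt (smash r X) m) = bpt (smash r X) m'" if g: "g \<in> topspace (J m m')" for m m' g
  proof -
    have "act (smash r X) m m' g (bpt (smash r X) m) =
        smash_rel r X m' `` {presmash_post m g (\<lambda>i\<in>{..<r}. 0, None, \<lambda>i\<in>{..<r}. bpt (X i) 0)}"
      unfolding smash_bpt_class[OF X b] by (rule cl[OF g b'[OF b]])
    also have "\<dots> = bpt (smash r X) m'"
      by (rule smash_bpt_class[OF X presmash_post_base[OF g b], symmetric])
    finally show ?thesis .
  qed
  fix m c assume "c \<in> topspace (Sp (smash r X) m)"
  then obtain z where z: "z \<in> topspace (presmash r X m)" "c = smash_rel r X m `` {z}" using cases by blast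
  obtain n F x where nFx: "z = (n, F, x)" by (cases z)
  show "act (smash r X) m m' None c = bpt (smash r X) m'" for m'
  proof -
    have N: "None \<in> topspace (J m m')" by (simp add: topspace_J)
    have "presmash_post m None z \<in> smash_base r X m'"
      using presmash_post_in[OF N z(1)] by (simp add: nFx presmash_post_def smash_base_iff)
    then show ?thesis unfolding z(2) cl[OF N z(1)] by (rule smash_bpt_class[OF X, symmetric])
  qed
  show "act (smash r X) m m (J_id m) c = c"
  proof -
    have I: "J_id m \<in> topspace (J m m)" by (rule J_id_in)
    have "presmash_post m (J_id m) z = z"
      using z(1) by (auto simp: nFx presmash_post_def topspace_presmash intro: Jsum_post_id)
    then show ?thesis unfolding z(2) cl[OF I z(1)] by simp
  qed
  fix m' p f g assume fg: "f \<in> topspace (J m m')" "g \<in> topspace (J m' p)"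
  have "J_comp m' g f \<in> topspace (J m p)" by (rule J_comp_in[OF fg])
  then show "act (smash r X) m p (J_comp m' g f) c = act (smash r X) m' p g (act (smash r X) m m' f c)"
    unfolding z(2) cl[OF fg(1) z(1)] cl[OF fg(2) presmash_post_in[OF fg(1) z(1)]]
    by (simp add: cl z(1)) (simp add: nFx presmash_post_def Jsum_post_comp)
qed

section \<open>The category of orthogonal spectra\<close>

lemma spectrum_map_id:
  assumes "orthogonal_spectrum X"
  shows "spectrum_map X X (spectrum_id X)"
  unfolding spectrum_map_def
proof (intro conjI allI ballI)
  show "continuous_map (Sp X n) (Sp X n) (spectrum_id X n)" for n
    by (rule continuous_map_eq[OF continuous_map_id]) (simp add: spectrum_id_def)
qed (use assms in \<open>auto simp: spectrum_id_def orthogonal_spectrum_bpt orthogonal_spectrum_act_in\<close>)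

lemma underlying_eq [simp]: "underlying (X, Y, f) = f"
  by (simp add: underlying_def)

lemma Spectra_arrow_iff: "a \<in> Ar Spectra \<longleftrightarrow> spectrum_map (Dom Spectra a) (Cod Spectra a) (underlying a)"
  by (cases a) (simp add: Spectra_def)

lemma Spectra_Ob_iff: "X \<in> Ob Spectra \<longleftrightarrow> orthogonal_spectrum X"
  by (simp add: Spectra_def)

lemma underlying_Idn [simp]: "underlying (Idn Spectra X) = spectrum_id X"
  by (simp add: Spectra_def)

lemma underlying_Cmp:
  "underlying (Cmp Spectra b a) =
    (\<lambda>n. compose (topspace (Sp (Dom Spectra a) n)) (underlying b n) (underlying a n))"
  by (cases a; cases b) (simp add: Spectra_def)

lemma spectrum_map_compose:
  assumes f: "spectrum_map X Y f" and g: "spectrum_map Y Z g"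
  shows "spectrum_map X Z (\<lambda>n. compose (topspace (Sp X n)) (g n) (f n))"
  unfolding spectrum_map_def
proof (intro conjI allI ballI)
  let ?h = "\<lambda>n. compose (topspace (Sp X n)) (g n) (f n)"
  have X: "orthogonal_spectrum X" using f by (simp add: spectrum_map_def)
  have f_in: "f n x \<in> topspace (Sp Y n)" if "x \<in> topspace (Sp X n)" for n x
    using f that by (auto simp: spectrum_map_def continuous_map_def Pi_iff)
  show "continuous_map (Sp X n) (Sp Z n) (?h n)" for n
  proof (rule continuous_map_eq)
    show "continuous_map (Sp X n) (Sp Z n) (g n \<circ> f n)"
      by (rule continuous_map_compose[where X' = "Sp Y n"]) (use f g in \<open>auto simp: spectrum_map_def\<close>)
  qed (simp add: compose_def)
  show "?h n (bpt X n) = bpt Z n" for n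
    using f g X by (simp add: spectrum_map_def compose_def orthogonal_spectrum_bpt)
  fix n m j x assume "j \<in> topspace (J n m)" "x \<in> topspace (Sp X n)"
  then show "?h m (act X n m j x) = act Z n m j (?h n x)"
    using f g orthogonal_spectrum_act_in[OF X] f_in by (simp add: spectrum_map_def compose_def)
qed (use f g in \<open>auto simp: spectrum_map_def compose_def\<close>)

lemma is_category_Spectra: "is_category Spectra"
proof -
  have ext: "compose (topspace (Sp X n)) (f n) (\<lambda>x\<in>topspace (Sp X n). x) = f n"
    "compose (topspace (Sp X n)) (\<lambda>x\<in>topspace (Sp Y n). x) (f n) = f n"
    if "spectrum_map X Y f" for X Y :: "'a spectrum" and f n
    using that
    by (auto simp: spectrum_map_def compose_def fun_eq_iff extensional_def continuous_map_def Pi_iff)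
  have assoc: "compose (topspace (Sp X n)) (h n) (compose (topspace (Sp X n)) (g n) (f n)) =
      compose (topspace (Sp X n)) (compose (topspace (Sp Y n)) (h n) (g n)) (f n)"
    if "spectrum_map X Y f" for X Y :: "'a spectrum" and f g h n
    using that by (auto simp: spectrum_map_def compose_def fun_eq_iff continuous_map_def Pi_iff)
  show ?thesis
    unfolding is_category_def
  proof (intro conjI ballI impI)
    fix f :: "'a spmor" assume "f \<in> Ar Spectra"
    then show "Dom Spectra f \<in> Ob Spectra" "Cod Spectra f \<in> Ob Spectra"
      by (auto simp: Spectra_def spectrum_map_def)
  next
    fix X :: "'a spectrum" assume "X \<in> Ob Spectra"
    then show "Idn Spectra X \<in> Ar Spectra" "Dom Spectra (Idn Spectra X) = X" "Cod Spectra (Idn Spectra X) = X"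
      by (simp_all add: Spectra_def spectrum_map_id)
  next
    fix f g :: "'a spmor" assume "f \<in> Ar Spectra" "g \<in> Ar Spectra" "Dom Spectra g = Cod Spectra f"
    then show "Cmp Spectra g f \<in> Ar Spectra" "Dom Spectra (Cmp Spectra g f) = Dom Spectra f"
      "Cod Spectra (Cmp Spectra g f) = Cod Spectra g"
      by (auto simp: Spectra_def intro: spectrum_map_compose)
  next
    fix f :: "'a spmor" assume "f \<in> Ar Spectra"
    then show "Cmp Spectra f (Idn Spectra (Dom Spectra f)) = f"
      "Cmp Spectra (Idn Spectra (Cod Spectra f)) f = f"
      by (auto simp: Spectra_def spectrum_id_def ext)
  next
    fix f g h :: "'a spmor"
    assume "f \<in> Ar Spectra" "g \<in> Ar Spectra" "h \<in> Ar Spectra"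
      "Dom Spectra g = Cod Spectra f" "Dom Spectra h = Cod Spectra g"
    then show "Cmp Spectra h (Cmp Spectra g f) = Cmp Spectra (Cmp Spectra h g) f"
      by (auto simp: Spectra_def fun_eq_iff assoc)
  qed
qed

section \<open>Functoriality of the smash product\<close>

lemma presmash_map_eq:
  "presmash_map r p f (n, F, x) =
    (\<lambda>j\<in>{..<r}. n (inv_into {..<r} p j), Jsum_perm r (inv_into {..<r} p) F,
     \<lambda>j\<in>{..<r}. f (inv_into {..<r} p j) (n (inv_into {..<r} p j)) (x (inv_into {..<r} p j)))"
  by (simp add: presmash_map_def Jsum_perm_def Let_def)

locale smash_factor_maps =
  fixes r :: nat and p :: "nat \<Rightarrow> nat" and X Y :: "nat \<Rightarrow> 'a spectrum" and f :: "nat \<Rightarrow> nat \<Rightarrow> 'a \<Rightarrow> 'a"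
  assumes p: "bij_betw p {..<r} {..<r}"
    and f: "\<forall>i<r. spectrum_map (X i) (Y (p i)) (f i)"
begin

abbreviation q :: "nat \<Rightarrow> nat" where "q \<equiv> inv_into {..<r} p"

lemma q: "bij_betw q {..<r} {..<r}" by (rule bij_betw_inv_into[OF p])

lemma q_less: "j < r \<Longrightarrow> q j < r" using q by (auto simp: bij_betw_def)

lemma p_q: "j < r \<Longrightarrow> p (q j) = j" using p by (simp add: bij_betw_inv_into_right)

lemma p_less: "i < r \<Longrightarrow> p i < r" using p by (auto simp: bij_betw_def)

lemma q_inj: "inj_on q {..<r}" "q ` {..<r} \<subseteq> {..<r}" using q by (auto simp: bij_betw_def)

lemma f_q: "j < r \<Longrightarrow> spectrum_map (X (q j)) (Y j) (f (q j))"
  using f q_less p_q by metis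

lemma f_in: "j < r \<Longrightarrow> x \<in> topspace (Sp (X (q j)) k) \<Longrightarrow> f (q j) k x \<in> topspace (Sp (Y j) k)"
  using f_q[of j] by (auto simp: spectrum_map_def continuous_map_def Pi_iff)

lemma source_orthogonal: "\<forall>i<r. orthogonal_spectrum (X i)"
  using f by (simp add: spectrum_map_def)

lemma target_orthogonal: "\<forall>i<r. orthogonal_spectrum (Y i)"
  using f_q by (simp add: spectrum_map_def)

lemma continuous_map_presmash_map:
  "continuous_map (presmash r X m) (presmash r Y m) (presmash_map r p f)"
proof -
  let ?\<nu> = "\<lambda>n :: nat \<Rightarrow> nat. \<lambda>j\<in>{..<r}. n (q j)"
  let ?\<xi> = "\<lambda>n x. \<lambda>j\<in>{..<r}. f (q j) (n (q j)) (x (q j))"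
  have "continuous_map (presmash r X m) (presmash r Y m)
      (\<lambda>(n, F, x). (?\<nu> n, Jsum_perm r q F, ?\<xi> n x))"
  proof (rule continuous_map_presmash[OF target_orthogonal, where \<nu> = ?\<nu> and a = "\<lambda>_. Jsum_perm r q" and \<xi> = ?\<xi>])
    fix n :: "nat \<Rightarrow> nat"
    show "?\<nu> n \<in> {..<r} \<rightarrow>\<^sub>E UNIV" by simp
    show "continuous_map (Jsum r n m) (Jsum r (?\<nu> n) m) (Jsum_perm r q)"
      by (rule continuous_map_Jsum_perm[OF q_inj]) simp
    show "continuous_map (product_topology (\<lambda>i. Sp (X i) (n i)) {..<r})
        (product_topology (\<lambda>i. Sp (Y i) (?\<nu> n i)) {..<r}) (?\<xi> n)"
      unfolding continuous_map_componentwise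
    proof (intro conjI ballI)
      fix j assume j: "j \<in> {..<r}"
      have "continuous_map (product_topology (\<lambda>i. Sp (X i) (n i)) {..<r}) (Sp (X (q j)) (n (q j))) (\<lambda>x. x (q j))"
        by (rule continuous_map_product_projection) (use j q_less in simp)
      moreover have "continuous_map (Sp (X (q j)) (n (q j))) (Sp (Y j) (n (q j))) (f (q j) (n (q j)))"
        using f_q[of j] j by (simp add: spectrum_map_def)
      ultimately have "continuous_map (product_topology (\<lambda>i. Sp (X i) (n i)) {..<r}) (Sp (Y j) (n (q j)))
          (f (q j) (n (q j)) \<circ> (\<lambda>x. x (q j)))" by (rule continuous_map_compose)
      then show "continuous_map (product_topology (\<lambda>i. Sp (X i) (n i)) {..<r}) (Sp (Y j) (?\<nu> n j)) (\<lambda>x. ?\<xi> n x j)"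
        using j by (simp add: o_def)
    qed auto
  qed
  then show ?thesis by (rule continuous_map_eq) (auto simp: presmash_map_eq)
qed

lemma presmash_map_in:
  "z \<in> topspace (presmash r X m) \<Longrightarrow> presmash_map r p f z \<in> topspace (presmash r Y m)"
  using continuous_map_presmash_map[of m] by (auto simp: continuous_map_def Pi_iff)

lemma presmash_map_base:
  assumes "z \<in> smash_base r X m"
  shows "presmash_map r p f z \<in> smash_base r Y m"
proof -
  obtain n F x where z: "z = (n, F, x)" by (cases z)
  have in_X: "z \<in> topspace (presmash r X m)" and F: "F = None \<or> (\<exists>i<r. x i = bpt (X i) (n i))"
    using assms by (auto simp: z smash_base_iff)
  from F have "Jsum_perm r q F = None \<or> (\<exists>j<r. f (q j) (n (q j)) (x (q j)) = bpt (Y j) (n (q j)))"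
  proof
    assume "\<exists>i<r. x i = bpt (X i) (n i)"
    then obtain i where i: "i < r" "x i = bpt (X i) (n i)" by blast
    have qp: "q (p i) = i" using p i(1) by (simp add: bij_betw_inv_into_left)
    have "f i (n i) (bpt (X i) (n i)) = bpt (Y (p i)) (n i)"
      using f i(1) by (simp add: spectrum_map_def)
    then show ?thesis using i p_less[OF i(1)] qp by auto
  qed (simp add: Jsum_perm_def)
  then show ?thesis
    using presmash_map_in[OF in_X] unfolding z presmash_map_eq smash_base_iff by auto
qed

text \<open>A generating pair moves \<open>g i\<close> from the operator \<open>F\<close> to the coordinate \<open>x i\<close>. The image is the pair that
  moves \<open>g (q j)\<close>, because the maps \<open>f i\<close> commute with the action of \<open>J\<close>.\<close>

lemma presmash_map_coend:
  assumes "(a, b) \<in> coend_rel r X m"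
  shows "(presmash_map r p f a, presmash_map r p f b) \<in> coend_rel r Y m"
proof -
  obtain n' n F g x where *: "n' \<in> {..<r} \<rightarrow>\<^sub>E (UNIV :: nat set)" "n \<in> {..<r} \<rightarrow>\<^sub>E (UNIV :: nat set)"
      "F \<in> topspace (Jsum r n m)" "\<forall>i<r. g i \<in> topspace (J (n' i) (n i))"
      "x \<in> (\<Pi>\<^sub>E i\<in>{..<r}. topspace (Sp (X i) (n' i)))"
    and a: "a = (n', Jsum_pre r n F g, x)"
    and b: "b = (n, F, \<lambda>i\<in>{..<r}. act (X i) (n' i) (n i) (g i) (x i))"
    using assms unfolding coend_rel_def by blast
  let ?n' = "\<lambda>j\<in>{..<r}. n' (q j)" and ?n = "\<lambda>j\<in>{..<r}. n (q j)"
  let ?x = "\<lambda>j\<in>{..<r}. f (q j) (n' (q j)) (x (q j))"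
  have xq: "x (q j) \<in> topspace (Sp (X (q j)) (n' (q j)))" if "j < r" for j
    using *(5) q_less[OF that] by auto
  have a': "presmash_map r p f a = (?n', Jsum_pre r ?n (Jsum_perm r q F) (\<lambda>j. g (q j)), ?x)"
    unfolding a presmash_map_eq Jsum_perm_pre[OF q] ..
  have "f (q j) (n (q j)) (act (X (q j)) (n' (q j)) (n (q j)) (g (q j)) (x (q j))) =
      act (Y j) (n' (q j)) (n (q j)) (g (q j)) (f (q j) (n' (q j)) (x (q j)))" if "j < r" for j
    using f_q[OF that] xq[OF that] *(4) q_less[OF that] by (simp add: spectrum_map_def)
  then have b': "presmash_map r p f b =
      (?n, Jsum_perm r q F, \<lambda>j\<in>{..<r}. act (Y j) (?n' j) (?n j) (g (q j)) (?x j))"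
    unfolding b presmash_map_eq by (auto simp: q_less intro!: restrict_ext)
  have "Jsum_perm r q F \<in> topspace (Jsum r ?n m)"
    by (rule Jsum_perm_in[OF q_inj *(3)]) simp
  moreover have "\<forall>j<r. g (q j) \<in> topspace (J (?n' j) (?n j))" using *(4) q_less by simp
  moreover have "?x \<in> (\<Pi>\<^sub>E j\<in>{..<r}. topspace (Sp (Y j) (?n' j)))"
    using f_in xq by auto
  ultimately show ?thesis
    unfolding coend_rel_def mem_Collect_eq
    by (intro exI[of _ ?n'] exI[of _ ?n] exI[of _ "Jsum_perm r q F"] exI[of _ "\<lambda>j. g (q j)"] exI[of _ ?x])
      (simp add: a' b')
qed

lemma smash_rel_presmash_map:
  "(a, b) \<in> smash_rel r X m \<Longrightarrow> (presmash_map r p f a, presmash_map r p f b) \<in> smash_rel r Y m"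
  by (rule smash_rel_map[OF source_orthogonal target_orthogonal continuous_map_presmash_map presmash_map_coend presmash_map_base])

lemma image_smash_class:
  "z \<in> topspace (presmash r X m) \<Longrightarrow>
    smash_rel r Y m `` (presmash_map r p f ` (smash_rel r X m `` {z})) = smash_rel r Y m `` {presmash_map r p f z}"
  by (rule image_class_eq[OF equiv_smash_rel[OF source_orthogonal] equiv_smash_rel[OF target_orthogonal] smash_rel_presmash_map])

lemma smash_map_class:
  "z \<in> topspace (presmash r X m) \<Longrightarrow>
    snd (snd (smash_map r p X Y f)) m (smash_rel r X m `` {z}) = smash_rel r Y m `` {presmash_map r p f z}"
  by (simp add: smash_map_def smash_class_in image_smash_class)

lemma presmash_map_post: "presmash_map r p f (presmash_post m g z) = presmash_post m g (presmash_map r p f z)"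
  by (cases z) (simp add: presmash_map_eq presmash_post_def Jsum_perm_post)

lemma spectrum_map_smash: "spectrum_map (smash r X) (smash r Y) (snd (snd (smash_map r p X Y f)))"
  unfolding spectrum_map_def
proof (intro conjI allI ballI)
  let ?h = "snd (snd (smash_map r p X Y f))"
  show "orthogonal_spectrum (smash r X)" "orthogonal_spectrum (smash r Y)"
    by (rule orthogonal_spectrum_smash[OF source_orthogonal] orthogonal_spectrum_smash[OF target_orthogonal])+
  show "?h m \<in> extensional (topspace (Sp (smash r X) m))" for m by (simp add: smash_map_def)
  show "continuous_map (Sp (smash r X) m) (Sp (smash r Y) m) (?h m)" for m
  proof (rule continuous_map_eq)
    show "continuous_map (Sp (smash r X) m) (Sp (smash r Y) m)
        (\<lambda>c. smash_rel r Y m `` (presmash_map r p f ` c))"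
      using continuous_map_class_map[OF equiv_smash_rel[OF source_orthogonal] equiv_smash_rel[OF target_orthogonal]
          continuous_map_presmash_map smash_rel_presmash_map]
      by (simp add: smash_def)
  qed (simp add: smash_map_def)
  show "?h m (bpt (smash r X) m) = bpt (smash r Y) m" for m
  proof -
    note b = smash_base_None[OF source_orthogonal, of m]
    have b': "(\<lambda>i\<in>{..<r}. 0, None, \<lambda>i\<in>{..<r}. bpt (X i) 0) \<in> topspace (presmash r X m)"
      using b unfolding smash_base_iff by blast
    show ?thesis
      unfolding smash_bpt_class[OF source_orthogonal b] smash_map_class[OF b']
      by (rule smash_bpt_class[OF target_orthogonal presmash_map_base[OF b], symmetric])
  qed
  fix m m' g c assume g: "g \<in> topspace (J m m')" and "c \<in> topspace (Sp (smash r X) m)"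
  then obtain z where z: "z \<in> topspace (presmash r X m)" "c = smash_rel r X m `` {z}"
    unfolding topspace_smash by (metis quotientE)
  show "?h m' (act (smash r X) m m' g c) = act (smash r Y) m m' g (?h m c)"
    unfolding z(2) smash_act_class[OF source_orthogonal g z(1)] smash_map_class[OF presmash_post_in[OF g z(1)]]
      smash_map_class[OF z(1)] smash_act_class[OF target_orthogonal g presmash_map_in[OF z(1)]] presmash_map_post ..
qed

lemma smash_map_arrow:
  "smash_map r p X Y f \<in> Ar Spectra" "Dom Spectra (smash_map r p X Y f) = smash r X"
  "Cod Spectra (smash_map r p X Y f) = smash r Y"
  using spectrum_map_smash by (simp_all add: Spectra_def smash_map_def)

end

lemma smash_map_cong:
  assumes "\<And>i. i < r \<Longrightarrow> p i = p' i" "\<And>i. i < r \<Longrightarrow> f i = f' i" and p: "bij_betw p {..<r} {..<r}"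
  shows "smash_map r p X Y f = smash_map r p' X Y f'"
proof -
  have q: "inv_into {..<r} p = inv_into {..<r} p'"
    unfolding inv_into_def using assms(1) by (intro ext arg_cong[where f = Eps]) auto
  have qr: "inv_into {..<r} p j < r" if "j < r" for j
    using bij_betw_inv_into[OF p] that by (auto simp: bij_betw_def)
  have pre: "presmash_map r p f (n, F, x) = presmash_map r p' f' (n, F, x)" for n F x
    unfolding presmash_map_eq q[symmetric] using assms(2) qr by (auto intro!: restrict_ext)
  have "presmash_map r p f z = presmash_map r p' f' z" for z
    by (cases z rule: prod_cases3) (simp only: pre)
  then have "presmash_map r p f = presmash_map r p' f'" ..
  then show ?thesis by (simp add: smash_map_def)
qed

text \<open>Both sides act on representatives by permuting and mapping the coordinates, where they agree.\<close>

lemma smash_map_compose: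
  fixes X Y Z :: "nat \<Rightarrow> 'a spectrum"
  assumes f: "bij_betw p {..<r} {..<r}" "\<forall>i<r. spectrum_map (X i) (Y (p i)) (f i)"
    and g: "bij_betw p' {..<r} {..<r}" "\<forall>i<r. spectrum_map (Y i) (Z (p' i)) (g i)"
  shows "Cmp Spectra (smash_map r p' Y Z g) (smash_map r p X Y f) =
    smash_map r (p' \<circ> p) X Z (\<lambda>i n. compose (topspace (Sp (X i) n)) (g (p i) n) (f i n))"
proof -
  interpret F: smash_factor_maps r p X Y f using f by unfold_locales
  interpret G: smash_factor_maps r p' Y Z g using g by unfold_locales
  let ?h = "\<lambda>i n. compose (topspace (Sp (X i) n)) (g (p i) n) (f i n)"
  interpret H: smash_factor_maps r "p' \<circ> p" X Z ?h
  proof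
    show "bij_betw (p' \<circ> p) {..<r} {..<r}" using f(1) g(1) by (rule bij_betw_trans)
    show "\<forall>i<r. spectrum_map (X i) (Z ((p' \<circ> p) i)) (?h i)"
    proof (intro allI impI)
      fix i assume "i < r"
      then show "spectrum_map (X i) (Z ((p' \<circ> p) i)) (?h i)"
        using spectrum_map_compose[of "X i" "Y (p i)" "f i" "Z (p' (p i))" "g (p i)"] f g F.p_less by simp
    qed
  qed
  have q: "H.q j = F.q (G.q j)" if "j < r" for j
  proof (rule inv_into_f_eq)
    show "inj_on (p' \<circ> p) {..<r}" using H.p by (simp add: bij_betw_def)
    show "F.q (G.q j) \<in> {..<r}" using F.q_less G.q_less that by simp
    show "(p' \<circ> p) (F.q (G.q j)) = j" using F.p_q G.p_q G.q_less that by simp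
  qed
  have pre3: "presmash_map r p' g (presmash_map r p f (n, F, x)) = presmash_map r (p' \<circ> p) ?h (n, F, x)"
    if z: "(n, F, x) \<in> topspace (presmash r X m)" for n F x m
  proof -
    have perm: "Jsum_perm r G.q (Jsum_perm r F.q F) = Jsum_perm r H.q F"
      by (cases F) (auto simp: Jsum_perm_def q G.q_less fun_eq_iff)
    have "x i \<in> topspace (Sp (X i) (n i))" if "i < r" for i
      using z that by (auto simp: topspace_presmash)
    then have "(\<lambda>j\<in>{..<r}. g (G.q j) ((\<lambda>j\<in>{..<r}. n (F.q j)) (G.q j))
          ((\<lambda>j\<in>{..<r}. f (F.q j) (n (F.q j)) (x (F.q j))) (G.q j))) =
        (\<lambda>j\<in>{..<r}. ?h (H.q j) (n (H.q j)) (x (H.q j)))"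
      by (intro restrict_ext) (simp add: q G.q_less F.q_less F.p_q compose_def)
    moreover have "(\<lambda>j\<in>{..<r}. (\<lambda>j\<in>{..<r}. n (F.q j)) (G.q j)) = (\<lambda>j\<in>{..<r}. n (H.q j))"
      by (intro restrict_ext) (simp add: q G.q_less)
    ultimately show ?thesis unfolding presmash_map_eq perm by (simp only:)
  qed
  have pre: "presmash_map r p' g (presmash_map r p f z) = presmash_map r (p' \<circ> p) ?h z"
    if "z \<in> topspace (presmash r X m)" for z m
    by (cases z rule: prod_cases3) (use that pre3 in blast)
  have "compose (topspace (Sp (smash r X) m)) (snd (snd (smash_map r p' Y Z g)) m) (snd (snd (smash_map r p X Y f)) m) =
      snd (snd (smash_map r (p' \<circ> p) X Z ?h)) m" for m
  proof
    fix c
    show "compose (topspace (Sp (smash r X) m)) (snd (snd (smash_map r p' Y Z g)) m) (snd (snd (smash_map r p X Y f)) m) c =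
      snd (snd (smash_map r (p' \<circ> p) X Z ?h)) m c"
    proof (cases "c \<in> topspace (Sp (smash r X) m)")
      case True
      then obtain z where z: "z \<in> topspace (presmash r X m)" "c = smash_rel r X m `` {z}"
        unfolding topspace_smash by (metis quotientE)
      have "snd (snd (smash_map r p' Y Z g)) m (snd (snd (smash_map r p X Y f)) m c) =
          snd (snd (smash_map r (p' \<circ> p) X Z ?h)) m c"
        unfolding z(2) F.smash_map_class[OF z(1)] G.smash_map_class[OF F.presmash_map_in[OF z(1)]]
          H.smash_map_class[OF z(1)] pre[OF z(1)] ..
      then show ?thesis using True by (simp add: compose_def)
    qed (simp add: compose_def smash_map_def)
  qed
  then show ?thesis by (auto simp: Spectra_def smash_map_def)
qed

lemma smash_map_id:
  assumes X: "\<forall>i<r. orthogonal_spectrum (X i)"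
  shows "smash_map r (\<lambda>i. i) X X (\<lambda>i. spectrum_id (X i)) = Idn Spectra (smash r X)"
proof -
  interpret smash_factor_maps r "\<lambda>i. i" X X "\<lambda>i. spectrum_id (X i)"
    using X by unfold_locales (auto simp: spectrum_map_id bij_betw_def)
  have q: "q j = j" if "j < r" for j using p_q[OF that] .
  have pre3: "presmash_map r (\<lambda>i. i) (\<lambda>i. spectrum_id (X i)) (n, F, x) = (n, F, x)"
    if z: "(n, F, x) \<in> topspace (presmash r X m)" for n F x m
  proof -
    have F: "F \<in> topspace (Jsum r n m)" and n: "n \<in> {..<r} \<rightarrow>\<^sub>E UNIV"
      and x: "x \<in> (\<Pi>\<^sub>E i\<in>{..<r}. topspace (Sp (X i) (n i)))"
      using z by (simp_all add: topspace_presmash)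
    have "Jsum_perm r q F = F"
      using F by (auto simp: topspace_Jsum Jsum_perm_def Jsum_points_iff q fun_eq_iff)
    moreover have "(\<lambda>j\<in>{..<r}. n (q j)) = n"
      using n by (auto simp: q fun_eq_iff PiE_def extensional_def)
    moreover have "(\<lambda>j\<in>{..<r}. spectrum_id (X (q j)) (n (q j)) (x (q j))) = x"
      using x by (auto simp: q fun_eq_iff PiE_def extensional_def spectrum_id_def)
    ultimately show ?thesis by (simp only: presmash_map_eq)
  qed
  have pre: "presmash_map r (\<lambda>i. i) (\<lambda>i. spectrum_id (X i)) z = z"
    if "z \<in> topspace (presmash r X m)" for z m
    by (cases z rule: prod_cases3) (use that pre3 in blast)
  have "snd (snd (smash_map r (\<lambda>i. i) X X (\<lambda>i. spectrum_id (X i)))) m = spectrum_id (smash r X) m" for m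
  proof
    fix c
    show "snd (snd (smash_map r (\<lambda>i. i) X X (\<lambda>i. spectrum_id (X i)))) m c = spectrum_id (smash r X) m c"
    proof (cases "c \<in> topspace (Sp (smash r X) m)")
      case True
      then obtain z where z: "z \<in> topspace (presmash r X m)" "c = smash_rel r X m `` {z}"
        unfolding topspace_smash by (metis quotientE)
      show ?thesis
        using True unfolding z(2) smash_map_class[OF z(1)] pre[OF z(1)] by (simp add: spectrum_id_def)
    qed (simp add: smash_map_def spectrum_id_def)
  qed
  then show ?thesis by (auto simp: Spectra_def smash_map_def)
qed

section \<open>Unordered smash products\<close>

lemma bij_betw_enum: "finite A \<Longrightarrow> bij_betw (enum A) {..<card A} A"
  unfolding enum_def lessThan_atLeast0 by (rule someI_ex[where P = "\<lambda>e. bij_betw e {0..<card A} A"]) (rule ex_bij_betw_nat_finite)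

lemma enum_in: "finite A \<Longrightarrow> k < card A \<Longrightarrow> enum A k \<in> A"
  using bij_betw_enum[of A] by (auto simp: bij_betw_def)

lemma Smash_in: "finite A \<Longrightarrow> (\<And>x. x \<in> A \<Longrightarrow> X x \<in> Ob Spectra) \<Longrightarrow> Smash A X \<in> Ob Spectra"
  unfolding Smash_def Spectra_Ob_iff by (rule orthogonal_spectrum_smash) (simp add: enum_in)

text \<open>The permutation of positions by which \<^const>\<open>Smash_map\<close> is defined: the bijection \<open>\<phi>\<close> read in the chosen
  enumerations of \<open>A\<close> and \<open>B\<close>.\<close>

definition enum_map :: "'i set \<Rightarrow> 'j set \<Rightarrow> ('i \<Rightarrow> 'j) \<Rightarrow> nat \<Rightarrow> nat" where
  "enum_map A B \<phi> k = inv_into {..<card B} (enum B) (\<phi> (enum A k))"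

lemma
  assumes A: "finite A" and \<phi>: "bij_betw \<phi> A B"
  shows bij_betw_enum_map: "bij_betw (enum_map A B \<phi>) {..<card A} {..<card A}"
    and enum_enum_map: "k < card A \<Longrightarrow> enum B (enum_map A B \<phi> k) = \<phi> (enum A k)"
proof -
  have B: "finite B" and c: "card B = card A" using A \<phi> by (simp_all add: bij_betw_finite bij_betw_same_card)
  have "bij_betw (inv_into {..<card B} (enum B) \<circ> (\<phi> \<circ> enum A)) {..<card A} {..<card B}"
    by (intro bij_betw_trans[OF bij_betw_trans[OF bij_betw_enum[OF A] \<phi>]] bij_betw_inv_into bij_betw_enum B)
  then show "bij_betw (enum_map A B \<phi>) {..<card A} {..<card A}"
    by (simp add: enum_map_def[abs_def] o_def c)
  show "enum B (enum_map A B \<phi> k) = \<phi> (enum A k)" if "k < card A"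
    unfolding enum_map_def
    by (rule bij_betw_inv_into_right[OF bij_betw_enum[OF B]]) (use enum_in[OF A that] \<phi> in \<open>auto simp: bij_betw_def\<close>)
qed

lemma Smash_map_enum_map:
  "Smash_map A B \<phi> X Y f = smash_map (card A) (enum_map A B \<phi>) (X \<circ> enum A) (Y \<circ> enum B) (f \<circ> enum A)"
  by (simp add: Smash_map_def enum_map_def[abs_def])

text \<open>The maps of the factors are given as arrows of \<^const>\<open>Spectra\<close>. This form lets a naturality square of smash
  products be checked factor by factor: by \<open>Smash_map_compose\<close> each side is a \<^const>\<open>Smash_map\<close> whose
  factors are composite arrows.\<close>

lemma Smash_map_arrow:
  assumes A: "finite A" and \<phi>: "bij_betw \<phi> A B"
    and a: "\<And>x. x \<in> A \<Longrightarrow> a x \<in> Ar Spectra \<and> Dom Spectra (a x) = X x \<and> Cod Spectra (a x) = Y (\<phi> x)"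
  shows "Smash_map A B \<phi> X Y (\<lambda>x. underlying (a x)) \<in> Ar Spectra"
    and "Dom Spectra (Smash_map A B \<phi> X Y (\<lambda>x. underlying (a x))) = Smash A X"
    and "Cod Spectra (Smash_map A B \<phi> X Y (\<lambda>x. underlying (a x))) = Smash B Y"
proof -
  have "spectrum_map (X x) (Y (\<phi> x)) (underlying (a x))" if "x \<in> A" for x
    using a[OF that] unfolding Spectra_arrow_iff by metis
  then interpret smash_factor_maps "card A" "enum_map A B \<phi>" "X \<circ> enum A" "Y \<circ> enum B"
    "(\<lambda>x. underlying (a x)) \<circ> enum A"
    by unfold_locales (use A \<phi> in \<open>simp_all add: bij_betw_enum_map enum_enum_map enum_in\<close>)
  have "card B = card A" using \<phi> by (simp add: bij_betw_same_card)
  then show "Smash_map A B \<phi> X Y (\<lambda>x. underlying (a x)) \<in> Ar Spectra"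
    "Dom Spectra (Smash_map A B \<phi> X Y (\<lambda>x. underlying (a x))) = Smash A X"
    "Cod Spectra (Smash_map A B \<phi> X Y (\<lambda>x. underlying (a x))) = Smash B Y"
    unfolding Smash_map_enum_map Smash_def using smash_map_arrow by simp_all
qed

lemma Smash_map_cong:
  assumes A: "finite A" and \<phi>: "bij_betw \<phi> A B"
    and "\<And>x. x \<in> A \<Longrightarrow> \<phi> x = \<phi>' x" "\<And>x. x \<in> A \<Longrightarrow> f x = f' x"
  shows "Smash_map A B \<phi> X Y f = Smash_map A B \<phi>' X Y f'"
  unfolding Smash_map_enum_map
  by (rule smash_map_cong) (use assms in \<open>simp_all add: bij_betw_enum_map enum_in enum_map_def\<close>)

lemma Smash_map_compose:
  assumes A: "finite A" and \<phi>: "bij_betw \<phi> A B" and \<psi>: "bij_betw \<psi> B C"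
    and a: "\<And>x. x \<in> A \<Longrightarrow> a x \<in> Ar Spectra \<and> Dom Spectra (a x) = X x \<and> Cod Spectra (a x) = Y (\<phi> x)"
    and b: "\<And>y. y \<in> B \<Longrightarrow> b y \<in> Ar Spectra \<and> Dom Spectra (b y) = Y y \<and> Cod Spectra (b y) = Z (\<psi> y)"
  shows "Cmp Spectra (Smash_map B C \<psi> Y Z (\<lambda>y. underlying (b y))) (Smash_map A B \<phi> X Y (\<lambda>x. underlying (a x))) =
    Smash_map A C (\<lambda>x. \<psi> (\<phi> x)) X Z (\<lambda>x. underlying (Cmp Spectra (b (\<phi> x)) (a x)))"
proof -
  have cB: "card B = card A" and B: "finite B" using A \<phi> by (simp_all add: bij_betw_same_card bij_betw_finite)
  have am: "spectrum_map (X x) (Y (\<phi> x)) (underlying (a x))" if "x \<in> A" for x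
    using a[OF that] unfolding Spectra_arrow_iff by metis
  have bm: "spectrum_map (Y y) (Z (\<psi> y)) (underlying (b y))" if "y \<in> B" for y
    using b[OF that] unfolding Spectra_arrow_iff by metis
  have p: "bij_betw (enum_map A B \<phi>) {..<card A} {..<card A}" by (rule bij_betw_enum_map[OF A \<phi>])
  have p': "bij_betw (enum_map B C \<psi>) {..<card A} {..<card A}" using bij_betw_enum_map[OF B \<psi>] cB by simp
  have "Cmp Spectra (Smash_map B C \<psi> Y Z (\<lambda>y. underlying (b y))) (Smash_map A B \<phi> X Y (\<lambda>x. underlying (a x))) =
    smash_map (card A) (enum_map B C \<psi> \<circ> enum_map A B \<phi>) (X \<circ> enum A) (Z \<circ> enum C)
      (\<lambda>k n. compose (topspace (Sp ((X \<circ> enum A) k) n))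
         (((\<lambda>y. underlying (b y)) \<circ> enum B) (enum_map A B \<phi> k) n) (((\<lambda>x. underlying (a x)) \<circ> enum A) k n))"
    unfolding Smash_map_enum_map cB
    by (rule smash_map_compose[OF p _ p'])
      (simp_all add: enum_enum_map[OF A \<phi>] enum_enum_map[OF B \<psi>] am bm enum_in[OF A] enum_in[OF B] cB)
  also have "\<dots> = smash_map (card A) (enum_map A C (\<lambda>x. \<psi> (\<phi> x))) (X \<circ> enum A) (Z \<circ> enum C)
      ((\<lambda>x. underlying (Cmp Spectra (b (\<phi> x)) (a x))) \<circ> enum A)"
  proof (rule smash_map_cong[OF _ _ bij_betw_trans[OF p p']])
    fix k assume k: "k < card A"
    show "(enum_map B C \<psi> \<circ> enum_map A B \<phi>) k = enum_map A C (\<lambda>x. \<psi> (\<phi> x)) k"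
      using enum_enum_map[OF A \<phi> k] by (simp add: enum_map_def[of B C] enum_map_def[of A C])
    show "(\<lambda>n. compose (topspace (Sp ((X \<circ> enum A) k) n))
         (((\<lambda>y. underlying (b y)) \<circ> enum B) (enum_map A B \<phi> k) n) (((\<lambda>x. underlying (a x)) \<circ> enum A) k n)) =
        ((\<lambda>x. underlying (Cmp Spectra (b (\<phi> x)) (a x))) \<circ> enum A) k"
      using a[OF enum_in[OF A k]] by (simp add: underlying_Cmp enum_enum_map[OF A \<phi> k])
  qed
  finally show ?thesis by (simp add: Smash_map_enum_map)
qed

lemma Smash_map_Idn:
  assumes A: "finite A" and X: "\<And>x. x \<in> A \<Longrightarrow> X x \<in> Ob Spectra"
  shows "Smash_map A A (\<lambda>x. x) X X (\<lambda>x. underlying (Idn Spectra (X x))) = Idn Spectra (Smash A X)"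
proof -
  have X': "\<forall>k<card A. orthogonal_spectrum ((X \<circ> enum A) k)"
    using X enum_in[OF A] by (simp add: Spectra_Ob_iff)
  have "enum_map A A (\<lambda>x. x) k = k" if "k < card A" for k
    unfolding enum_map_def using bij_betw_inv_into_left[OF bij_betw_enum[OF A]] that by simp
  then have "Smash_map A A (\<lambda>x. x) X X (\<lambda>x. underlying (Idn Spectra (X x))) =
      smash_map (card A) (\<lambda>k. k) (X \<circ> enum A) (X \<circ> enum A) (\<lambda>k. spectrum_id ((X \<circ> enum A) k))"
    unfolding Smash_map_enum_map
    by (intro smash_map_cong) (use bij_betw_enum_map[OF A, of "\<lambda>x. x" A] in \<open>simp_all add: bij_betw_def\<close>)
  then show ?thesis using smash_map_id[OF X'] by (simp add: Smash_def o_def)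
qed

section \<open>Functor categories\<close>

lemma
  assumes "is_category C"
  shows category_Dom: "f \<in> Ar C \<Longrightarrow> Dom C f \<in> Ob C"
    and category_Cod: "f \<in> Ar C \<Longrightarrow> Cod C f \<in> Ob C"
    and category_Idn: "x \<in> Ob C \<Longrightarrow> Idn C x \<in> Ar C"
    and category_Dom_Idn: "x \<in> Ob C \<Longrightarrow> Dom C (Idn C x) = x"
    and category_Cod_Idn: "x \<in> Ob C \<Longrightarrow> Cod C (Idn C x) = x"
    and category_Cmp: "f \<in> Ar C \<Longrightarrow> g \<in> Ar C \<Longrightarrow> Dom C g = Cod C f \<Longrightarrow> Cmp C g f \<in> Ar C"
    and category_Dom_Cmp: "f \<in> Ar C \<Longrightarrow> g \<in> Ar C \<Longrightarrow> Dom C g = Cod C f \<Longrightarrow> Dom C (Cmp C g f) = Dom C f"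
    and category_Cod_Cmp: "f \<in> Ar C \<Longrightarrow> g \<in> Ar C \<Longrightarrow> Dom C g = Cod C f \<Longrightarrow> Cod C (Cmp C g f) = Cod C g"
    and category_Idn_right: "f \<in> Ar C \<Longrightarrow> Dom C f = x \<Longrightarrow> Cmp C f (Idn C x) = f"
    and category_Idn_left: "f \<in> Ar C \<Longrightarrow> Cod C f = x \<Longrightarrow> Cmp C (Idn C x) f = f"
    and category_assoc: "f \<in> Ar C \<Longrightarrow> g \<in> Ar C \<Longrightarrow> h \<in> Ar C \<Longrightarrow> Dom C g = Cod C f \<Longrightarrow>
      Dom C h = Cod C g \<Longrightarrow> Cmp C h (Cmp C g f) = Cmp C (Cmp C h g) f"
  using assms by (auto simp: is_category_def)

lemmas category_simps = category_Dom category_Cod category_Idn category_Dom_Idn category_Cod_Idn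
  category_Cmp category_Dom_Cmp category_Cod_Cmp category_Idn_right category_Idn_left

lemma
  assumes "is_functor C D F"
  shows functor_source: "is_category C" and functor_target: "is_category D"
    and functor_Src: "Src F = C" and functor_Tgt: "Tgt F = D"
    and functor_Fo: "x \<in> Ob C \<Longrightarrow> Fo F x \<in> Ob D"
    and functor_Fa: "f \<in> Ar C \<Longrightarrow> Fa F f \<in> Ar D"
    and functor_Dom: "f \<in> Ar C \<Longrightarrow> Dom D (Fa F f) = Fo F (Dom C f)"
    and functor_Cod: "f \<in> Ar C \<Longrightarrow> Cod D (Fa F f) = Fo F (Cod C f)"
    and functor_Idn: "x \<in> Ob C \<Longrightarrow> Fa F (Idn C x) = Idn D (Fo F x)"
    and functor_Cmp: "f \<in> Ar C \<Longrightarrow> g \<in> Ar C \<Longrightarrow> Dom C g = Cod C f \<Longrightarrow> Fa F (Cmp C g f) = Cmp D (Fa F g) (Fa F f)"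
  using assms by (auto simp: is_functor_def)

lemmas functor_simps = functor_Src functor_Tgt functor_Fo functor_Fa functor_Dom functor_Cod functor_Idn functor_Cmp

lemma
  assumes "nat_trans C D F F' \<eta>"
  shows nat_trans_source: "is_functor C D F" and nat_trans_target: "is_functor C D F'"
    and nat_trans_in: "x \<in> Ob C \<Longrightarrow> \<eta> x \<in> Ar D"
    and nat_trans_ext: "\<eta> \<in> extensional (Ob C)"
    and nat_trans_Dom: "x \<in> Ob C \<Longrightarrow> Dom D (\<eta> x) = Fo F x"
    and nat_trans_Cod: "x \<in> Ob C \<Longrightarrow> Cod D (\<eta> x) = Fo F' x"
    and nat_trans_square: "f \<in> Ar C \<Longrightarrow> Cmp D (\<eta> (Cod C f)) (Fa F f) = Cmp D (Fa F' f) (\<eta> (Dom C f))"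
  using assms by (auto simp: nat_trans_def PiE_def)

lemmas nat_trans_simps = nat_trans_in nat_trans_Dom nat_trans_Cod

lemma nat_trans_Idn:
  assumes F: "is_functor K C F"
  shows "nat_trans K C F F (\<lambda>x\<in>Ob K. Idn C (Fo F x))"
  using functor_source[OF F] functor_target[OF F] F
  by (auto simp: nat_trans_def category_simps functor_simps)

lemma nat_trans_Cmp:
  assumes \<eta>: "nat_trans K C F F' \<eta>" and \<theta>: "nat_trans K C F' F'' \<theta>"
  shows "nat_trans K C F F'' (\<lambda>x\<in>Ob K. Cmp C (\<theta> x) (\<eta> x))"
proof -
  note F = nat_trans_source[OF \<eta>] and F' = nat_trans_target[OF \<eta>] and F'' = nat_trans_target[OF \<theta>]
  note K = functor_source[OF F] and C = functor_target[OF F]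
  have "Cmp C (Cmp C (\<theta> (Cod K f)) (\<eta> (Cod K f))) (Fa F f) =
      Cmp C (Fa F'' f) (Cmp C (\<theta> (Dom K f)) (\<eta> (Dom K f)))" if f: "f \<in> Ar K" for f
  proof -
    have ob: "Dom K f \<in> Ob K" "Cod K f \<in> Ob K" using K f by (simp_all add: category_simps)
    have "Cmp C (Cmp C (\<theta> (Cod K f)) (\<eta> (Cod K f))) (Fa F f) =
        Cmp C (\<theta> (Cod K f)) (Cmp C (\<eta> (Cod K f)) (Fa F f))"
      by (rule category_assoc[OF C, symmetric])
        (use \<eta> \<theta> F f ob in \<open>simp_all add: nat_trans_simps functor_simps\<close>)
    also have "\<dots> = Cmp C (\<theta> (Cod K f)) (Cmp C (Fa F' f) (\<eta> (Dom K f)))"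
      by (simp add: nat_trans_square[OF \<eta> f])
    also have "\<dots> = Cmp C (Cmp C (\<theta> (Cod K f)) (Fa F' f)) (\<eta> (Dom K f))"
      by (rule category_assoc[OF C])
        (use \<eta> \<theta> F' f ob in \<open>simp_all add: nat_trans_simps functor_simps\<close>)
    also have "\<dots> = Cmp C (Cmp C (Fa F'' f) (\<theta> (Dom K f))) (\<eta> (Dom K f))"
      by (simp add: nat_trans_square[OF \<theta> f])
    also have "\<dots> = Cmp C (Fa F'' f) (Cmp C (\<theta> (Dom K f)) (\<eta> (Dom K f)))"
      by (rule category_assoc[OF C, symmetric])
        (use \<eta> \<theta> F'' f ob in \<open>simp_all add: nat_trans_simps functor_simps\<close>)
    finally show ?thesis .
  qed
  then show ?thesis
    unfolding nat_trans_def
    using F F'' \<eta> \<theta> by (auto simp: category_simps[OF K] category_simps[OF C] nat_trans_simps[OF \<eta>] nat_trans_simps[OF \<theta>])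
qed

lemma is_category_fun_cat: "is_category (fun_cat K C)"
proof -
  have id: "(\<lambda>x\<in>Ob K. Cmp C (\<eta> x) ((\<lambda>x\<in>Ob K. Idn C (Fo F x)) x)) = \<eta>"
    "(\<lambda>x\<in>Ob K. Cmp C ((\<lambda>x\<in>Ob K. Idn C (Fo F' x)) x) (\<eta> x)) = \<eta>" if \<eta>: "nat_trans K C F F' \<eta>" for F F' \<eta>
  proof -
    note C = functor_target[OF nat_trans_source[OF \<eta>]]
    show "(\<lambda>x\<in>Ob K. Cmp C (\<eta> x) ((\<lambda>x\<in>Ob K. Idn C (Fo F x)) x)) = \<eta>"
      "(\<lambda>x\<in>Ob K. Cmp C ((\<lambda>x\<in>Ob K. Idn C (Fo F' x)) x) (\<eta> x)) = \<eta>"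
      using nat_trans_ext[OF \<eta>]
      by (auto simp: fun_eq_iff extensional_def category_simps[OF C] nat_trans_simps[OF \<eta>])
  qed
  have assoc: "(\<lambda>x\<in>Ob K. Cmp C (\<zeta> x) ((\<lambda>x\<in>Ob K. Cmp C (\<theta> x) (\<eta> x)) x)) =
      (\<lambda>x\<in>Ob K. Cmp C ((\<lambda>x\<in>Ob K. Cmp C (\<zeta> x) (\<theta> x)) x) (\<eta> x))"
    if \<eta>: "nat_trans K C F F' \<eta>" and \<theta>: "nat_trans K C F' F'' \<theta>" and \<zeta>: "nat_trans K C F'' F''' \<zeta>"
    for F F' F'' F''' \<eta> \<theta> \<zeta>
    using category_assoc[OF functor_target[OF nat_trans_source[OF \<eta>]]]
    by (auto simp: nat_trans_simps[OF \<eta>] nat_trans_simps[OF \<theta>] nat_trans_simps[OF \<zeta>] intro!: restrict_ext)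
  show ?thesis
    unfolding is_category_def
    by (auto simp: fun_cat_def nat_trans_Idn id[simplified] dest: nat_trans_source nat_trans_target
        intro: nat_trans_Cmp) (use assoc[simplified] in blast)
qed

lemma Ob_fun_cat [simp]: "F \<in> Ob (fun_cat K C) \<longleftrightarrow> is_functor K C F"
  and Ar_fun_cat [simp]: "(F, F', \<eta>) \<in> Ar (fun_cat K C) \<longleftrightarrow> nat_trans K C F F' \<eta>"
  and Dom_fun_cat [simp]: "Dom (fun_cat K C) (F, F', \<eta>) = F"
  and Cod_fun_cat [simp]: "Cod (fun_cat K C) (F, F', \<eta>) = F'"
  and Idn_fun_cat: "Idn (fun_cat K C) F = (F, F, \<lambda>x\<in>Ob K. Idn C (Fo F x))"
  and Cmp_fun_cat: "Cmp (fun_cat K C) (F1, F2, \<theta>) (F0, F1', \<eta>) = (F0, F2, \<lambda>x\<in>Ob K. Cmp C (\<theta> x) (\<eta> x))"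
  by (simp_all add: fun_cat_def)

lemma
  shows fcomp_Src: "Src (F' \<circ>\<^sub>F F) = Src F" and fcomp_Tgt: "Tgt (F' \<circ>\<^sub>F F) = Tgt F'"
    and fcomp_Fo: "x \<in> Ob (Src F) \<Longrightarrow> Fo (F' \<circ>\<^sub>F F) x = Fo F' (Fo F x)"
    and fcomp_Fa: "f \<in> Ar (Src F) \<Longrightarrow> Fa (F' \<circ>\<^sub>F F) f = Fa F' (Fa F f)"
  by (simp_all add: fcomp_def)

lemma functor_fcomp:
  assumes F: "is_functor C D F" and F': "is_functor D E F'"
  shows "is_functor C E (F' \<circ>\<^sub>F F)"
  unfolding is_functor_def
proof (intro conjI ballI impI)
  note C = functor_source[OF F]
  note s = functor_simps[OF F] functor_simps[OF F'] category_simps[OF C] fcomp_Fo fcomp_Fa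
  show "is_category C" "is_category E" by (fact C, fact functor_target[OF F'])
  show "Src (F' \<circ>\<^sub>F F) = C" "Tgt (F' \<circ>\<^sub>F F) = E" by (simp_all add: fcomp_Src fcomp_Tgt s)
  show "Fo (F' \<circ>\<^sub>F F) \<in> Ob C \<rightarrow>\<^sub>E Ob E" "Fa (F' \<circ>\<^sub>F F) \<in> Ar C \<rightarrow>\<^sub>E Ar E"
    by (auto simp: fcomp_def s)
qed (simp_all add: functor_simps[OF F] functor_simps[OF F'] category_simps[OF functor_source[OF F]] fcomp_Fo fcomp_Fa)

lemma fcomp_assoc:
  assumes "is_functor C D F" "is_functor D E F'"
  shows "F'' \<circ>\<^sub>F (F' \<circ>\<^sub>F F) = (F'' \<circ>\<^sub>F F') \<circ>\<^sub>F F"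
  using functor_Src[OF assms(1)] functor_Src[OF assms(2)] functor_Fo[OF assms(1)] functor_Fa[OF assms(1)]
  by (auto simp: fcomp_def intro!: restrict_ext)

lemma nat_trans_precomp:
  assumes U: "is_functor K L U" and \<eta>: "nat_trans L C F F' \<eta>"
  shows "nat_trans K C (F \<circ>\<^sub>F U) (F' \<circ>\<^sub>F U) (\<lambda>x\<in>Ob K. \<eta> (Fo U x))"
  unfolding nat_trans_def
proof (intro conjI ballI)
  note F = nat_trans_source[OF \<eta>] and F' = nat_trans_target[OF \<eta>]
  note s = functor_simps[OF U] category_simps[OF functor_source[OF U]] fcomp_Fo fcomp_Fa
    nat_trans_simps[OF \<eta>]
  show "is_functor K C (F \<circ>\<^sub>F U)" "is_functor K C (F' \<circ>\<^sub>F U)"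
    by (rule functor_fcomp[OF U F] functor_fcomp[OF U F'])+
  show "(\<lambda>x\<in>Ob K. \<eta> (Fo U x)) \<in> Ob K \<rightarrow>\<^sub>E Ar C" by (auto simp: s)
  show "Dom C ((\<lambda>x\<in>Ob K. \<eta> (Fo U x)) x) = Fo (F \<circ>\<^sub>F U) x"
    "Cod C ((\<lambda>x\<in>Ob K. \<eta> (Fo U x)) x) = Fo (F' \<circ>\<^sub>F U) x" if "x \<in> Ob K" for x
    using that by (simp_all add: s)
  show "Cmp C ((\<lambda>x\<in>Ob K. \<eta> (Fo U x)) (Cod K f)) (Fa (F \<circ>\<^sub>F U) f) =
      Cmp C (Fa (F' \<circ>\<^sub>F U) f) ((\<lambda>x\<in>Ob K. \<eta> (Fo U x)) (Dom K f))" if "f \<in> Ar K" for f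
    using that nat_trans_square[OF \<eta>, of "Fa U f"] by (simp add: s)
qed

lemma is_functor_precomp:
  assumes U: "is_functor K L U"
  shows "is_functor (fun_cat L C) (fun_cat K C) (precomp C U)"
  unfolding is_functor_def
proof (intro conjI ballI impI is_category_fun_cat)
  note sU = functor_simps[OF U]
  show "Src (precomp C U) = fun_cat L C" "Tgt (precomp C U) = fun_cat K C"
    by (simp_all add: precomp_def sU)
  show "Fo (precomp C U) \<in> Ob (fun_cat L C) \<rightarrow>\<^sub>E Ob (fun_cat K C)"
    by (auto simp: precomp_def sU functor_fcomp[OF U])
  show "Fa (precomp C U) \<in> Ar (fun_cat L C) \<rightarrow>\<^sub>E Ar (fun_cat K C)"
    by (rule PiE_I) (auto simp: precomp_def sU nat_trans_precomp[OF U])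
  show "Dom (fun_cat K C) (Fa (precomp C U) a) = Fo (precomp C U) (Dom (fun_cat L C) a)"
    "Cod (fun_cat K C) (Fa (precomp C U) a) = Fo (precomp C U) (Cod (fun_cat L C) a)"
    if "a \<in> Ar (fun_cat L C)" for a
    using that by (cases a; auto simp: precomp_def sU dest: nat_trans_source nat_trans_target)+
  show "Fa (precomp C U) (Idn (fun_cat L C) F) = Idn (fun_cat K C) (Fo (precomp C U) F)"
    if "F \<in> Ob (fun_cat L C)" for F
    using that by (auto simp: precomp_def sU Idn_fun_cat nat_trans_Idn fcomp_Fo intro!: restrict_ext)
  show "Fa (precomp C U) (Cmp (fun_cat L C) b a) =
      Cmp (fun_cat K C) (Fa (precomp C U) b) (Fa (precomp C U) a)"
    if "a \<in> Ar (fun_cat L C)" "b \<in> Ar (fun_cat L C)" "Dom (fun_cat L C) b = Cod (fun_cat L C) a" for a b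
    using that by (cases a; cases b) (auto simp: precomp_def sU Cmp_fun_cat nat_trans_Cmp intro!: restrict_ext)
qed

lemma Fo_precomp: "is_functor K L U \<Longrightarrow> is_functor L C F \<Longrightarrow> Fo (precomp C U) F = F \<circ>\<^sub>F U"
  by (simp add: precomp_def functor_Tgt)

lemma Fa_precomp:
  "is_functor K L U \<Longrightarrow> nat_trans L C F F' \<eta> \<Longrightarrow>
    Fa (precomp C U) (F, F', \<eta>) = (F \<circ>\<^sub>F U, F' \<circ>\<^sub>F U, \<lambda>x\<in>Ob K. \<eta> (Fo U x))"
  by (simp add: precomp_def functor_Tgt functor_Src)

lemma precomp_fcomp:
  assumes U: "is_functor K L U" and V: "is_functor L M V"
  shows "precomp C (V \<circ>\<^sub>F U) = precomp C U \<circ>\<^sub>F precomp C V"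
proof -
  note s = functor_simps[OF U] functor_simps[OF V] fcomp_Src fcomp_Tgt
  have "Fo (precomp C (V \<circ>\<^sub>F U)) = Fo (precomp C U \<circ>\<^sub>F precomp C V)"
  proof
    fix F
    show "Fo (precomp C (V \<circ>\<^sub>F U)) F = Fo (precomp C U \<circ>\<^sub>F precomp C V) F"
      using fcomp_assoc[OF U V, of F] functor_fcomp[OF V, of C F]
      by (simp add: precomp_def fcomp_def[of "\<lparr>Src = _, Tgt = _, Fo = _, Fa = _\<rparr>"] s)
  qed
  moreover have "Fa (precomp C (V \<circ>\<^sub>F U)) = Fa (precomp C U \<circ>\<^sub>F precomp C V)"
  proof
    fix a
    show "Fa (precomp C (V \<circ>\<^sub>F U)) a = Fa (precomp C U \<circ>\<^sub>F precomp C V) a"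
    proof (cases a rule: prod_cases3)
      case a: (fields F F' \<eta>)
      show ?thesis using fcomp_assoc[OF U V, of F] fcomp_assoc[OF U V, of F'] nat_trans_precomp[OF V, of C F F' \<eta>]
      by (auto simp: a precomp_def fcomp_def[of "\<lparr>Src = _, Tgt = _, Fo = _, Fa = _\<rparr>"] s fcomp_Fo intro!: restrict_ext)
    qed
  qed
  ultimately show ?thesis by (simp add: precomp_def fcomp_def s)
qed

text \<open>The inverses \<open>g x\<close> of the components form a natural transformation: insert \<open>\<eta> x \<circ> g x\<close> on one side of the
  square for \<open>g\<close>, use naturality of \<open>\<eta>\<close>, and cancel \<open>g y \<circ> \<eta> y\<close>.\<close>

lemma nat_iso_imp_is_iso:
  assumes "nat_iso K C F F' \<eta>"
  shows "is_iso (fun_cat K C) (F, F', \<eta>)"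
proof -
  have \<eta>: "nat_trans K C F F' \<eta>" and iso: "\<And>x. x \<in> Ob K \<Longrightarrow> is_iso C (\<eta> x)"
    using assms by (simp_all add: nat_iso_def)
  note F = nat_trans_source[OF \<eta>] and F' = nat_trans_target[OF \<eta>]
  note K = functor_source[OF F] and C = functor_target[OF F]
  note s = functor_simps[OF F] functor_simps[OF F'] category_simps[OF K] nat_trans_simps[OF \<eta>]
  have "\<exists>g. \<forall>x\<in>Ob K. g x \<in> Ar C \<and> Dom C (g x) = Fo F' x \<and> Cod C (g x) = Fo F x \<and>
        Cmp C (g x) (\<eta> x) = Idn C (Fo F x) \<and> Cmp C (\<eta> x) (g x) = Idn C (Fo F' x)"
    by (rule bchoice) (use iso in \<open>auto simp: is_iso_def s\<close>)
  then obtain g where g: "g x \<in> Ar C" "Dom C (g x) = Fo F' x" "Cod C (g x) = Fo F x"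
    "Cmp C (g x) (\<eta> x) = Idn C (Fo F x)" "Cmp C (\<eta> x) (g x) = Idn C (Fo F' x)" if "x \<in> Ob K" for x
    by blast
  define h where "h = (\<lambda>x\<in>Ob K. g x)"
  have h: "h x = g x" if "x \<in> Ob K" for x using that by (simp add: h_def)
  have square: "Cmp C (g (Cod K f)) (Fa F' f) = Cmp C (Fa F f) (g (Dom K f))" if f: "f \<in> Ar K" for f
  proof -
    let ?x = "Dom K f" and ?y = "Cod K f"
    have ob: "?x \<in> Ob K" "?y \<in> Ob K" using f by (simp_all add: s)
    note [simp] = f ob s g
    have "Cmp C (g ?y) (Fa F' f) = Cmp C (g ?y) (Cmp C (Fa F' f) (Cmp C (\<eta> ?x) (g ?x)))"
      by (simp add: category_simps[OF C])
    also have "Cmp C (Fa F' f) (Cmp C (\<eta> ?x) (g ?x)) = Cmp C (Cmp C (Fa F' f) (\<eta> ?x)) (g ?x)"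
      by (rule category_assoc[OF C]) simp_all
    also have "Cmp C (Fa F' f) (\<eta> ?x) = Cmp C (\<eta> ?y) (Fa F f)"
      by (rule nat_trans_square[OF \<eta> f, symmetric])
    also have "Cmp C (Cmp C (\<eta> ?y) (Fa F f)) (g ?x) = Cmp C (\<eta> ?y) (Cmp C (Fa F f) (g ?x))"
      by (rule category_assoc[OF C, symmetric]) simp_all
    also have "Cmp C (g ?y) (Cmp C (\<eta> ?y) (Cmp C (Fa F f) (g ?x))) =
        Cmp C (Cmp C (g ?y) (\<eta> ?y)) (Cmp C (Fa F f) (g ?x))"
      by (rule category_assoc[OF C]) (simp_all add: category_simps[OF C])
    also have "\<dots> = Cmp C (Fa F f) (g ?x)" by (simp add: category_simps[OF C])
    finally show ?thesis .
  qed
  have nt: "nat_trans K C F' F h"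
    unfolding nat_trans_def by (auto simp: F F' h_def g s square)
  show ?thesis
    unfolding is_iso_def
  proof (intro conjI bexI[of _ "(F', F, h)"])
    show "(F, F', \<eta>) \<in> Ar (fun_cat K C)" "(F', F, h) \<in> Ar (fun_cat K C)" using \<eta> nt by simp_all
    show "Cmp (fun_cat K C) (F', F, h) (F, F', \<eta>) = Idn (fun_cat K C) (Dom (fun_cat K C) (F, F', \<eta>))"
      "Cmp (fun_cat K C) (F, F', \<eta>) (F', F, h) = Idn (fun_cat K C) (Cod (fun_cat K C) (F, F', \<eta>))"
      by (auto simp: Cmp_fun_cat Idn_fun_cat h g intro!: restrict_ext)
  qed simp_all
qed

lemma nat_iso_precomp:
  assumes W: "is_functor B C W" and \<eta>: "nat_iso C D F F' \<eta>"
  shows "nat_iso B D (F \<circ>\<^sub>F W) (F' \<circ>\<^sub>F W) (\<lambda>x\<in>Ob B. \<eta> (Fo W x))"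
  using \<eta> functor_Fo[OF W] by (simp add: nat_iso_def nat_trans_precomp[OF W])

section \<open>Smash products over a permuted index set\<close>

text \<open>The common form of \<open>p_smash\<close> and \<open>n_smash\<close>: the monoid \<open>M\<close> permutes the finite set \<open>A\<close> through \<open>\<phi>\<close>, and
  \<open>k g x\<close> is an arrow of \<open>K\<close> from \<open>ob x\<close> to \<open>ob (\<phi> g x)\<close> along which \<open>g\<close> moves the factor at \<open>x\<close>.\<close>

definition smash_over_ob where
  "smash_over_ob A M ob \<phi> k X =
     \<lparr>Src = group_cat M, Tgt = (Spectra :: ('a smash_pt spectrum, 'a smash_pt spmor) category),
      Fo = (\<lambda>_. Smash A (\<lambda>x. Fo X (ob x))),
      Fa = (\<lambda>m\<in>carrier M. Smash_map A A (\<phi> m) (\<lambda>x. Fo X (ob x)) (\<lambda>x. Fo X (ob x))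
              (\<lambda>x. underlying (Fa X (k m x))))\<rparr>"

definition smash_over where
  "smash_over A K M ob \<phi> k =
     (let B = fun_cat K (Spectra :: ('a spectrum, 'a spmor) category); P = smash_over_ob A M ob \<phi> k
      in \<lparr>Src = B, Tgt = fun_cat (group_cat M) (Spectra :: ('a smash_pt spectrum, 'a smash_pt spmor) category),
          Fo = restrict P (Ob B),
          Fa = (\<lambda>(X, Y, f)\<in>Ar B. (P X, P Y,
                  \<lambda>_. Smash_map A A (\<lambda>x. x) (\<lambda>x. Fo X (ob x)) (\<lambda>x. Fo Y (ob x))
                        (\<lambda>x. underlying (f (ob x)))))\<rparr>)"

lemma is_category_monoid: "Group.monoid M \<Longrightarrow> is_category (group_cat M)"
  unfolding is_category_def group_cat_def
  by (simp add: monoid.m_closed monoid.one_closed monoid.l_one monoid.r_one monoid.m_assoc)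

text \<open>The conditions on \<open>\<phi>\<close> and \<open>k\<close> say that \<open>M\<close> acts on \<open>A\<close> and that \<open>x \<mapsto> ob x\<close> and \<open>(g, x) \<mapsto> k g x\<close> form a
  functor to \<open>K\<close> from the translation category of this action; this is what makes the smash product over \<open>A\<close> a functor on \<open>M\<close>.\<close>

locale indexed_action =
  fixes A :: "'i set" and K :: "('o, 'm) category" and M :: "('g, 'b) monoid_scheme"
    and ob :: "'i \<Rightarrow> 'o" and \<phi> :: "'g \<Rightarrow> 'i \<Rightarrow> 'i" and k :: "'g \<Rightarrow> 'i \<Rightarrow> 'm"
  assumes finite: "finite A" and K: "is_category K" and M: "Group.monoid M"
    and ob: "x \<in> A \<Longrightarrow> ob x \<in> Ob K"
    and bij: "g \<in> carrier M \<Longrightarrow> bij_betw (\<phi> g) A A"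
    and arrow: "g \<in> carrier M \<Longrightarrow> x \<in> A \<Longrightarrow> k g x \<in> Ar K \<and> Dom K (k g x) = ob x \<and> Cod K (k g x) = ob (\<phi> g x)"
    and one: "x \<in> A \<Longrightarrow> \<phi> \<one>\<^bsub>M\<^esub> x = x \<and> k \<one>\<^bsub>M\<^esub> x = Idn K (ob x)"
    and mult: "g \<in> carrier M \<Longrightarrow> g' \<in> carrier M \<Longrightarrow> x \<in> A \<Longrightarrow>
      \<phi> (g' \<otimes>\<^bsub>M\<^esub> g) x = \<phi> g' (\<phi> g x) \<and> k (g' \<otimes>\<^bsub>M\<^esub> g) x = Cmp K (k g' (\<phi> g x)) (k g x)"
begin

abbreviation P where "P \<equiv> smash_over_ob A M ob \<phi> k"

abbreviation factors where "factors X \<equiv> \<lambda>x. Fo X (ob x)"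

abbreviation act_map where
  "act_map X g \<equiv> Smash_map A A (\<phi> g) (factors X) (factors X) (\<lambda>x. underlying (Fa X (k g x)))"

abbreviation trans_map where
  "trans_map X Y f \<equiv> Smash_map A A (\<lambda>x. x) (factors X) (factors Y) (\<lambda>x. underlying (f (ob x)))"

lemma \<phi>_in: "g \<in> carrier M \<Longrightarrow> x \<in> A \<Longrightarrow> \<phi> g x \<in> A"
  using bij by (auto simp: bij_betw_def)

lemma bij_id: "bij_betw (\<lambda>x. x) A A" by (simp add: bij_betw_def)

lemma functor_arrow:
  assumes "is_functor K Spectra X" "g \<in> carrier M" "x \<in> A"
  shows "Fa X (k g x) \<in> Ar Spectra \<and> Dom Spectra (Fa X (k g x)) = Fo X (ob x) \<and>
    Cod Spectra (Fa X (k g x)) = Fo X (ob (\<phi> g x))"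
  using functor_simps[OF assms(1)] arrow[OF assms(2,3)] by simp

lemma is_functor_smash_over_ob:
  assumes X: "is_functor K (Spectra :: ('a spectrum, 'a spmor) category) X"
  shows "is_functor (group_cat M) Spectra (P X)"
proof -
  have 1: "Smash A (factors X) \<in> Ob Spectra"
    by (rule Smash_in[OF finite]) (use X ob in \<open>simp add: functor_simps\<close>)
  have arr: "act_map X g \<in> Ar Spectra"
    "Dom Spectra (act_map X g) =
      Smash A (factors X)"
    "Cod Spectra (act_map X g) =
      Smash A (factors X)" if "g \<in> carrier M" for g
    by (rule Smash_map_arrow; use that finite bij functor_arrow[OF X] in auto)+
  have 2: "act_map X \<one>\<^bsub>M\<^esub> =
      Idn Spectra (Smash A (factors X))"
  proof -
    have "act_map X \<one>\<^bsub>M\<^esub> =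
        Smash_map A A (\<lambda>x. x) (factors X) (factors X)
          (\<lambda>x. underlying (Idn Spectra (Fo X (ob x))))"
      by (rule Smash_map_cong[OF finite bij[OF monoid.one_closed[OF M]]])
        (use one ob in \<open>simp_all add: functor_Idn[OF X] del: underlying_Idn\<close>)
    also have "\<dots> = Idn Spectra (Smash A (factors X))"
      by (rule Smash_map_Idn[OF finite]) (use ob in \<open>simp add: functor_Fo[OF X]\<close>)
    finally show ?thesis .
  qed
  have 3: "act_map X (g' \<otimes>\<^bsub>M\<^esub> g) =
      Cmp Spectra
        (act_map X g')
        (act_map X g)"
    if g: "g \<in> carrier M" "g' \<in> carrier M" for g g'
  proof -
    have "Cmp Spectra
        (act_map X g')
        (act_map X g) =
      Smash_map A A (\<lambda>x. \<phi> g' (\<phi> g x)) (factors X) (factors X)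
        (\<lambda>x. underlying (Cmp Spectra (Fa X (k g' (\<phi> g x))) (Fa X (k g x))))"
      by (rule Smash_map_compose) (use g finite bij functor_arrow[OF X] in auto)
    also have "\<dots> = act_map X (g' \<otimes>\<^bsub>M\<^esub> g)"
    proof (rule Smash_map_cong[OF finite, symmetric])
      show "bij_betw (\<phi> (g' \<otimes>\<^bsub>M\<^esub> g)) A A" using bij monoid.m_closed[OF M] g by simp
      fix x assume x: "x \<in> A"
      show "\<phi> (g' \<otimes>\<^bsub>M\<^esub> g) x = \<phi> g' (\<phi> g x)" using mult g x by blast
      have "Fa X (k (g' \<otimes>\<^bsub>M\<^esub> g) x) = Cmp Spectra (Fa X (k g' (\<phi> g x))) (Fa X (k g x))"
        using mult[OF g x] functor_Cmp[OF X, of "k g x" "k g' (\<phi> g x)"] arrow[OF g(1) x]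
          arrow[OF g(2) \<phi>_in[OF g(1) x]] by simp
      then show "underlying (Fa X (k (g' \<otimes>\<^bsub>M\<^esub> g) x)) =
          underlying (Cmp Spectra (Fa X (k g' (\<phi> g x))) (Fa X (k g x)))" by simp
    qed
    finally show ?thesis ..
  qed
  show ?thesis
    unfolding is_functor_def
  proof (intro conjI ballI impI is_category_Spectra is_category_monoid[OF M])
    show "Fo (P X) \<in> Ob (group_cat M) \<rightarrow>\<^sub>E Ob Spectra"
      by (rule PiE_I) (simp_all add: smash_over_ob_def group_cat_def 1)
    show "Fa (P X) \<in> Ar (group_cat M) \<rightarrow>\<^sub>E Ar Spectra"
      by (rule PiE_I) (simp_all add: smash_over_ob_def group_cat_def arr)
  qed (simp_all add: smash_over_ob_def group_cat_def arr 2 3 monoid.one_closed[OF M] monoid.m_closed[OF M])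
qed

lemma nat_trans_arrow:
  assumes "nat_trans K Spectra X Y f" "x \<in> A"
  shows "f (ob x) \<in> Ar Spectra \<and> Dom Spectra (f (ob x)) = Fo X (ob x) \<and> Cod Spectra (f (ob x)) = Fo Y (ob x)"
  using nat_trans_simps[OF assms(1)] ob[OF assms(2)] by simp

lemma nat_trans_smash_over:
  assumes f: "nat_trans K (Spectra :: ('a spectrum, 'a spmor) category) X Y f"
  shows "nat_trans (group_cat M) Spectra (P X) (P Y)
    (\<lambda>_. trans_map X Y f)"
proof -
  note X = nat_trans_source[OF f] and Y = nat_trans_target[OF f]
  have arr: "trans_map X Y f \<in> Ar Spectra"
    "Dom Spectra (trans_map X Y f) =
      Smash A (factors X)"
    "Cod Spectra (trans_map X Y f) =
      Smash A (factors Y)"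
    by (rule Smash_map_arrow; use finite bij_id nat_trans_arrow[OF f] in auto)+
  have sq: "Cmp Spectra
      (trans_map X Y f)
      (act_map X g) =
    Cmp Spectra
      (act_map Y g)
      (trans_map X Y f)"
    (is "?l = ?r") if g: "g \<in> carrier M" for g
  proof -
    have "?l = Smash_map A A (\<phi> g) (factors X) (factors Y)
        (\<lambda>x. underlying (Cmp Spectra (f (ob (\<phi> g x))) (Fa X (k g x))))"
      by (rule Smash_map_compose) (use finite bij[OF g] bij_id functor_arrow[OF X g] nat_trans_arrow[OF f] \<phi>_in[OF g] in auto)
    also have "\<dots> = Smash_map A A (\<phi> g) (factors X) (factors Y)
        (\<lambda>x. underlying (Cmp Spectra (Fa Y (k g x)) (f (ob x))))"
    proof (rule Smash_map_cong[OF finite])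
      fix x assume "x \<in> A"
      then show "underlying (Cmp Spectra (f (ob (\<phi> g x))) (Fa X (k g x))) =
          underlying (Cmp Spectra (Fa Y (k g x)) (f (ob x)))"
        using nat_trans_square[OF f, of "k g x"] arrow[OF g] by simp
    qed (use bij[OF g] in simp_all)
    also have "\<dots> = ?r"
      by (rule Smash_map_compose[symmetric]) (use finite bij[OF g] bij_id nat_trans_arrow[OF f] functor_arrow[OF Y g] in auto)
    finally show ?thesis .
  qed
  show ?thesis
    unfolding nat_trans_def
    by (intro conjI ballI is_functor_smash_over_ob[OF X] is_functor_smash_over_ob[OF Y] PiE_I)
      (simp_all add: arr smash_over_ob_def group_cat_def sq)
qed

lemma Fo_smash_over:
  "is_functor K Spectra X \<Longrightarrow> Fo (smash_over A K M ob \<phi> k) X = P X"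
  by (simp add: smash_over_def Let_def)

lemma Fa_smash_over:
  "nat_trans K Spectra X Y f \<Longrightarrow> Fa (smash_over A K M ob \<phi> k) (X, Y, f) = (P X, P Y,
      \<lambda>_. trans_map X Y f)"
  by (simp add: smash_over_def Let_def)

lemma is_functor_smash_over:
  "is_functor (fun_cat K (Spectra :: ('a spectrum, 'a spmor) category)) (fun_cat (group_cat M) Spectra)
    (smash_over A K M ob \<phi> k)"
  unfolding is_functor_def
proof (intro conjI ballI impI is_category_fun_cat)
  let ?B = "fun_cat K (Spectra :: ('a spectrum, 'a spmor) category)" and ?S = "smash_over A K M ob \<phi> k"
  let ?C = "fun_cat (group_cat M) (Spectra :: ('a smash_pt spectrum, 'a smash_pt spmor) category)"
  show "Src ?S = ?B" "Tgt ?S = ?C" by (simp_all add: smash_over_def Let_def)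
  show "Fo ?S \<in> Ob ?B \<rightarrow>\<^sub>E Ob ?C"
    by (rule PiE_I) (simp_all add: smash_over_def Let_def is_functor_smash_over_ob)
  show "Fa ?S \<in> Ar ?B \<rightarrow>\<^sub>E Ar ?C"
  proof (rule PiE_I)
    fix a assume "a \<in> Ar ?B"
    then show "Fa ?S a \<in> Ar ?C" by (cases a) (simp add: Fa_smash_over nat_trans_smash_over)
  qed (simp add: smash_over_def Let_def)
  fix a assume a: "a \<in> Ar ?B"
  then show "Dom ?C (Fa ?S a) = Fo ?S (Dom ?B a)" "Cod ?C (Fa ?S a) = Fo ?S (Cod ?B a)"
    by (cases a; simp add: Fa_smash_over Fo_smash_over nat_trans_source nat_trans_target)+
next
  let ?B = "fun_cat K (Spectra :: ('a spectrum, 'a spmor) category)" and ?S = "smash_over A K M ob \<phi> k"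
  let ?C = "fun_cat (group_cat M) (Spectra :: ('a smash_pt spectrum, 'a smash_pt spmor) category)"
  fix X assume "X \<in> Ob ?B"
  then have X: "is_functor K Spectra X" by simp
  have "Smash_map A A (\<lambda>x. x) (factors X) (factors X)
      (\<lambda>x. underlying ((\<lambda>x\<in>Ob K. Idn Spectra (Fo X x)) (ob x))) =
    Smash_map A A (\<lambda>x. x) (factors X) (factors X)
      (\<lambda>x. underlying (Idn Spectra (Fo X (ob x))))"
    by (rule Smash_map_cong[OF finite bij_id]) (simp_all add: ob)
  also have "\<dots> = Idn Spectra (Smash A (factors X))"
    by (rule Smash_map_Idn[OF finite]) (simp add: ob functor_Fo[OF X])
  finally show "Fa ?S (Idn ?B X) = Idn ?C (Fo ?S X)"
    unfolding Idn_fun_cat Fa_smash_over[OF nat_trans_Idn[OF X]] Fo_smash_over[OF X]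
    by (simp add: smash_over_ob_def group_cat_def fun_eq_iff)
next
  let ?B = "fun_cat K (Spectra :: ('a spectrum, 'a spmor) category)" and ?S = "smash_over A K M ob \<phi> k"
  let ?C = "fun_cat (group_cat M) (Spectra :: ('a smash_pt spectrum, 'a smash_pt spmor) category)"
  fix a b assume ab: "a \<in> Ar ?B" "b \<in> Ar ?B" "Dom ?B b = Cod ?B a"
  obtain X Y f where a: "a = (X, Y, f)" by (cases a)
  obtain Z g where b: "b = (Y, Z, g)" using ab(3) a by (cases b) auto
  have f: "nat_trans K Spectra X Y f" and g: "nat_trans K Spectra Y Z g" using ab a b by simp_all
  have "Cmp Spectra
      (trans_map Y Z g)
      (trans_map X Y f) =
    Smash_map A A (\<lambda>x. x) (factors X) (factors Z)
      (\<lambda>x. underlying (Cmp Spectra (g (ob x)) (f (ob x))))"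
    by (rule Smash_map_compose) (use finite bij_id nat_trans_arrow[OF f] nat_trans_arrow[OF g] in auto)
  also have "\<dots> = Smash_map A A (\<lambda>x. x) (factors X) (factors Z)
      (\<lambda>x. underlying ((\<lambda>x\<in>Ob K. Cmp Spectra (g x) (f x)) (ob x)))"
    by (rule Smash_map_cong[OF finite bij_id]) (simp_all add: ob)
  finally show "Fa ?S (Cmp ?B b a) = Cmp ?C (Fa ?S b) (Fa ?S a)"
    unfolding a b Cmp_fun_cat Fa_smash_over[OF f] Fa_smash_over[OF g] Fa_smash_over[OF nat_trans_Cmp[OF f g]]
    by (simp add: group_cat_def fun_eq_iff)
qed

end

section \<open>The norm diagram of a transversal\<close>

text \<open>Reindexing along a bijection is inverted by reindexing along the inverse bijection.\<close>

lemma Smash_map_Idn_iso: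
  assumes A: "finite A" and \<phi>: "bij_betw \<phi> A B"
    and X: "\<And>x. x \<in> A \<Longrightarrow> X x \<in> Ob Spectra" and Y: "\<And>x. x \<in> A \<Longrightarrow> Y (\<phi> x) = X x"
  shows "is_iso Spectra (Smash_map A B \<phi> X Y (\<lambda>x. spectrum_id (X x)))"
proof -
  let ?\<psi> = "inv_into A \<phi>"
  let ?R = "Smash_map A B \<phi> X Y (\<lambda>x. underlying (Idn Spectra (X x)))"
  let ?S = "Smash_map B A ?\<psi> Y X (\<lambda>y. underlying (Idn Spectra (Y y)))"
  have B: "finite B" using A \<phi> by (simp add: bij_betw_finite)
  have \<psi>: "bij_betw ?\<psi> B A" using \<phi> by (rule bij_betw_inv_into)
  have \<psi>A: "?\<psi> y \<in> A" and \<phi>\<psi>: "\<phi> (?\<psi> y) = y" if "y \<in> B" for y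
    using \<psi> bij_betw_inv_into_right[OF \<phi> that] that by (auto simp: bij_betw_def)
  have \<psi>\<phi>: "?\<psi> (\<phi> x) = x" if "x \<in> A" for x using bij_betw_inv_into_left[OF \<phi> that] .
  have YX: "Y y = X (?\<psi> y)" if "y \<in> B" for y using Y[OF \<psi>A[OF that]] \<phi>\<psi>[OF that] by simp
  note c = category_simps[OF is_category_Spectra]
  have R: "\<forall>x\<in>A. Idn Spectra (X x) \<in> Ar Spectra \<and> Dom Spectra (Idn Spectra (X x)) = X x \<and>
      Cod Spectra (Idn Spectra (X x)) = Y (\<phi> x)"
    using X Y by (simp add: c)
  have S: "\<forall>y\<in>B. Idn Spectra (Y y) \<in> Ar Spectra \<and> Dom Spectra (Idn Spectra (Y y)) = Y y \<and>
      Cod Spectra (Idn Spectra (Y y)) = X (?\<psi> y)"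
    using X \<psi>A YX by (simp add: c)
  have arrow: "?R \<in> Ar Spectra" "Dom Spectra ?R = Smash A X" "Cod Spectra ?R = Smash B Y"
    by (rule Smash_map_arrow; use A \<phi> R in auto)+
  have arrow': "?S \<in> Ar Spectra" "Dom Spectra ?S = Smash B Y" "Cod Spectra ?S = Smash A X"
    by (rule Smash_map_arrow; use B \<psi> S in auto)+
  have "Cmp Spectra ?S ?R = Smash_map A A (\<lambda>x. ?\<psi> (\<phi> x)) X X
      (\<lambda>x. underlying (Cmp Spectra (Idn Spectra (Y (\<phi> x))) (Idn Spectra (X x))))"
    by (rule Smash_map_compose) (use A \<phi> \<psi> R S in auto)
  also have "\<dots> = Smash_map A A (\<lambda>x. x) X X (\<lambda>x. underlying (Idn Spectra (X x)))"
    by (rule Smash_map_cong[OF A bij_betw_trans[OF \<phi> \<psi>, unfolded o_def]])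
      (simp_all add: \<psi>\<phi> Y X c del: underlying_Idn)
  also have "\<dots> = Idn Spectra (Smash A X)" by (rule Smash_map_Idn[OF A X])
  finally have SR: "Cmp Spectra ?S ?R = Idn Spectra (Dom Spectra ?R)" by (simp only: arrow(2))
  have "Cmp Spectra ?R ?S = Smash_map B B (\<lambda>y. \<phi> (?\<psi> y)) Y Y
      (\<lambda>y. underlying (Cmp Spectra (Idn Spectra (X (?\<psi> y))) (Idn Spectra (Y y))))"
    by (rule Smash_map_compose) (use B \<phi> \<psi> R S in auto)
  also have "\<dots> = Smash_map B B (\<lambda>y. y) Y Y (\<lambda>y. underlying (Idn Spectra (Y y)))"
    by (rule Smash_map_cong[OF B bij_betw_trans[OF \<psi> \<phi>, unfolded o_def]])
      (simp_all add: \<phi>\<psi> YX X \<psi>A c del: underlying_Idn)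
  also have "\<dots> = Idn Spectra (Smash B Y)"
    by (rule Smash_map_Idn[OF B]) (simp add: YX X \<psi>A)
  finally have RS: "Cmp Spectra ?R ?S = Idn Spectra (Cod Spectra ?R)" by (simp only: arrow(3))
  have "is_iso Spectra ?R"
    unfolding is_iso_def using arrow arrow' SR RS by (intro conjI bexI[of _ ?S]) simp_all
  then show ?thesis by simp
qed

lemma monoid_wreath:
  assumes "group G" "subgroup H G"
  shows "Group.monoid (wreath G H n)"
proof -
  interpret group G by fact
  interpret subgroup H G by fact
  have perm: "\<tau> i \<in> {1..n}" if "\<tau> permutes {1..n}" "i \<in> {1..n}" for \<tau> i
    using permutes_in_image[OF that(1)] that(2) by simp
  show ?thesis
  proof
    fix x y assume "x \<in> carrier (wreath G H n)" "y \<in> carrier (wreath G H n)"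
    then show "x \<otimes>\<^bsub>wreath G H n\<^esub> y \<in> carrier (wreath G H n)"
      using perm by (auto simp: wreath_def permutes_compose PiE_def Pi_def simp del: atLeastAtMost_iff One_nat_def)
  next
    fix x y z
    assume "x \<in> carrier (wreath G H n)" "y \<in> carrier (wreath G H n)" "z \<in> carrier (wreath G H n)"
    then show "x \<otimes>\<^bsub>wreath G H n\<^esub> y \<otimes>\<^bsub>wreath G H n\<^esub> z = x \<otimes>\<^bsub>wreath G H n\<^esub> (y \<otimes>\<^bsub>wreath G H n\<^esub> z)"
      using perm by (auto simp: wreath_def o_assoc PiE_def Pi_def m_assoc simp del: atLeastAtMost_iff One_nat_def intro!: restrict_ext)
  next
    fix x assume "x \<in> carrier (wreath G H n)"
    then show "\<one>\<^bsub>wreath G H n\<^esub> \<otimes>\<^bsub>wreath G H n\<^esub> x = x" "x \<otimes>\<^bsub>wreath G H n\<^esub> \<one>\<^bsub>wreath G H n\<^esub> = x"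
      using perm
      by (auto simp: wreath_def PiE_def Pi_def extensional_def fun_eq_iff simp del: atLeastAtMost_iff One_nat_def)
  qed (auto simp: wreath_def permutes_id)
qed

context
  fixes G :: "('g, 'b) monoid_scheme" and H n t
  assumes G: "group G" and H: "subgroup H G" and tr: "transversal G H n t"
begin

interpretation group G by (rule G)
interpretation sub: subgroup H G by (rule H)

lemmas T = G H tr

lemma is_category_index_cat: "is_category (index_cat G H n)"
proof -
  have perm: "\<tau> i \<in> {1..n}" if "\<tau> permutes {1..n}" "i \<in> {1..n}" for \<tau> i
    using permutes_in_image[OF that(1)] that(2) by simp
  show ?thesis
    unfolding is_category_def index_cat_def prod_cat_def index_groupoid_def translation_groupoid_def
      group_cat_def sym_group_def
    using perm by (auto simp: permutes_compose permutes_id o_assoc m_assoc simp del: atLeastAtMost_iff One_nat_def)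
qed

lemma is_functor_snd: "is_functor (index_cat G H n) (subgroup_cat G H) (snd_fctr (index_groupoid n) (subgroup_cat G H))"
  unfolding is_functor_def
proof (intro conjI is_category_index_cat is_category_subgroup_cat[OF T])
  show "Src (snd_fctr (index_groupoid n) (subgroup_cat G H)) = index_cat G H n"
    by (simp add: snd_fctr_def index_cat_def)
qed (use is_category_index_cat in \<open>auto simp: snd_fctr_def index_cat_def prod_cat_def is_category_def\<close>)

lemma tr_index_in: "x \<in> lcosets\<^bsub>G\<^esub> H \<Longrightarrow> tr_index G H n t x \<in> {1..n}"
  using tr_cases[OF T] tr_index_eq[OF T] by metis

lemma tr_index_right: "x \<in> lcosets\<^bsub>G\<^esub> H \<Longrightarrow> t (tr_index G H n t x) <#\<^bsub>G\<^esub> H = x"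
  using tr_cases[OF T] tr_index_eq[OF T] by metis

lemma tr_index_shift:
  assumes "g \<in> carrier G" "x \<in> lcosets\<^bsub>G\<^esub> H"
  shows "tr_index G H n t (g <#\<^bsub>G\<^esub> x) = tr_sigma G H n t g (tr_index G H n t x)"
  using tr_shift[OF T assms(1) tr_index_in[OF assms(2)]] tr_index_right[OF assms(2)]
    tr_index_eq[OF T tr_decomp(1)[OF T assms(1) tr_index_in[OF assms(2)]]] by simp

lemma tr_sigma_one: "tr_sigma G H n t \<one>\<^bsub>G\<^esub> = id"
  using tr_one(1)[OF T] by (auto simp: fun_eq_iff tr_sigma_def)

lemma tr_sigma_mult:
  assumes "g \<in> carrier G" "g' \<in> carrier G"
  shows "tr_sigma G H n t (g' \<otimes>\<^bsub>G\<^esub> g) = tr_sigma G H n t g' \<circ> tr_sigma G H n t g"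
proof
  fix i
  show "tr_sigma G H n t (g' \<otimes>\<^bsub>G\<^esub> g) i = (tr_sigma G H n t g' \<circ> tr_sigma G H n t g) i"
  proof (cases "i \<in> {1..n}")
    case True
    then show ?thesis using tr_mult(1)[OF T assms True] by simp
  next
    case False
    then show ?thesis by (simp add: tr_sigma_def del: atLeastAtMost_iff One_nat_def)
  qed
qed

lemma is_functor_beta: "is_functor (coset_groupoid G H) (index_cat G H n) (beta G H n t)"
  unfolding is_functor_def
proof (intro conjI is_category_index_cat is_category_coset_groupoid[OF T])
  show "Fo (beta G H n t) \<in> Ob (coset_groupoid G H) \<rightarrow>\<^sub>E Ob (index_cat G H n)"
    by (rule PiE_I) (simp_all add: beta_def coset_groupoid_def translation_groupoid_def index_cat_def
        prod_cat_def index_groupoid_def group_cat_def tr_index_in del: atLeastAtMost_iff One_nat_def)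
  show "Fa (beta G H n t) \<in> Ar (coset_groupoid G H) \<rightarrow>\<^sub>E Ar (index_cat G H n)"
    by (rule PiE_I) (auto simp: beta_def coset_groupoid_def translation_groupoid_def index_cat_def
        prod_cat_def index_groupoid_def group_cat_def sym_group_def tr_index_in tr_decomp(2)[OF T]
        tr_sigma_permutes[OF T] simp del: atLeastAtMost_iff One_nat_def)
qed (simp_all add: beta_def coset_groupoid_def translation_groupoid_def index_cat_def
        prod_cat_def index_groupoid_def group_cat_def sym_group_def tr_index_in tr_decomp[OF T]
        tr_sigma_permutes[OF T] tr_index_shift tr_sigma_one tr_sigma_mult tr_one(2)[OF T] tr_mult(2)[OF T]
        coset_action[OF T] del: atLeastAtMost_iff One_nat_def)

lemma is_functor_alpha: "is_functor (group_cat G) (group_cat (wreath G H n)) (alpha G H n t)"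
  unfolding is_functor_def
proof (intro conjI is_category_group_cat[OF T G] is_category_monoid[OF monoid_wreath[OF G H]])
  show "Fo (alpha G H n t) \<in> Ob (group_cat G) \<rightarrow>\<^sub>E Ob (group_cat (wreath G H n))"
    by (rule PiE_I) (simp_all add: alpha_def group_cat_def)
  show "Fa (alpha G H n t) \<in> Ar (group_cat G) \<rightarrow>\<^sub>E Ar (group_cat (wreath G H n))"
    by (rule PiE_I) (auto simp: alpha_def group_cat_def wreath_def tr_decomp(2)[OF T]
        tr_sigma_permutes[OF T] simp del: atLeastAtMost_iff One_nat_def)
qed (auto simp: alpha_def group_cat_def wreath_def tr_sigma_one tr_sigma_mult tr_one(2)[OF T] tr_mult(2)[OF T]
      tr_decomp(1)[OF T] simp del: atLeastAtMost_iff One_nat_def intro!: restrict_ext)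

lemma bij_coset_action:
  assumes g: "g \<in> carrier G"
  shows "bij_betw (\<lambda>x. g <#\<^bsub>G\<^esub> x) (lcosets\<^bsub>G\<^esub> H) (lcosets\<^bsub>G\<^esub> H)"
proof -
  have cancel: "inv\<^bsub>G\<^esub> a <#\<^bsub>G\<^esub> (a <#\<^bsub>G\<^esub> x) = x" if a: "a \<in> carrier G" and x: "x \<in> lcosets\<^bsub>G\<^esub> H" for a x
  proof -
    obtain b where b: "b \<in> carrier G" "x = b <#\<^bsub>G\<^esub> H" using x by (auto simp: LCOSETS_def)
    have "inv\<^bsub>G\<^esub> a \<otimes>\<^bsub>G\<^esub> (a \<otimes>\<^bsub>G\<^esub> b) = b" using a b(1) by (simp add: m_assoc[symmetric])
    then show ?thesis using a b by (simp add: lcosets_shift[OF G H])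
  qed
  have i: "inv\<^bsub>G\<^esub> g \<in> carrier G" using g by simp
  show ?thesis
    by (rule bij_betw_byWitness[where f' = "\<lambda>x. inv\<^bsub>G\<^esub> g <#\<^bsub>G\<^esub> x"])
      (use cancel[OF g] cancel[OF i] g i in \<open>auto simp: coset_action[OF T]\<close>)
qed

lemma bij_transversal: "bij_betw (\<lambda>i. t i <#\<^bsub>G\<^esub> H) {1..n} (lcosets\<^bsub>G\<^esub> H)"
  using tr by (simp add: transversal_def)

lemma finite_lcosets: "finite (lcosets\<^bsub>G\<^esub> H)"
  using bij_betw_finite[OF bij_transversal] by simp

lemma indexed_action_cosets:
  "indexed_action (lcosets\<^bsub>G\<^esub> H) (coset_groupoid G H) G (\<lambda>x. x) (\<lambda>g x. g <#\<^bsub>G\<^esub> x) (\<lambda>g x. (g, x))"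
proof (rule indexed_action.intro)
  show "Group.monoid G" by (rule is_monoid)
  show "finite (lcosets\<^bsub>G\<^esub> H)" by (rule finite_lcosets)
  show "is_category (coset_groupoid G H)" by (rule is_category_coset_groupoid[OF T])
  show "bij_betw (\<lambda>x. g <#\<^bsub>G\<^esub> x) (lcosets\<^bsub>G\<^esub> H) (lcosets\<^bsub>G\<^esub> H)" if "g \<in> carrier G" for g
    using that by (rule bij_coset_action)
  have C: "is_category (coset_groupoid G H)" by (rule is_category_coset_groupoid[OF T])
  have "\<one>\<^bsub>G\<^esub> <#\<^bsub>G\<^esub> x = x" if "x \<in> lcosets\<^bsub>G\<^esub> H" for x
    using category_Cod_Idn[OF C, of x] that by (simp add: coset_groupoid_def translation_groupoid_def)
  then show "\<one>\<^bsub>G\<^esub> <#\<^bsub>G\<^esub> x = x \<and> (\<one>\<^bsub>G\<^esub>, x) = Idn (coset_groupoid G H) x" if "x \<in> lcosets\<^bsub>G\<^esub> H" for x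
    using that by (simp add: coset_groupoid_def translation_groupoid_def)
  show "(g' \<otimes>\<^bsub>G\<^esub> g) <#\<^bsub>G\<^esub> x = g' <#\<^bsub>G\<^esub> (g <#\<^bsub>G\<^esub> x) \<and>
      (g' \<otimes>\<^bsub>G\<^esub> g, x) = Cmp (coset_groupoid G H) (g', g <#\<^bsub>G\<^esub> x) (g, x)"
    if "g \<in> carrier G" "g' \<in> carrier G" "x \<in> lcosets\<^bsub>G\<^esub> H" for g g' x
    using category_Cod_Cmp[OF C, of "(g, x)" "(g', g <#\<^bsub>G\<^esub> x)"] that
    by (simp add: coset_groupoid_def translation_groupoid_def coset_action[OF T])
qed (simp_all add: coset_groupoid_def translation_groupoid_def)

lemma indexed_action_indices:
  "indexed_action {1..n} (index_cat G H n) (wreath G H n) (\<lambda>i. (i, ())) fst (\<lambda>m i. ((fst m, i), snd m i))"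
proof (rule indexed_action.intro)
  show "is_category (index_cat G H n)" by (rule is_category_index_cat)
  show "Group.monoid (wreath G H n)" by (rule monoid_wreath[OF G H])
  show "bij_betw (fst m) {1..n} {1..n}" if "m \<in> carrier (wreath G H n)" for m
    using that by (auto simp: wreath_def intro: permutes_imp_bij)
  show "((fst m, i), snd m i) \<in> Ar (index_cat G H n) \<and>
      Dom (index_cat G H n) ((fst m, i), snd m i) = (i, ()) \<and>
      Cod (index_cat G H n) ((fst m, i), snd m i) = (fst m i, ())"
    if "m \<in> carrier (wreath G H n)" "i \<in> {1..n}" for m i
    using that by (auto simp: wreath_def index_cat_def prod_cat_def index_groupoid_def
        translation_groupoid_def group_cat_def sym_group_def)
qed (auto simp: wreath_def index_cat_def prod_cat_def index_groupoid_def
        translation_groupoid_def group_cat_def sym_group_def)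

lemma p_smash_eq:
  "p_smash G H = smash_over (lcosets\<^bsub>G\<^esub> H) (coset_groupoid G H) G (\<lambda>x. x) (\<lambda>g x. g <#\<^bsub>G\<^esub> x) (\<lambda>g x. (g, x))"
  by (simp add: p_smash_def smash_over_def smash_over_ob_def[abs_def] Let_def)

lemma n_smash_eq:
  "n_smash G H n = smash_over {1..n} (index_cat G H n) (wreath G H n) (\<lambda>i. (i, ())) fst (\<lambda>m i. ((fst m, i), snd m i))"
  by (simp add: n_smash_def smash_over_def smash_over_ob_def[abs_def] Let_def case_prod_unfold)

interpretation cosets: indexed_action "lcosets\<^bsub>G\<^esub> H" "coset_groupoid G H" G "\<lambda>x. x" "\<lambda>g x. g <#\<^bsub>G\<^esub> x" "\<lambda>g x. (g, x)"
  by (rule indexed_action_cosets)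

interpretation indices: indexed_action "{1..n}" "index_cat G H n" "wreath G H n" "\<lambda>i. (i, ())" fst
    "\<lambda>m i. ((fst m, i), snd m i)"
  by (rule indexed_action_indices)

text \<open>The component of \<^const>\<open>reindex\<close>, with its identity maps written as arrows of \<^const>\<open>Spectra\<close> so that
  \<open>Smash_map_compose\<close> applies.\<close>

definition reindex_map where
  "reindex_map X = Smash_map {1..n} (lcosets\<^bsub>G\<^esub> H) (\<lambda>i. t i <#\<^bsub>G\<^esub> H)
     (\<lambda>i. Fo X (i, ())) (Fo (X \<circ>\<^sub>F beta G H n t)) (\<lambda>i. underlying (Idn Spectra (Fo X (i, ()))))"

lemma reindex_eq:
  "reindex G H n t X =
     (Fo (precomp Spectra (alpha G H n t) \<circ>\<^sub>F n_smash G H n) X,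
      Fo (p_smash G H \<circ>\<^sub>F precomp Spectra (beta G H n t)) X, \<lambda>_. reindex_map X)"
  by (simp add: reindex_def reindex_map_def)

lemma Fo_beta: "i \<in> {1..n} \<Longrightarrow> Fo (X \<circ>\<^sub>F beta G H n t) (t i <#\<^bsub>G\<^esub> H) = Fo X (i, ())"
  by (simp add: fcomp_def beta_def coset_groupoid_def translation_groupoid_def tr_in[OF T] tr_index_eq[OF T]
      del: atLeastAtMost_iff One_nat_def)

lemma Fa_beta:
  "i \<in> {1..n} \<Longrightarrow> g \<in> carrier G \<Longrightarrow> Fa (X \<circ>\<^sub>F beta G H n t) (g, t i <#\<^bsub>G\<^esub> H) =
    Fa X ((tr_sigma G H n t g, i), tr_h G H n t g i)"
  by (simp add: fcomp_def beta_def coset_groupoid_def translation_groupoid_def tr_in[OF T] tr_index_eq[OF T]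
      del: atLeastAtMost_iff One_nat_def)

lemma index_ob: "i \<in> {1..n} \<Longrightarrow> (i, ()) \<in> Ob (index_cat G H n)"
  by (rule indices.ob)

lemma reindex_family:
  assumes X: "is_functor (index_cat G H n) Spectra X" and i: "i \<in> {1..n}"
  shows "Idn Spectra (Fo X (i, ())) \<in> Ar Spectra \<and> Dom Spectra (Idn Spectra (Fo X (i, ()))) = Fo X (i, ()) \<and>
    Cod Spectra (Idn Spectra (Fo X (i, ()))) = Fo (X \<circ>\<^sub>F beta G H n t) (t i <#\<^bsub>G\<^esub> H)"
  using functor_Fo[OF X index_ob[OF i]] Fo_beta[OF i, of X]
  by (simp add: category_simps[OF is_category_Spectra])

text \<open>The arrow along which \<open>\<alpha>(g)\<close> moves the factor at \<open>i\<close> to the factor at \<open>\<sigma>\<^sub>g(i)\<close>. The restriction to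
  \<open>{1..n}\<close> is the one by which \<^const>\<open>alpha\<close> makes \<open>h(g)\<close> extensional.\<close>

abbreviation factor_arrow where
  "factor_arrow X g i \<equiv> Fa X ((tr_sigma G H n t g, i), (\<lambda>i\<in>{1..n}. tr_h G H n t g i) i)"

text \<open>The lower square on one object. After composing with the reindexing map, the two actions of \<open>g\<close> move the
  factor at \<open>i\<close> to the cosets \<open>t\<^bsub>\<sigma>\<^sub>g(i)\<^esub> H\<close> and \<open>g t\<^sub>i H\<close>, which are equal by \<open>tr_shift\<close>, and they do so along
  the same arrow by \<open>Fa_beta\<close>.\<close>

lemma nat_iso_reindex_component:
  assumes X: "is_functor (index_cat G H n) (Spectra :: ('a spectrum, 'a spmor) category) X"
  shows "nat_iso (group_cat G) Spectra (indices.P X \<circ>\<^sub>F alpha G H n t) (cosets.P (X \<circ>\<^sub>F beta G H n t)) (\<lambda>_. reindex_map X)"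
proof -
  note X\<beta> = functor_fcomp[OF is_functor_beta X]
  note fin = finite_lcosets
  let ?R = "reindex_map X"
  let ?Xi = "\<lambda>i. Fo X (i, ())" and ?Y = "Fo (X \<circ>\<^sub>F beta G H n t)"
  have arr: "?R \<in> Ar Spectra" "Dom Spectra ?R = Smash {1..n} ?Xi" "Cod Spectra ?R = Smash (lcosets\<^bsub>G\<^esub> H) ?Y"
    unfolding reindex_map_def
    by (rule Smash_map_arrow; use bij_transversal reindex_family[OF X] in auto)+
  have sq: "Cmp Spectra ?R (Smash_map {1..n} {1..n} (tr_sigma G H n t g) ?Xi ?Xi
        (\<lambda>i. underlying (factor_arrow X g i))) =
      Cmp Spectra (Smash_map (lcosets\<^bsub>G\<^esub> H) (lcosets\<^bsub>G\<^esub> H) (\<lambda>x. g <#\<^bsub>G\<^esub> x) ?Y ?Y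
        (\<lambda>x. underlying (Fa (X \<circ>\<^sub>F beta G H n t) (g, x)))) ?R"
    (is "Cmp Spectra ?R ?l = Cmp Spectra ?r ?R") if g: "g \<in> carrier G" for g
  proof -
    let ?m = "(tr_sigma G H n t g, \<lambda>i\<in>{1..n}. tr_h G H n t g i)"
    have m: "?m \<in> carrier (wreath G H n)"
      using functor_Fa[OF is_functor_alpha, of g] g by (simp add: group_cat_def alpha_def)
    have fam: "factor_arrow X g i \<in> Ar Spectra \<and>
        Dom Spectra (factor_arrow X g i) = ?Xi i \<and>
        Cod Spectra (factor_arrow X g i) = ?Xi (tr_sigma G H n t g i)"
      if "i \<in> {1..n}" for i
      using indices.functor_arrow[OF X m that] by simp
    have \<sigma>: "bij_betw (tr_sigma G H n t g) {1..n} {1..n}" using indices.bij[OF m] by simp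
    have "Cmp Spectra ?R ?l = Smash_map {1..n} (lcosets\<^bsub>G\<^esub> H) (\<lambda>i. t (tr_sigma G H n t g i) <#\<^bsub>G\<^esub> H) ?Xi ?Y
        (\<lambda>i. underlying (Cmp Spectra (Idn Spectra (?Xi (tr_sigma G H n t g i)))
          (factor_arrow X g i)))"
      unfolding reindex_map_def
      by (rule Smash_map_compose) (use \<sigma> bij_transversal fam reindex_family[OF X] in auto)
    also have "\<dots> = Smash_map {1..n} (lcosets\<^bsub>G\<^esub> H) (\<lambda>i. g <#\<^bsub>G\<^esub> (t i <#\<^bsub>G\<^esub> H)) ?Xi ?Y
        (\<lambda>i. underlying (Cmp Spectra (Fa (X \<circ>\<^sub>F beta G H n t) (g, t i <#\<^bsub>G\<^esub> H)) (Idn Spectra (?Xi i))))"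
    proof (rule Smash_map_cong)
      show "bij_betw (\<lambda>i. t (tr_sigma G H n t g i) <#\<^bsub>G\<^esub> H) {1..n} (lcosets\<^bsub>G\<^esub> H)"
        using bij_betw_trans[OF \<sigma> bij_transversal] by (simp add: o_def)
      fix i assume i: "i \<in> {1..n}"
      show "t (tr_sigma G H n t g i) <#\<^bsub>G\<^esub> H = g <#\<^bsub>G\<^esub> (t i <#\<^bsub>G\<^esub> H)"
        by (rule tr_shift[OF T g i, symmetric])
      show "underlying (Cmp Spectra (Idn Spectra (?Xi (tr_sigma G H n t g i)))
            (factor_arrow X g i)) =
          underlying (Cmp Spectra (Fa (X \<circ>\<^sub>F beta G H n t) (g, t i <#\<^bsub>G\<^esub> H)) (Idn Spectra (?Xi i)))"
        unfolding Fa_beta[OF i g] using fam[OF i] i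
        by (simp add: category_simps[OF is_category_Spectra] del: atLeastAtMost_iff One_nat_def)
    qed simp
    also have "\<dots> = Cmp Spectra ?r ?R"
      unfolding reindex_map_def
      by (rule Smash_map_compose[symmetric])
        (use bij_transversal bij_coset_action[OF g] reindex_family[OF X] cosets.functor_arrow[OF X\<beta> g] in auto)
    finally show ?thesis .
  qed
  have "nat_trans (group_cat G) Spectra (indices.P X \<circ>\<^sub>F alpha G H n t) (cosets.P (X \<circ>\<^sub>F beta G H n t)) (\<lambda>_. ?R)"
    unfolding nat_trans_def
  proof (intro conjI ballI)
    show "is_functor (group_cat G) Spectra (indices.P X \<circ>\<^sub>F alpha G H n t)"
      by (rule functor_fcomp[OF is_functor_alpha indices.is_functor_smash_over_ob[OF X]])
    show "is_functor (group_cat G) Spectra (cosets.P (X \<circ>\<^sub>F beta G H n t))"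
      by (rule cosets.is_functor_smash_over_ob[OF X\<beta>])
    show "(\<lambda>_. ?R) \<in> Ob (group_cat G) \<rightarrow>\<^sub>E Ar Spectra"
      by (rule PiE_I) (simp_all add: arr group_cat_def)
    fix x assume "x \<in> Ob (group_cat G)"
    show "Dom Spectra ?R = Fo (indices.P X \<circ>\<^sub>F alpha G H n t) x"
      by (simp add: arr fcomp_def alpha_def group_cat_def smash_over_ob_def)
    show "Cod Spectra ?R = Fo (cosets.P (X \<circ>\<^sub>F beta G H n t)) x"
      by (simp add: arr smash_over_ob_def)
  next
    fix g assume "g \<in> Ar (group_cat G)"
    then have g: "g \<in> carrier G" by (simp add: group_cat_def)
    have m: "(tr_sigma G H n t g, \<lambda>i\<in>{1..n}. tr_h G H n t g i) \<in> carrier (wreath G H n)"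
      using functor_Fa[OF is_functor_alpha, of g] g by (simp add: group_cat_def alpha_def)
    show "Cmp Spectra ?R (Fa (indices.P X \<circ>\<^sub>F alpha G H n t) g) =
        Cmp Spectra (Fa (cosets.P (X \<circ>\<^sub>F beta G H n t)) g) ?R"
      using sq[OF g] g m
      by (simp add: fcomp_def alpha_def group_cat_def smash_over_ob_def del: restrict_apply atLeastAtMost_iff)
        (simp add: restrict_def)
  qed
  moreover have "is_iso Spectra ?R"
    unfolding reindex_map_def underlying_Idn
    by (rule Smash_map_Idn_iso[OF _ bij_transversal])
      (use functor_Fo[OF X index_ob] Fo_beta in \<open>simp_all del: atLeastAtMost_iff One_nat_def\<close>)
  ultimately show ?thesis by (simp add: nat_iso_def)
qed

lemmas is_functor_n_smash = indices.is_functor_smash_over[folded n_smash_eq]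

lemmas is_functor_p_smash = cosets.is_functor_smash_over[folded p_smash_eq]

text \<open>Naturality in \<open>X\<close> holds on each factor, since the component of \<open>\<beta>\<^sup>*f\<close> at \<open>t\<^sub>i H\<close> is the component of \<open>f\<close> at \<open>i\<close>.\<close>

lemma nat_iso_reindex:
  "nat_iso
     (fun_cat (index_cat G H n) (Spectra :: ('a spectrum, 'a spmor) category))
     (fun_cat (group_cat G) (Spectra :: ('a smash_pt spectrum, 'a smash_pt spmor) category))
     (precomp Spectra (alpha G H n t) \<circ>\<^sub>F n_smash G H n)
     (p_smash G H \<circ>\<^sub>F precomp Spectra (beta G H n t))
     (\<lambda>X\<in>Ob (fun_cat (index_cat G H n) Spectra). reindex G H n t X)"
proof -
  let ?I = "fun_cat (index_cat G H n) (Spectra :: ('a spectrum, 'a spmor) category)"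
  let ?C = "fun_cat (group_cat G) (Spectra :: ('a smash_pt spectrum, 'a smash_pt spmor) category)"
  let ?L = "precomp (Spectra :: ('a smash_pt spectrum, 'a smash_pt spmor) category) (alpha G H n t) \<circ>\<^sub>F n_smash G H n"
  let ?R = "p_smash G H \<circ>\<^sub>F precomp (Spectra :: ('a spectrum, 'a spmor) category) (beta G H n t)"
  have L: "is_functor ?I ?C ?L"
    by (rule functor_fcomp[OF is_functor_n_smash is_functor_precomp[OF is_functor_alpha]])
  have R: "is_functor ?I ?C ?R"
    by (rule functor_fcomp[OF is_functor_precomp[OF is_functor_beta] is_functor_p_smash])
  have FoL: "Fo ?L X = indices.P X \<circ>\<^sub>F alpha G H n t"
    and FoR: "Fo ?R X = cosets.P (X \<circ>\<^sub>F beta G H n t)"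
    if X: "is_functor (index_cat G H n) Spectra X" for X
  proof -
    have "X \<in> Ob (Src (n_smash G H n))" "X \<in> Ob (Src (precomp Spectra (beta G H n t)))"
      using X by (simp_all add: functor_Src[OF is_functor_n_smash]
          functor_Src[OF is_functor_precomp[OF is_functor_beta]])
    then show "Fo ?L X = indices.P X \<circ>\<^sub>F alpha G H n t" "Fo ?R X = cosets.P (X \<circ>\<^sub>F beta G H n t)"
      using X
      by (simp_all add: fcomp_Fo n_smash_eq p_smash_eq indices.Fo_smash_over cosets.Fo_smash_over
          Fo_precomp[OF is_functor_alpha] Fo_precomp[OF is_functor_beta]
          indices.is_functor_smash_over_ob functor_fcomp[OF is_functor_beta] del: One_nat_def)
  qed
  have FaL: "Fa ?L (X, Y, f) = (indices.P X \<circ>\<^sub>F alpha G H n t, indices.P Y \<circ>\<^sub>F alpha G H n t,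
      \<lambda>_. indices.trans_map X Y f)"
    and FaR: "Fa ?R (X, Y, f) = (cosets.P (X \<circ>\<^sub>F beta G H n t), cosets.P (Y \<circ>\<^sub>F beta G H n t),
      \<lambda>_. cosets.trans_map (X \<circ>\<^sub>F beta G H n t) (Y \<circ>\<^sub>F beta G H n t)
        (\<lambda>x\<in>Ob (coset_groupoid G H). f (Fo (beta G H n t) x)))"
    if f: "nat_trans (index_cat G H n) Spectra X Y f" for X Y f
  proof -
    have a: "(X, Y, f) \<in> Ar (Src (n_smash G H n))" "(X, Y, f) \<in> Ar (Src (precomp Spectra (beta G H n t)))"
      using f by (simp_all add: functor_Src[OF is_functor_n_smash]
          functor_Src[OF is_functor_precomp[OF is_functor_beta]])
    show "Fa ?L (X, Y, f) = (indices.P X \<circ>\<^sub>F alpha G H n t, indices.P Y \<circ>\<^sub>F alpha G H n t,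
      \<lambda>_. indices.trans_map X Y f)"
      using f unfolding fcomp_Fa[OF a(1)] unfolding n_smash_eq
      by (simp add: indices.Fa_smash_over Fa_precomp[OF is_functor_alpha indices.nat_trans_smash_over]
          fun_eq_iff group_cat_def del: One_nat_def)
    show "Fa ?R (X, Y, f) = (cosets.P (X \<circ>\<^sub>F beta G H n t), cosets.P (Y \<circ>\<^sub>F beta G H n t),
      \<lambda>_. cosets.trans_map (X \<circ>\<^sub>F beta G H n t) (Y \<circ>\<^sub>F beta G H n t)
        (\<lambda>x\<in>Ob (coset_groupoid G H). f (Fo (beta G H n t) x)))"
      unfolding fcomp_Fa[OF a(2)] Fa_precomp[OF is_functor_beta f] unfolding p_smash_eq
      by (rule cosets.Fa_smash_over[OF nat_trans_precomp[OF is_functor_beta f]])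
  qed
  have re: "reindex G H n t X = (indices.P X \<circ>\<^sub>F alpha G H n t, cosets.P (X \<circ>\<^sub>F beta G H n t), \<lambda>_. reindex_map X)"
    if "is_functor (index_cat G H n) (Spectra :: ('a spectrum, 'a spmor) category) X" for X
    unfolding reindex_eq FoL[OF that] FoR[OF that] ..
  have sq: "Cmp Spectra (reindex_map Y)
        (indices.trans_map X Y f) =
      Cmp Spectra (cosets.trans_map (X \<circ>\<^sub>F beta G H n t) (Y \<circ>\<^sub>F beta G H n t)
        (\<lambda>x\<in>Ob (coset_groupoid G H). f (Fo (beta G H n t) x))) (reindex_map X)"
    (is "?l = ?r")
    if f: "nat_trans (index_cat G H n) (Spectra :: ('a spectrum, 'a spmor) category) X Y f" for X Y f
  proof -
    note X = nat_trans_source[OF f] and Y = nat_trans_target[OF f]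
    note f\<beta> = nat_trans_precomp[OF is_functor_beta f]
    have "?l = Smash_map {1..n} (lcosets\<^bsub>G\<^esub> H) (\<lambda>i. t i <#\<^bsub>G\<^esub> H) (\<lambda>i. Fo X (i, ())) (Fo (Y \<circ>\<^sub>F beta G H n t))
        (\<lambda>i. underlying (Cmp Spectra (Idn Spectra (Fo Y (i, ()))) (f (i, ()))))"
      unfolding reindex_map_def
      by (rule Smash_map_compose)
        (use indices.bij_id bij_transversal indices.nat_trans_arrow[OF f] reindex_family[OF Y] in auto)
    also have "\<dots> = Smash_map {1..n} (lcosets\<^bsub>G\<^esub> H) (\<lambda>i. t i <#\<^bsub>G\<^esub> H) (\<lambda>i. Fo X (i, ())) (Fo (Y \<circ>\<^sub>F beta G H n t))
        (\<lambda>i. underlying (Cmp Spectra ((\<lambda>x\<in>Ob (coset_groupoid G H). f (Fo (beta G H n t) x)) (t i <#\<^bsub>G\<^esub> H))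
          (Idn Spectra (Fo X (i, ())))))"
    proof (rule Smash_map_cong[OF _ bij_transversal])
      fix i assume i: "i \<in> {1..n}"
      have "(\<lambda>x\<in>Ob (coset_groupoid G H). f (Fo (beta G H n t) x)) (t i <#\<^bsub>G\<^esub> H) = f (i, ())"
        using i by (simp add: beta_def coset_groupoid_def translation_groupoid_def tr_in[OF T]
            tr_index_eq[OF T] del: atLeastAtMost_iff One_nat_def)
      then show "underlying (Cmp Spectra (Idn Spectra (Fo Y (i, ()))) (f (i, ()))) =
          underlying (Cmp Spectra ((\<lambda>x\<in>Ob (coset_groupoid G H). f (Fo (beta G H n t) x)) (t i <#\<^bsub>G\<^esub> H))
            (Idn Spectra (Fo X (i, ()))))"
        using indices.nat_trans_arrow[OF f i]
        by (simp add: category_Idn_left[OF is_category_Spectra] category_Idn_right[OF is_category_Spectra]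
            del: restrict_apply)
    qed simp_all
    also have "\<dots> = ?r"
      unfolding reindex_map_def
      by (rule Smash_map_compose[symmetric])
        (use finite_lcosets cosets.bij_id bij_transversal cosets.nat_trans_arrow[OF f\<beta>] reindex_family[OF X]
          in \<open>auto simp del: restrict_apply\<close>)
    finally show ?thesis .
  qed
  have "nat_trans ?I ?C ?L ?R (\<lambda>X\<in>Ob ?I. reindex G H n t X)"
    unfolding nat_trans_def
  proof (intro conjI ballI L R)
    show "(\<lambda>X\<in>Ob ?I. reindex G H n t X) \<in> Ob ?I \<rightarrow>\<^sub>E Ar ?C"
    proof (rule PiE_I)
      fix X assume "X \<in> Ob ?I"
      then have X: "is_functor (index_cat G H n) Spectra X" by simp
      show "(\<lambda>X\<in>Ob ?I. reindex G H n t X) X \<in> Ar ?C"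
        using nat_iso_reindex_component[OF X] X by (simp add: re[OF X] nat_iso_def)
    qed simp
    fix X assume "X \<in> Ob ?I"
    then have X: "is_functor (index_cat G H n) Spectra X" by simp
    show "Dom ?C ((\<lambda>X\<in>Ob ?I. reindex G H n t X) X) = Fo ?L X"
      "Cod ?C ((\<lambda>X\<in>Ob ?I. reindex G H n t X) X) = Fo ?R X"
      using X by (simp_all add: re[OF X] FoL[OF X] FoR[OF X])
  next
    fix a assume a: "a \<in> Ar ?I"
    obtain X Y f where XYf: "a = (X, Y, f)" by (cases a)
    have f: "nat_trans (index_cat G H n) Spectra X Y f" using a XYf by simp
    note X = nat_trans_source[OF f] and Y = nat_trans_target[OF f]
    show "Cmp ?C ((\<lambda>X\<in>Ob ?I. reindex G H n t X) (Cod ?I a)) (Fa ?L a) =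
        Cmp ?C (Fa ?R a) ((\<lambda>X\<in>Ob ?I. reindex G H n t X) (Dom ?I a))"
      using X Y
      by (simp add: XYf FaL[OF f] FaR[OF f] re[OF X] re[OF Y] Cmp_fun_cat sq[OF f] del: One_nat_def
          cong: restrict_cong)
  qed
  moreover have "is_iso ?C ((\<lambda>X\<in>Ob ?I. reindex G H n t X) X)" if "X \<in> Ob ?I" for X
  proof -
    have X: "is_functor (index_cat G H n) Spectra X" using that by simp
    show ?thesis using nat_iso_imp_is_iso[OF nat_iso_reindex_component[OF X]] X by (simp add: re[OF X])
  qed
  ultimately show ?thesis by (simp add: nat_iso_def)
qed

lemma is_functor_c_functor:
  "is_functor (fun_cat (subgroup_cat G H) (Spectra :: ('a spectrum, 'a spmor) category))
     (fun_cat (index_cat G H n) Spectra) (c_functor G H n)"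
  unfolding c_functor_def by (rule is_functor_precomp[OF is_functor_snd])

lemma kappa_eq: "kappa G H n t = snd_fctr (index_groupoid n) (subgroup_cat G H) \<circ>\<^sub>F beta G H n t"
proof -
  have "Fo (beta G H n t) x \<in> Ob (prod_cat (index_groupoid n) (subgroup_cat G H))" if "x \<in> lcosets\<^bsub>G\<^esub> H" for x
    using functor_Fo[OF is_functor_beta, of x] that
    by (simp add: index_cat_def coset_groupoid_def translation_groupoid_def)
  moreover have "Fa (beta G H n t) a \<in> Ar (prod_cat (index_groupoid n) (subgroup_cat G H))"
    if "a \<in> carrier G \<times> (lcosets\<^bsub>G\<^esub> H)" for a
    using functor_Fa[OF is_functor_beta, of a] that
    by (simp add: index_cat_def coset_groupoid_def translation_groupoid_def)
  ultimately show ?thesis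
    unfolding kappa_def fcomp_def snd_fctr_def
    by (auto simp: coset_groupoid_def translation_groupoid_def beta_def intro!: restrict_ext)
qed

lemma kappa_triangle:
  "precomp (Spectra :: ('a spectrum, 'a spmor) category) (kappa G H n t) =
    precomp Spectra (beta G H n t) \<circ>\<^sub>F c_functor G H n"
  unfolding kappa_eq c_functor_def by (rule precomp_fcomp[OF is_functor_beta is_functor_snd])

text \<open>The norms are the two paths around the square, precomposed with \<open>c\<close>; the triangle identifies
  \<open>\<beta>\<^sup>* \<circ> c\<close> with \<open>\<kappa>\<^sup>*\<close>.\<close>

lemma nat_iso_norms:
  "nat_iso
     (fun_cat (subgroup_cat G H) (Spectra :: ('a spectrum, 'a spmor) category))
     (fun_cat (group_cat G) (Spectra :: ('a smash_pt spectrum, 'a smash_pt spmor) category))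
     (gm_norm G H n t)
     (hhr_norm G H (kappa G H n t))
     (\<lambda>X\<in>Ob (fun_cat (subgroup_cat G H) Spectra). reindex G H n t (Fo (c_functor G H n) X))"
proof -
  let ?S = "Spectra :: ('a spectrum, 'a spmor) category"
  have gm: "gm_norm G H n t = (precomp Spectra (alpha G H n t) \<circ>\<^sub>F n_smash G H n) \<circ>\<^sub>F (c_functor G H n :: (_, _, _, (_, _, 'a spectrum, 'a spmor) ntrans) fctr)"
    unfolding gm_norm_def smash_power_def
    by (rule fcomp_assoc[OF is_functor_c_functor is_functor_n_smash])
  have hhr: "hhr_norm G H (kappa G H n t) = (p_smash G H \<circ>\<^sub>F precomp ?S (beta G H n t)) \<circ>\<^sub>F c_functor G H n"
    unfolding hhr_norm_def kappa_triangle
    by (rule fcomp_assoc[OF is_functor_c_functor is_functor_precomp[OF is_functor_beta]])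
  have family: "(\<lambda>X\<in>Ob (fun_cat (subgroup_cat G H) ?S). (\<lambda>X\<in>Ob (fun_cat (index_cat G H n) ?S). reindex G H n t X) (Fo (c_functor G H n) X)) =
      (\<lambda>X\<in>Ob (fun_cat (subgroup_cat G H) ?S). reindex G H n t (Fo (c_functor G H n) X))"
    using functor_Fo[OF is_functor_c_functor[where 'a = 'a]] by (intro restrict_ext) simp
  show ?thesis
    unfolding gm hhr family[symmetric] by (rule nat_iso_precomp[OF is_functor_c_functor nat_iso_reindex])
qed

end

theorem theorem8:
  fixes G :: "('g, 'b) monoid_scheme" and T :: "'g topology" and d :: nat
    and \<A> :: "('g set \<times> ('g \<Rightarrow> vec)) set" and H :: "'g set" and t :: "nat \<Rightarrow> 'g" and n :: nat
  assumes "compact_lie_group G T d \<A>"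
    and "subgroup H G"
    and "finite (lcosets\<^bsub>G\<^esub> H)"
    and "n = card (lcosets\<^bsub>G\<^esub> H)"
    and "transversal G H n t"
  shows
    "is_functor (fun_cat (subgroup_cat G H) (Spectra :: ('a spectrum, 'a spmor) category))
       (fun_cat (coset_groupoid G H) Spectra)
       (precomp Spectra (kappa G H n t)) \<and>
     is_functor (fun_cat (subgroup_cat G H) (Spectra :: ('a spectrum, 'a spmor) category))
       (fun_cat (index_cat G H n) Spectra)
       (c_functor G H n) \<and>
     is_functor (fun_cat (index_cat G H n) (Spectra :: ('a spectrum, 'a spmor) category))
       (fun_cat (coset_groupoid G H) Spectra)
       (precomp Spectra (beta G H n t)) \<and>
     is_functor (fun_cat (coset_groupoid G H) (Spectra :: ('a spectrum, 'a spmor) category))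
       (fun_cat (group_cat G) (Spectra :: ('a smash_pt spectrum, 'a smash_pt spmor) category))
       (p_smash G H) \<and>
     is_functor (fun_cat (index_cat G H n) (Spectra :: ('a spectrum, 'a spmor) category))
       (fun_cat (group_cat (wreath G H n)) (Spectra :: ('a smash_pt spectrum, 'a smash_pt spmor) category))
       (n_smash G H n) \<and>
     is_functor (fun_cat (group_cat (wreath G H n)) (Spectra :: ('a smash_pt spectrum, 'a smash_pt spmor) category))
       (fun_cat (group_cat G) Spectra)
       (precomp Spectra (alpha G H n t)) \<and>
     precomp (Spectra :: ('a spectrum, 'a spmor) category) (kappa G H n t) =
       precomp Spectra (beta G H n t) \<circ>\<^sub>F c_functor G H n \<and>
     nat_iso
       (fun_cat (index_cat G H n) (Spectra :: ('a spectrum, 'a spmor) category))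
       (fun_cat (group_cat G) (Spectra :: ('a smash_pt spectrum, 'a smash_pt spmor) category))
       (precomp Spectra (alpha G H n t) \<circ>\<^sub>F n_smash G H n)
       (p_smash G H \<circ>\<^sub>F precomp Spectra (beta G H n t))
       (\<lambda>X\<in>Ob (fun_cat (index_cat G H n) Spectra). reindex G H n t X) \<and>
     nat_iso
       (fun_cat (subgroup_cat G H) (Spectra :: ('a spectrum, 'a spmor) category))
       (fun_cat (group_cat G) (Spectra :: ('a smash_pt spectrum, 'a smash_pt spmor) category))
       (gm_norm G H n t)
       (hhr_norm G H (kappa G H n t))
       (\<lambda>X\<in>Ob (fun_cat (subgroup_cat G H) Spectra). reindex G H n t (Fo (c_functor G H n) X))"
proof -
  have G: "group G" using assms(1) by (simp add: compact_lie_group_def)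
  note T = G assms(2) assms(5)
  show ?thesis
    using is_functor_precomp[OF is_functor_kappa[OF T]] is_functor_c_functor[OF T]
      is_functor_precomp[OF is_functor_beta[OF T]] is_functor_p_smash[OF T] is_functor_n_smash[OF T]
      is_functor_precomp[OF is_functor_alpha[OF T]] kappa_triangle[OF T]
      nat_iso_reindex[OF T] nat_iso_norms[OF T]
    by (intro conjI)
qed

end
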